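(* Let $M$ be an Orlicz function such that $M\in\Delta_2^\infty$ and $\tilde M\in\Delta_2^\infty$, and suppose there exists a function $\psi\in C_M^\infty$ such that $1/\psi^{-1}\in L_M=L_M[0,1]$ and, for some $C>0$, $$\psi(uv)\le C\psi(u)\psi(v)\quad\text{for all }0\le u,v\le1.$$ Then there is a strongly embedded subspace $H$ of $L_M$ such that the unit ball $B_H=\{x\in H:\|x\|_{L_M}\le1\}$ fails to have equi-absolutely continuous norms in $L_M$.
   Context: An Orlicz function is an increasing convex continuous function $M$ on $[0,\infty)$ with $M(0)=0$, $\lim_{t\to\infty}M(t)=\infty$, normalized by $M(1)=1$. $L_M=L_M[0,1]$ is the Orlicz space of measurable functions on $[0,1]$ with Lebesgue measure $m$, with norm $\|f\|_{L_M}=\inf\{\lambda>0:\int_0^1M(|f(t)|/\lambda)\,dt\le1\}$. The Young conjugate is $\tilde M(u)=\sup_{t>0}(ut-M(t))$, $u>0$. $Q\in\Delta_2^\infty$ means that $Q$ is finite and there are $K,u_0>0$ with $Q(2u)\le KQ(u)$ for all $u\ge u_0$ (for Orlicz functions normalized at $1$ this is the same as $\sup_{u\ge1}Q(2u)/Q(u)<\infty$). For $M\in\Delta_2^\infty$, let $E_{M,A}^\infty$ be the closure in $C[0,1]$ of the set of functions $x\mapsto M(xy)/M(y)$, $y>A$; $E_M^\infty=\bigcap_{A>0}E_{M,A}^\infty$; and $C_M^\infty$ the closed convex hull of $E_M^\infty$ in $C[0,1]$. Elements $\psi\in C_M^\infty$ are (restrictions to $[0,1]$ of) Orlicz functions with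 $\psi(1)=1$; $\psi^{-1}:[0,1]\to[0,1]$ is the inverse function and $1/\psi^{-1}$ denotes the function $t\mapsto1/\psi^{-1}(t)$ on $(0,1]$. A subspace means a closed linear subspace. A subspace $H$ of $L_M$ is strongly embedded in $L_M$ if, for sequences in $H$, convergence in the $L_M$-norm is equivalent to convergence in measure. A set $K\subset L_M$ has equi-absolutely continuous norms in $L_M$ if $\lim_{\delta\to0}\sup_{m(E)<\delta}\sup_{x\in K}\|x\chi_E\|_{L_M}=0$. *)

theory Defs
  imports "HOL-Analysis.Analysis"
begin

text \<open>Orlicz functions live on \<open>[0,\<infinity>)\<close>; their values at negative reals are irrelevant.\<close>

definition orlicz_function :: "(real \<Rightarrow> real) \<Rightarrow> bool" where
  "orlicz_function M \<longleftrightarrow>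
     strict_mono_on {0..} M \<and> convex_on {0..} M \<and> continuous_on {0..} M \<and>
     M 0 = 0 \<and> filterlim M at_top at_top \<and> M 1 = 1"

definition young_conjugate :: "(real \<Rightarrow> real) \<Rightarrow> real \<Rightarrow> ereal" where
  "young_conjugate M u = (SUP t\<in>{0<..}. ereal (u * t - M t))"

text \<open>The argument is extended-valued so that it also applies to Young conjugates.\<close>

definition Delta2_infinity :: "(real \<Rightarrow> ereal) \<Rightarrow> bool" where
  "Delta2_infinity Q \<longleftrightarrow>
     (\<forall>u>0. \<bar>Q u\<bar> \<noteq> \<infinity>) \<and>
     (\<exists>K>0. \<exists>u0>0. \<forall>u\<ge>u0. Q (2 * u) \<le> ereal K * Q u)"

text \<open>Elements of \<open>L\<^sub>M[0,1]\<close> are represented by functions rather than by almost-everywhere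
  classes, and \<open>orlicz_norm\<close> is therefore a seminorm. Outside \<open>[0,1]\<close> the
  representatives are arbitrary. The norm is meaningful only on \<open>orlicz_space M\<close>
  (otherwise the set under the infimum is empty).\<close>

definition orlicz_space :: "(real \<Rightarrow> real) \<Rightarrow> (real \<Rightarrow> real) set" where
  "orlicz_space M =
     {f \<in> borel_measurable (lebesgue_on {0..1}).
        \<exists>c>0. (\<integral>\<^sup>+ t. ennreal (M (\<bar>f t\<bar> / c)) \<partial>lebesgue_on {0..1}) \<le> 1}"

definition orlicz_norm :: "(real \<Rightarrow> real) \<Rightarrow> (real \<Rightarrow> real) \<Rightarrow> real" where
  "orlicz_norm M f =
     Inf {c. c > 0 \<and> (\<integral>\<^sup>+ t. ennreal (M (\<bar>f t\<bar> / c)) \<partial>lebesgue_on {0..1}) \<le> 1}"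

text \<open>The metric space \<open>C[0,1]\<close>; its points are extended by \<open>undefined\<close> outside \<open>[0,1]\<close>,
  which is why members are built with \<open>restrict\<close>.\<close>

abbreviation C01 :: "(real \<Rightarrow> real) metric" where
  "C01 \<equiv> cfunspace (top_of_set {0..1}) euclidean_metric"

definition E_infinity_from :: "(real \<Rightarrow> real) \<Rightarrow> real \<Rightarrow> (real \<Rightarrow> real) set" where
  "E_infinity_from M A =
     mtopology_of C01 closure_of {restrict (\<lambda>x. M (x * y) / M y) {0..1} | y. y > A}"

definition E_infinity :: "(real \<Rightarrow> real) \<Rightarrow> (real \<Rightarrow> real) set" where
  "E_infinity M = (\<Inter>A\<in>{0<..}. E_infinity_from M A)"

text \<open>The library predicate \<open>convex\<close> needs a vector space type, which \<open>C01\<close> is not.\<close>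

definition convex_in_C01 :: "(real \<Rightarrow> real) set \<Rightarrow> bool" where
  "convex_in_C01 K \<longleftrightarrow>
     (\<forall>f\<in>K. \<forall>g\<in>K. \<forall>a\<in>{0..1}. restrict (\<lambda>x. (1 - a) * f x + a * g x) {0..1} \<in> K)"

definition C_infinity :: "(real \<Rightarrow> real) \<Rightarrow> (real \<Rightarrow> real) set" where
  "C_infinity M =
     (\<lambda>K. closedin (mtopology_of C01) K \<and> convex_in_C01 K) hull (E_infinity M)"

text \<open>Closedness forces a subspace to contain every function that is almost everywhere
  equal to one of its members, so these sets correspond exactly to the closed linear
  subspaces of the normed space of classes.\<close>

definition closed_subspace :: "(real \<Rightarrow> real) \<Rightarrow> (real \<Rightarrow> real) set \<Rightarrow> bool" where
  "closed_subspace M H \<longleftrightarrow>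
     H \<subseteq> orlicz_space M \<and> (\<lambda>t. 0) \<in> H \<and>
     (\<forall>f\<in>H. \<forall>g\<in>H. (\<lambda>t. f t + g t) \<in> H) \<and>
     (\<forall>c. \<forall>f\<in>H. (\<lambda>t. c * f t) \<in> H) \<and>
     (\<forall>x f. (\<forall>n::nat. x n \<in> H) \<and> f \<in> orlicz_space M \<and>
        (\<lambda>n. orlicz_norm M (\<lambda>t. x n t - f t)) \<longlonglongrightarrow> 0 \<longrightarrow> f \<in> H)"

definition converges_in_measure :: "(nat \<Rightarrow> real \<Rightarrow> real) \<Rightarrow> (real \<Rightarrow> real) \<Rightarrow> bool" where
  "converges_in_measure x f \<longleftrightarrow>
     (\<forall>\<epsilon>>0. (\<lambda>n. measure (lebesgue_on {0..1}) {t \<in> {0..1}. \<bar>x n t - f t\<bar> > \<epsilon>}) \<longlonglongrightarrow> 0)"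

definition strongly_embedded :: "(real \<Rightarrow> real) \<Rightarrow> (real \<Rightarrow> real) set \<Rightarrow> bool" where
  "strongly_embedded M H \<longleftrightarrow>
     (\<forall>x f. (\<forall>n. x n \<in> H) \<and> f \<in> H \<longrightarrow>
        ((\<lambda>n. orlicz_norm M (\<lambda>t. x n t - f t)) \<longlonglongrightarrow> 0 \<longleftrightarrow> converges_in_measure x f))"

text \<open>Suprema are taken in \<open>ennreal\<close>, so no boundedness is presupposed.\<close>

definition equi_absolutely_continuous_norms ::
    "(real \<Rightarrow> real) \<Rightarrow> (real \<Rightarrow> real) set \<Rightarrow> bool" where
  "equi_absolutely_continuous_norms M K \<longleftrightarrow>
     ((\<lambda>\<delta>. SUP E\<in>{E \<in> sets (lebesgue_on {0..1}). measure (lebesgue_on {0..1}) E < \<delta>}.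
             SUP x\<in>K. ennreal (orlicz_norm M (\<lambda>t. x t * indicator E t)))
        \<longlongrightarrow> 0) (at_right 0)"

end

theory Submission
  imports Defs
begin

text \<open>
  The subspace is spanned by \<open>x\<^sub>n = f\<^sub>n + g\<^sub>n\<close>, where the \<open>g\<^sub>n\<close> are disjoint bumps that destroy
  equi-absolute continuity and the \<open>f\<^sub>n\<close> are independent symmetric variables that dominate the
  bumps already in the sense of convergence in measure.

  The bumps. A function \<open>x \<mapsto> M (x y) / M y\<close> is the modular of \<open>x g\<close>, where \<open>g\<close> takes the value \<open>y\<close> on a
  set of measure \<open>1 / M y\<close>. Putting several such values next to each other realizes convex
  combinations, so every \<open>\<psi>\<close> in the closed convex hull is, up to an arbitrarily small uniform error,
  the function \<open>x \<mapsto> \<integral> M (x g)\<close> for some \<open>g\<close> with arbitrarily small support (\<open>C_infinity_realize\<close>).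
  With summable errors, the modular of \<open>\<Sum> c\<^sub>n g\<^sub>n\<close> exceeds \<open>\<Sum> \<psi> \<bar>c\<^sub>n\<bar>\<close> by at most a constant, while \<open>g\<^sub>n\<close>
  keeps norm at least \<open>1/2\<close> on a set of vanishing measure.

  The random part. Up to symmetrisation and discretisation, \<open>\<bar>f\<^sub>n\<bar>\<close> is distributed like
  \<open>h = 1 / \<psi>\<^sup>-\<^sup>1\<close>, so that \<open>\<psi> \<bar>c\<bar>\<close> is the probability of \<open>\<bar>c\<bar> h \<ge> 1\<close>. The size of \<open>S = \<Sum> c\<^sub>n f\<^sub>n\<close> is measured by
  \<open>B = \<Sum> E (min 1 (c\<^sub>n f\<^sub>n)\<^sup>2)\<close>, and \<open>\<Sum> \<psi> \<bar>c\<^sub>n\<bar>\<close> is, when all \<open>\<bar>c\<^sub>n\<bar> \<le> 1\<close>, at most a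
  constant multiple of \<open>B\<close> plus a constant. Two estimates are needed.

  \<^item> If \<open>B\<close> is small, then the modular of \<open>S / 2\<close> is bounded (\<open>digit_sum_modular_bound\<close>). The summands
    are cut at \<open>1\<close>: the small parts have a sum with bounded exponential moments; of the large parts
    only few are nonzero at a time, so that the modular of their sum is controlled by
    the sum of their modulars. The latter is where the hypotheses on \<open>\<psi>\<close> enter: by submultiplicativity the
    part of \<open>c h\<close> above \<open>1\<close> is a dilation of a function dominated by \<open>h\<close>, hence its modular is at most
    \<open>C \<psi> c\<close> times that of \<open>h\<close> (\<open>tail_dilation\<close>, \<open>tail_modular_le\<close>).

  \<^item> If \<open>B\<close> is not small, then \<open>S\<close> is not small in measure (\<open>digit_sum_lower_bound\<close>). The
    characteristic function of \<open>S\<close> is a product, and a product of factors \<open>1 - b\<^sub>n \<in> [0,1]\<close> is at most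
    \<open>1 / (1 + \<Sum> b\<^sub>n)\<close>.

  Since the bumps live on a set of measure \<open>1/256\<close>, the second estimate also holds for combinations of the
  \<open>x\<^sub>n\<close>. Together: a combination that is small in measure has norm at most a fixed constant. By
  homogeneity a sequence of combinations tending to \<open>0\<close> in measure tends to \<open>0\<close> in norm, and this
  passes to the closure (\<open>strongly_embedded_closure\<close>).

  The independent variables are functions of the digits of the points of \<open>[0,1]\<close> in a mixed radix expansion. As
  each of them depends on one digit, all expectations are finite averages, and independence is
  a statement about division with remainder (\<open>digits_independent\<close>).
\<close>

section \<open>The modular and the norm of an Orlicz space\<close>

abbreviation unit_interval_measure :: "real measure" ("\<U>") where
  "\<U> \<equiv> lebesgue_on {0..1}"

lemma space_U [simp]: "space \<U> = {0..1}"
  by (simp add: space_restrict_space)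

lemma emeasure_U_space: "emeasure \<U> {0..1} = 1"
  by (simp add: emeasure_restrict_space)

lemma finite_measure_U: "finite_measure \<U>"
  by (rule finite_measureI) (simp add: emeasure_U_space)

lemma borel_imp_measurable_U: "f \<in> borel_measurable borel \<Longrightarrow> f \<in> borel_measurable \<U>"
  by (intro measurable_restrict_space1 measurable_completion) simp

definition modular :: "(real \<Rightarrow> real) \<Rightarrow> (real \<Rightarrow> real) \<Rightarrow> real \<Rightarrow> ennreal" where
  "modular M f c = (\<integral>\<^sup>+ t. ennreal (M (\<bar>f t\<bar> / c)) \<partial>\<U>)"

lemma orlicz_space_iff:
  "f \<in> orlicz_space M \<longleftrightarrow> f \<in> borel_measurable \<U> \<and> (\<exists>c>0. modular M f c \<le> 1)"
  by (simp add: orlicz_space_def modular_def)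

lemma orlicz_norm_eq: "orlicz_norm M f = Inf {c. c > 0 \<and> modular M f c \<le> 1}"
  by (simp add: orlicz_norm_def modular_def)

lemma orlicz_space_measurable: "f \<in> orlicz_space M \<Longrightarrow> f \<in> borel_measurable \<U>"
  by (simp add: orlicz_space_iff)

lemma orlicz_norm_le: "\<lbrakk>c > 0; modular M f c \<le> 1\<rbrakk> \<Longrightarrow> orlicz_norm M f \<le> c"
  unfolding orlicz_norm_eq by (rule cInf_lower) (auto intro!: bdd_belowI[of _ 0])

lemma orlicz_norm_nonneg:
  assumes "f \<in> orlicz_space M" shows "orlicz_norm M f \<ge> 0"
  unfolding orlicz_norm_eq by (rule cInf_greatest) (use assms in \<open>auto simp: orlicz_space_iff\<close>)

lemma orlicz_norm_lessE:
  assumes "f \<in> orlicz_space M" "orlicz_norm M f < c"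
  obtains d where "0 < d" "d < c" "modular M f d \<le> 1"
proof -
  have "{c. c > 0 \<and> modular M f c \<le> 1} \<noteq> {}" using assms(1) by (auto simp: orlicz_space_iff)
  from cInf_lessD[OF this assms(2)[unfolded orlicz_norm_eq]] that show ?thesis by auto
qed

locale orlicz =
  fixes M :: "real \<Rightarrow> real"
  assumes orlicz: "orlicz_function M"
begin

lemma M_0 [simp]: "M 0 = 0" and M_1 [simp]: "M 1 = 1"
  and M_continuous: "continuous_on {0..} M" and M_convex: "convex_on {0..} M"
  and M_at_top: "filterlim M at_top at_top" and M_strict: "strict_mono_on {0..} M"
  using orlicz by (auto simp: orlicz_function_def)

lemma M_mono: "\<lbrakk>0 \<le> a; a \<le> b\<rbrakk> \<Longrightarrow> M a \<le> M b"
  using M_strict by (cases "a = b") (auto simp: strict_mono_on_def less_imp_le)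

lemma M_nonneg: "0 \<le> a \<Longrightarrow> 0 \<le> M a"
  using M_mono[of 0 a] by simp

lemma M_ge_1: "1 \<le> a \<Longrightarrow> 1 \<le> M a"
  using M_mono[of 1 a] by simp

lemma M_convexD: "\<lbrakk>0 \<le> a; 0 \<le> b; 0 \<le> p; p \<le> 1\<rbrakk> \<Longrightarrow> M ((1 - p) * a + p * b) \<le> (1 - p) * M a + p * M b"
  using convex_onD[OF M_convex, of p a b] by simp

lemma M_scale: "\<lbrakk>0 \<le> a; a \<le> 1; 0 \<le> t\<rbrakk> \<Longrightarrow> M (a * t) \<le> a * M t"
  using M_convexD[of 0 t a] by simp

lemma M_abs_measurable: "(\<lambda>x. M \<bar>x\<bar>) \<in> borel_measurable borel"
  by (intro borel_measurable_continuous_onI continuous_on_compose2[OF M_continuous])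
     (auto intro!: continuous_intros)

lemma modular_measurable:
  assumes "f \<in> borel_measurable \<U>" "c > 0"
  shows "(\<lambda>t. ennreal (M (\<bar>f t\<bar> / c))) \<in> borel_measurable \<U>"
proof -
  have "(\<lambda>t. M \<bar>f t / c\<bar>) \<in> borel_measurable \<U>"
    using assms by (intro measurable_compose[OF _ M_abs_measurable]) simp
  with assms(2) show ?thesis by (simp add: abs_divide)
qed

text \<open>By convexity, division of the argument by \<open>B\<close> divides the modular by at least \<open>B\<close>; so any bound
  on the modular is a bound on the norm.\<close>

lemma modular_rescale:
  assumes "f \<in> borel_measurable \<U>" "c > 0" "B \<ge> 1" "modular M f c \<le> ennreal B"
  shows "modular M f (B * c) \<le> 1"
proof -
  have "modular M f (B * c) \<le> (\<integral>\<^sup>+ t. ennreal (1/B) * ennreal (M (\<bar>f t\<bar> / c)) \<partial>\<U>)"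
    unfolding modular_def
  proof (intro nn_integral_mono)
    fix t
    have "M ((1/B) * (\<bar>f t\<bar> / c)) \<le> (1/B) * M (\<bar>f t\<bar> / c)"
      using assms by (intro M_scale) auto
    then show "ennreal (M (\<bar>f t\<bar> / (B * c))) \<le> ennreal (1/B) * ennreal (M (\<bar>f t\<bar> / c))"
      using assms M_nonneg[of "\<bar>f t\<bar> / c"] by (simp flip: ennreal_mult add: field_simps ennreal_leI)
  qed
  also have "\<dots> = ennreal (1/B) * modular M f c"
    unfolding modular_def using assms by (intro nn_integral_cmult modular_measurable) auto
  also have "\<dots> \<le> ennreal (1/B) * ennreal B"
    using assms by (intro mult_left_mono) auto
  also have "\<dots> = 1"
    using assms by (simp flip: ennreal_mult)
  finally show ?thesis .
qed

lemma orlicz_norm_le_modular: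
  assumes "f \<in> borel_measurable \<U>" "c > 0" "B \<ge> 1" "modular M f c \<le> ennreal B"
  shows "f \<in> orlicz_space M" "orlicz_norm M f \<le> B * c"
proof -
  have *: "modular M f (B * c) \<le> 1" "B * c > 0" using modular_rescale[OF assms] assms by auto
  then show "f \<in> orlicz_space M" using assms(1) unfolding orlicz_space_iff by blast
  from * show "orlicz_norm M f \<le> B * c" by (intro orlicz_norm_le)
qed

text \<open>The triangle inequality at the level of modulars: \<open>(f + g) / (a + b)\<close> is the convex combination of
  \<open>f / a\<close> and \<open>g / b\<close> with weights proportional to \<open>a\<close> and \<open>b\<close>.\<close>

lemma modular_add:
  assumes "f \<in> borel_measurable \<U>" "g \<in> borel_measurable \<U>" "a > 0" "b > 0"
    "modular M f a \<le> 1" "modular M g b \<le> 1"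
  shows "modular M (\<lambda>t. f t + g t) (a + b) \<le> 1"
proof -
  let ?p = "b / (a + b)"
  have p: "0 \<le> ?p" "?p \<le> 1" "1 - ?p = a / (a + b)" "0 \<le> 1 - ?p"
    using assms by (auto simp: field_simps)
  have "modular M (\<lambda>t. f t + g t) (a + b) \<le>
      (\<integral>\<^sup>+ t. ennreal (1 - ?p) * ennreal (M (\<bar>f t\<bar> / a)) + ennreal ?p * ennreal (M (\<bar>g t\<bar> / b)) \<partial>\<U>)"
    unfolding modular_def
  proof (intro nn_integral_mono)
    fix t
    have "\<bar>f t + g t\<bar> / (a + b) \<le> (1 - ?p) * (\<bar>f t\<bar> / a) + ?p * (\<bar>g t\<bar> / b)"
    proof -
      have "(1 - ?p) * (\<bar>f t\<bar> / a) + ?p * (\<bar>g t\<bar> / b) = (\<bar>f t\<bar> + \<bar>g t\<bar>) / (a + b)"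
        unfolding p(3) using assms by (simp add: add_divide_distrib)
      then show ?thesis using assms by (simp add: divide_right_mono)
    qed
    then have "M (\<bar>f t + g t\<bar> / (a + b)) \<le> M ((1 - ?p) * (\<bar>f t\<bar> / a) + ?p * (\<bar>g t\<bar> / b))"
      using assms by (intro M_mono) auto
    also have "\<dots> \<le> (1 - ?p) * M (\<bar>f t\<bar> / a) + ?p * M (\<bar>g t\<bar> / b)"
      using assms p by (intro M_convexD) auto
    finally have "ennreal (M (\<bar>f t + g t\<bar> / (a + b))) \<le> ennreal \<dots>" by (rule ennreal_leI)
    also have "\<dots> = ennreal (1 - ?p) * ennreal (M (\<bar>f t\<bar> / a)) + ennreal ?p * ennreal (M (\<bar>g t\<bar> / b))"
    proof -
      have "0 \<le> M (\<bar>f t\<bar> / a)" "0 \<le> M (\<bar>g t\<bar> / b)" using assms by (auto intro!: M_nonneg)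
      then show ?thesis
        using p by (subst ennreal_plus) (auto simp only: ennreal_mult mult_nonneg_nonneg)
    qed
    finally show "ennreal (M (\<bar>f t + g t\<bar> / (a + b))) \<le>
      ennreal (1 - ?p) * ennreal (M (\<bar>f t\<bar> / a)) + ennreal ?p * ennreal (M (\<bar>g t\<bar> / b))" .
  qed
  also have "\<dots> = ennreal (1 - ?p) * modular M f a + ennreal ?p * modular M g b"
    unfolding modular_def
    using modular_measurable[OF assms(1,3)] modular_measurable[OF assms(2,4)]
    by (subst nn_integral_add) (auto simp: nn_integral_cmult)
  also have "\<dots> \<le> ennreal (1 - ?p) * 1 + ennreal ?p * 1"
    using assms by (intro add_mono mult_left_mono) auto
  also have "\<dots> = ennreal (1 - ?p + ?p)" using p by (subst ennreal_plus) auto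
  finally show ?thesis by simp
qed

lemma orlicz_space_add:
  assumes "f \<in> orlicz_space M" "g \<in> orlicz_space M"
  shows "(\<lambda>t. f t + g t) \<in> orlicz_space M"
proof -
  obtain a b where "a > 0" "modular M f a \<le> 1" "b > 0" "modular M g b \<le> 1"
    using assms by (auto simp: orlicz_space_iff)
  with modular_add[of f g a b] assms show ?thesis
    by (auto simp: orlicz_space_iff intro!: exI[of _ "a + b"])
qed

lemma orlicz_norm_triangle:
  assumes "f \<in> orlicz_space M" "g \<in> orlicz_space M"
  shows "orlicz_norm M (\<lambda>t. f t + g t) \<le> orlicz_norm M f + orlicz_norm M g"
proof (rule field_le_epsilon)
  fix e :: real assume "e > 0"
  obtain a where a: "0 < a" "a < orlicz_norm M f + e/2" "modular M f a \<le> 1"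
    using orlicz_norm_lessE[OF assms(1), of "orlicz_norm M f + e/2"] \<open>e > 0\<close> by auto
  obtain b where b: "0 < b" "b < orlicz_norm M g + e/2" "modular M g b \<le> 1"
    using orlicz_norm_lessE[OF assms(2), of "orlicz_norm M g + e/2"] \<open>e > 0\<close> by auto
  have "orlicz_norm M (\<lambda>t. f t + g t) \<le> a + b"
    using a b assms by (intro orlicz_norm_le modular_add orlicz_space_measurable) auto
  with a b show "orlicz_norm M (\<lambda>t. f t + g t) \<le> orlicz_norm M f + orlicz_norm M g + e" by simp
qed

lemma zero_in_orlicz_space: "(\<lambda>t. 0) \<in> orlicz_space M"
  by (auto simp: orlicz_space_iff modular_def intro!: exI[of _ 1])

lemma orlicz_norm_zero: "orlicz_norm M (\<lambda>t. 0) = 0"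
proof -
  have "orlicz_norm M (\<lambda>t. 0) \<le> 0 + e" if "e > 0" for e :: real
    using that by (intro orlicz_norm_le) (auto simp: modular_def)
  then have "orlicz_norm M (\<lambda>t. 0) \<le> 0" by (rule field_le_epsilon)
  with orlicz_norm_nonneg[OF zero_in_orlicz_space] show ?thesis by simp
qed

lemma modular_cmult: "a \<noteq> 0 \<Longrightarrow> modular M (\<lambda>t. a * f t) (\<bar>a\<bar> * c) = modular M f c"
  unfolding modular_def by (simp add: abs_mult)

lemma orlicz_space_cmult:
  assumes "f \<in> orlicz_space M" shows "(\<lambda>t. a * f t) \<in> orlicz_space M"
proof (cases "a = 0")
  case False
  obtain c where "c > 0" "modular M f c \<le> 1" using assms by (auto simp: orlicz_space_iff)
  then have "\<bar>a\<bar> * c > 0" "modular M (\<lambda>t. a * f t) (\<bar>a\<bar> * c) \<le> 1"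
    using False by (auto simp: modular_cmult)
  then show ?thesis using assms unfolding orlicz_space_iff by (intro conjI) auto
qed (simp add: zero_in_orlicz_space)

lemma orlicz_norm_cmult_le:
  assumes "f \<in> orlicz_space M" shows "orlicz_norm M (\<lambda>t. a * f t) \<le> \<bar>a\<bar> * orlicz_norm M f"
proof (cases "a = 0")
  case False
  have "orlicz_norm M (\<lambda>t. a * f t) / \<bar>a\<bar> \<le> orlicz_norm M f"
  proof (rule field_le_epsilon)
    fix e :: real assume "e > 0"
    then obtain d where d: "0 < d" "d < orlicz_norm M f + e" "modular M f d \<le> 1"
      using orlicz_norm_lessE[OF assms, of "orlicz_norm M f + e"] by auto
    have "orlicz_norm M (\<lambda>t. a * f t) \<le> \<bar>a\<bar> * d"
      using d False by (intro orlicz_norm_le) (auto simp: modular_cmult)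
    then have "orlicz_norm M (\<lambda>t. a * f t) / \<bar>a\<bar> \<le> d" using False by (simp add: field_simps)
    with d show "orlicz_norm M (\<lambda>t. a * f t) / \<bar>a\<bar> \<le> orlicz_norm M f + e" by simp
  qed
  then show ?thesis using False by (simp add: field_simps)
qed (simp add: orlicz_norm_zero)

lemma orlicz_norm_cmult:
  assumes "f \<in> orlicz_space M" shows "orlicz_norm M (\<lambda>t. a * f t) = \<bar>a\<bar> * orlicz_norm M f"
proof (cases "a = 0")
  case False
  have "orlicz_norm M (\<lambda>t. inverse a * (a * f t)) \<le> \<bar>inverse a\<bar> * orlicz_norm M (\<lambda>t. a * f t)"
    by (intro orlicz_norm_cmult_le orlicz_space_cmult assms)
  then have "orlicz_norm M f \<le> orlicz_norm M (\<lambda>t. a * f t) / \<bar>a\<bar>"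
    using False by (simp add: field_simps flip: mult.assoc)
  with orlicz_norm_cmult_le[OF assms, of a] False show ?thesis
    by (intro antisym) (auto simp: field_simps)
qed (simp add: orlicz_norm_zero)

lemma orlicz_space_diff:
  "\<lbrakk>f \<in> orlicz_space M; g \<in> orlicz_space M\<rbrakk> \<Longrightarrow> (\<lambda>t. f t - g t) \<in> orlicz_space M"
  using orlicz_space_add[of f "\<lambda>t. -1 * g t"] orlicz_space_cmult[of g "-1"] by simp

lemma orlicz_norm_diff_commute:
  "\<lbrakk>f \<in> orlicz_space M; g \<in> orlicz_space M\<rbrakk> \<Longrightarrow>
    orlicz_norm M (\<lambda>t. f t - g t) = orlicz_norm M (\<lambda>t. g t - f t)"
  using orlicz_norm_cmult[OF orlicz_space_diff[of f g], of "-1"] by simp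

text \<open>Chebyshev's inequality for the modular: functions of small norm are small in measure.\<close>

lemma small_norm_small_in_measure:
  assumes "\<epsilon> > 0" "\<eta> > 0"
  obtains e where "e > 0"
    "\<And>f. \<lbrakk>f \<in> orlicz_space M; orlicz_norm M f < e\<rbrakk> \<Longrightarrow> measure \<U> {t \<in> {0..1}. \<bar>f t\<bar> > \<epsilon>} \<le> \<eta>"
proof -
  from M_at_top have "eventually (\<lambda>x. M x \<ge> 1/\<eta>) at_top" by (simp add: filterlim_at_top)
  then obtain R where R: "\<And>x. x \<ge> R \<Longrightarrow> M x \<ge> 1/\<eta>" by (auto simp: eventually_at_top_linorder)
  define e where "e = \<epsilon> / max R 1"
  have e: "e > 0" "M (\<epsilon> / e) \<ge> 1/\<eta>" using assms R[of "max R 1"] by (auto simp: e_def)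
  show ?thesis
  proof
    show "e > 0" by (fact e)
    fix f assume f: "f \<in> orlicz_space M" "orlicz_norm M f < e"
    then obtain d where d: "0 < d" "d < e" "modular M f d \<le> 1" by (elim orlicz_norm_lessE)
    let ?A = "{t \<in> {0..1}. \<bar>f t\<bar> > \<epsilon>}"
    have meas: "f \<in> borel_measurable \<U>" using f by (simp add: orlicz_space_measurable)
    have A: "?A \<in> sets \<U>"
      using measurable_sets[OF meas, of "{x. \<bar>x\<bar> > \<epsilon>}"] by (simp add: vimage_def Int_def conj_commute)
    have "ennreal (1/\<eta>) * emeasure \<U> ?A = (\<integral>\<^sup>+ t. ennreal (1/\<eta>) * indicator ?A t \<partial>\<U>)"
      using A by (simp add: nn_integral_cmult_indicator)
    also have "\<dots> \<le> modular M f d"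
      unfolding modular_def
    proof (intro nn_integral_mono)
      fix t
      have "1/\<eta> \<le> M (\<bar>f t\<bar> / d)" if "t \<in> ?A"
      proof -
        have "\<epsilon> / e \<le> \<bar>f t\<bar> / d" using that d e assms by (intro frac_le) auto
        then have "M (\<epsilon> / e) \<le> M (\<bar>f t\<bar> / d)" using e assms by (intro M_mono) auto
        with e show ?thesis by simp
      qed
      then show "ennreal (1/\<eta>) * indicator ?A t \<le> ennreal (M (\<bar>f t\<bar> / d))"
        by (auto simp: indicator_def ennreal_leI)
    qed
    also have "\<dots> \<le> 1" by (fact d)
    finally have "ennreal (1/\<eta>) * ennreal (measure \<U> ?A) \<le> 1"
      by (simp add: finite_measure.emeasure_eq_measure[OF finite_measure_U])
    then show "measure \<U> ?A \<le> \<eta>"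
      using assms by (simp add: ennreal_mult[symmetric] field_simps flip: ennreal_1)
  qed
qed

end

section \<open>Closures of linear families and strong embedding\<close>

definition orlicz_closure :: "(real \<Rightarrow> real) \<Rightarrow> (real \<Rightarrow> real) set \<Rightarrow> (real \<Rightarrow> real) set" where
  "orlicz_closure M S =
    {f \<in> orlicz_space M. \<forall>e>0. \<exists>s\<in>S. orlicz_norm M (\<lambda>t. f t - s t) < e}"

definition linear_family :: "(real \<Rightarrow> real) set \<Rightarrow> bool" where
  "linear_family S \<longleftrightarrow> (\<lambda>t. 0) \<in> S \<and> (\<forall>f\<in>S. \<forall>g\<in>S. (\<lambda>t. f t + g t) \<in> S) \<and>
     (\<forall>c. \<forall>f\<in>S. (\<lambda>t. c * f t) \<in> S)"

lemma measure_superlevel_add: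
  fixes f g :: "real \<Rightarrow> real"
  assumes "f \<in> borel_measurable \<U>" "g \<in> borel_measurable \<U>"
  shows "measure \<U> {t \<in> {0..1}. \<bar>f t + g t\<bar> > a + b} \<le>
    measure \<U> {t \<in> {0..1}. \<bar>f t\<bar> > a} + measure \<U> {t \<in> {0..1}. \<bar>g t\<bar> > b}"
proof -
  have *: "{t \<in> {0..1}. \<bar>h t\<bar> > c} \<in> sets \<U>" if "h \<in> borel_measurable \<U>" for h :: "real \<Rightarrow> real" and c
    using measurable_sets[OF that, of "{x. \<bar>x\<bar> > c}"] by (simp add: vimage_def Int_def conj_commute)
  have "measure \<U> {t \<in> {0..1}. \<bar>f t + g t\<bar> > a + b} \<le>
      measure \<U> ({t \<in> {0..1}. \<bar>f t\<bar> > a} \<union> {t \<in> {0..1}. \<bar>g t\<bar> > b})"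
    using assms by (intro finite_measure.finite_measure_mono[OF finite_measure_U] sets.Un *) auto
  also have "\<dots> \<le> measure \<U> {t \<in> {0..1}. \<bar>f t\<bar> > a} + measure \<U> {t \<in> {0..1}. \<bar>g t\<bar> > b}"
    using assms by (intro measure_Un_le *)
  finally show ?thesis .
qed

context orlicz
begin

lemma orlicz_closure_subset: "S \<subseteq> orlicz_space M \<Longrightarrow> S \<subseteq> orlicz_closure M S"
proof
  fix s assume S: "S \<subseteq> orlicz_space M" and s: "s \<in> S"
  have "\<exists>r\<in>S. orlicz_norm M (\<lambda>t. s t - r t) < e" if "e > 0" for e
    by (rule bexI[OF _ s]) (simp add: that orlicz_norm_zero)
  with S s show "s \<in> orlicz_closure M S" by (auto simp: orlicz_closure_def)
qed

lemma closed_subspace_closure: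
  assumes S: "S \<subseteq> orlicz_space M" "linear_family S"
  shows "closed_subspace M (orlicz_closure M S)"
  unfolding closed_subspace_def
proof (intro conjI ballI allI impI; (elim conjE)?)
  let ?H = "orlicz_closure M S"
  show sub: "?H \<subseteq> orlicz_space M" by (auto simp: orlicz_closure_def)
  show "(\<lambda>t. 0) \<in> ?H" using orlicz_closure_subset[OF S(1)] S(2) by (auto simp: linear_family_def)
  fix f assume f: "f \<in> ?H"
  show "(\<lambda>t. f t + g t) \<in> ?H" if g: "g \<in> ?H" for g
    unfolding orlicz_closure_def
  proof (intro CollectI conjI allI impI)
    show "(\<lambda>t. f t + g t) \<in> orlicz_space M" using f g sub by (intro orlicz_space_add) auto
    fix e :: real assume "e > 0"
    then have "e/2 > 0" by simp
    with f g obtain s r where s: "s \<in> S" "orlicz_norm M (\<lambda>t. f t - s t) < e/2"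
      and r: "r \<in> S" "orlicz_norm M (\<lambda>t. g t - r t) < e/2"
      unfolding orlicz_closure_def by blast
    have "orlicz_norm M (\<lambda>t. (f t - s t) + (g t - r t)) \<le>
        orlicz_norm M (\<lambda>t. f t - s t) + orlicz_norm M (\<lambda>t. g t - r t)"
      using f g sub s r S by (intro orlicz_norm_triangle orlicz_space_diff) auto
    then have "orlicz_norm M (\<lambda>t. f t + g t - (s t + r t)) < e"
      using s r by (simp add: algebra_simps)
    moreover have "(\<lambda>t. s t + r t) \<in> S" using s r S(2) by (auto simp: linear_family_def)
    ultimately show "\<exists>s\<in>S. orlicz_norm M (\<lambda>t. f t + g t - s t) < e" by (rule bexI)
  qed
  show "(\<lambda>t. c * f t) \<in> ?H" for c
    unfolding orlicz_closure_def
  proof (intro CollectI conjI allI impI)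
    show "(\<lambda>t. c * f t) \<in> orlicz_space M" using f sub by (intro orlicz_space_cmult) auto
    fix e :: real assume "e > 0"
    then have "e / (\<bar>c\<bar> + 1) > 0" by simp
    with f obtain s where s: "s \<in> S" "orlicz_norm M (\<lambda>t. f t - s t) < e / (\<bar>c\<bar> + 1)"
      unfolding orlicz_closure_def by blast
    have n0: "0 \<le> orlicz_norm M (\<lambda>t. f t - s t)"
      using f sub s S by (intro orlicz_norm_nonneg orlicz_space_diff) auto
    have "orlicz_norm M (\<lambda>t. c * (f t - s t)) = \<bar>c\<bar> * orlicz_norm M (\<lambda>t. f t - s t)"
      using f sub s S by (intro orlicz_norm_cmult orlicz_space_diff) auto
    also have "\<dots> \<le> (\<bar>c\<bar> + 1) * orlicz_norm M (\<lambda>t. f t - s t)"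
      using n0 by (intro mult_right_mono) auto
    also have "\<dots> < e" using s(2) by (simp add: field_simps)
    finally have "orlicz_norm M (\<lambda>t. c * f t - c * s t) < e" by (simp add: algebra_simps)
    moreover have "(\<lambda>t. c * s t) \<in> S" using s S(2) by (auto simp: linear_family_def)
    ultimately show "\<exists>s\<in>S. orlicz_norm M (\<lambda>t. c * f t - s t) < e" by (rule bexI)
  qed
next
  let ?H = "orlicz_closure M S"
  have sub: "?H \<subseteq> orlicz_space M" by (auto simp: orlicz_closure_def)
  fix x f
  assume x: "\<forall>n::nat. x n \<in> ?H" and f: "f \<in> orlicz_space M"
    and lim: "(\<lambda>n. orlicz_norm M (\<lambda>t. x n t - f t)) \<longlonglongrightarrow> 0"
  show "f \<in> ?H"
    unfolding orlicz_closure_def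
  proof (intro CollectI conjI allI impI f)
    fix e :: real assume "e > 0"
    then have e2: "e/2 > 0" by simp
    then have "eventually (\<lambda>n. orlicz_norm M (\<lambda>t. x n t - f t) < e/2) sequentially"
      by (rule order_tendstoD(2)[OF lim])
    then obtain n where n: "orlicz_norm M (\<lambda>t. x n t - f t) < e/2"
      by (auto simp: eventually_sequentially)
    have xn: "x n \<in> ?H" using x by blast
    with e2 obtain s where s: "s \<in> S" "orlicz_norm M (\<lambda>t. x n t - s t) < e/2"
      unfolding orlicz_closure_def by blast
    have "orlicz_norm M (\<lambda>t. (f t - x n t) + (x n t - s t)) \<le>
        orlicz_norm M (\<lambda>t. f t - x n t) + orlicz_norm M (\<lambda>t. x n t - s t)"
      using f xn sub s S by (intro orlicz_norm_triangle orlicz_space_diff) auto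
    moreover have "orlicz_norm M (\<lambda>t. f t - x n t) < e/2"
      using n f xn sub by (subst orlicz_norm_diff_commute) auto
    ultimately have "orlicz_norm M (\<lambda>t. f t - s t) < e" using s by simp
    then show "\<exists>s\<in>S. orlicz_norm M (\<lambda>t. f t - s t) < e" using s(1) by (rule bexI)
  qed
qed

text \<open>Homogeneity is what makes the last hypothesis on \<open>S\<close> strong enough: a null sequence in
  measure stays null after multiplication by any constant \<open>a\<close>, so its norms are eventually
  at most \<open>K / a\<close>.\<close>

lemma strongly_embedded_closure:
  assumes S: "S \<subseteq> orlicz_space M" "linear_family S" and "\<delta> > 0"
    and key: "\<And>s. \<lbrakk>s \<in> S; measure \<U> {t \<in> {0..1}. \<bar>s t\<bar> > \<delta>} \<le> \<delta>\<rbrakk> \<Longrightarrow> orlicz_norm M s \<le> K"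
  shows "strongly_embedded M (orlicz_closure M S)"
proof -
  let ?H = "orlicz_closure M S"
  have sub: "?H \<subseteq> orlicz_space M" by (auto simp: orlicz_closure_def)
  have closed: "closed_subspace M ?H" by (rule closed_subspace_closure[OF S])
  have add: "\<forall>f\<in>?H. \<forall>g\<in>?H. (\<lambda>t. f t + g t) \<in> ?H" and cmult: "\<forall>c. \<forall>f\<in>?H. (\<lambda>t. c * f t) \<in> ?H"
    using closed unfolding closed_subspace_def by simp_all
  have H_cmult: "(\<lambda>t. c * f t) \<in> ?H" if "f \<in> ?H" for c f
    by (rule bspec[OF spec[OF cmult] that])
  have H_diff: "(\<lambda>t. f t - g t) \<in> ?H" if "f \<in> ?H" "g \<in> ?H" for f g
    using bspec[OF bspec[OF add that(1)] H_cmult[OF that(2), of "-1"]] by simp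
  have K: "K \<ge> 0"
    using key[of "\<lambda>t. 0"] S(2) \<open>\<delta> > 0\<close> by (auto simp: linear_family_def orlicz_norm_zero)
  \<comment> \<open>The hypothesis passes to the closure with \<open>\<delta>/2\<close> in place of \<open>\<delta>\<close>, because an approximation
    in norm is an approximation in measure.\<close>
  have keyH: "orlicz_norm M y \<le> K + 1"
    if y: "y \<in> ?H" "measure \<U> {t \<in> {0..1}. \<bar>y t\<bar> > \<delta>/2} \<le> \<delta>/2" for y
  proof -
    obtain e where e: "e > 0" "\<And>f. \<lbrakk>f \<in> orlicz_space M; orlicz_norm M f < e\<rbrakk> \<Longrightarrow>
        measure \<U> {t \<in> {0..1}. \<bar>f t\<bar> > \<delta>/2} \<le> \<delta>/2"
      using small_norm_small_in_measure[of "\<delta>/2" "\<delta>/2"] \<open>\<delta> > 0\<close> by auto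
    have "min e 1 > 0" using e by simp
    then obtain s where s: "s \<in> S" "orlicz_norm M (\<lambda>t. y t - s t) < min e 1"
      using y(1) unfolding orlicz_closure_def by blast
    have sp: "y \<in> orlicz_space M" "s \<in> orlicz_space M" using y sub s S by auto
    have eq: "orlicz_norm M (\<lambda>t. s t - y t) = orlicz_norm M (\<lambda>t. y t - s t)"
      by (rule orlicz_norm_diff_commute) (use sp in auto)
    have "measure \<U> {t \<in> {0..1}. \<bar>y t + (s t - y t)\<bar> > \<delta>/2 + \<delta>/2} \<le>
        measure \<U> {t \<in> {0..1}. \<bar>y t\<bar> > \<delta>/2} + measure \<U> {t \<in> {0..1}. \<bar>s t - y t\<bar> > \<delta>/2}"
      using sp by (intro measure_superlevel_add orlicz_space_measurable[where M = M] orlicz_space_diff) auto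
    moreover have "measure \<U> {t \<in> {0..1}. \<bar>s t - y t\<bar> > \<delta>/2} \<le> \<delta>/2"
      using sp s eq by (intro e(2) orlicz_space_diff) auto
    ultimately have "measure \<U> {t \<in> {0..1}. \<bar>s t\<bar> > \<delta>} \<le> \<delta>" using y(2) by simp
    with s have "orlicz_norm M s \<le> K" by (intro key)
    moreover have "orlicz_norm M (\<lambda>t. (y t - s t) + s t) \<le>
        orlicz_norm M (\<lambda>t. y t - s t) + orlicz_norm M s"
      using sp by (intro orlicz_norm_triangle orlicz_space_diff)
    ultimately show ?thesis using s by simp
  qed
  show ?thesis
    unfolding strongly_embedded_def
  proof (intro allI impI iffI; elim conjE)
    fix x f
    assume x: "\<forall>n::nat. x n \<in> ?H" and f: "f \<in> ?H"
      and lim: "(\<lambda>n. orlicz_norm M (\<lambda>t. x n t - f t)) \<longlonglongrightarrow> 0"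
    have xf: "(\<lambda>t. x n t - f t) \<in> orlicz_space M" for n using H_diff[of "x n" f] x f sub by auto
    show "converges_in_measure x f"
      unfolding converges_in_measure_def
    proof (intro allI impI)
      fix \<epsilon> :: real assume "\<epsilon> > 0"
      show "(\<lambda>n. measure \<U> {t \<in> {0..1}. \<bar>x n t - f t\<bar> > \<epsilon>}) \<longlonglongrightarrow> 0"
      proof (rule LIMSEQ_I)
        fix r :: real assume "r > 0"
        then obtain e where e: "e > 0" "\<And>f. \<lbrakk>f \<in> orlicz_space M; orlicz_norm M f < e\<rbrakk> \<Longrightarrow>
            measure \<U> {t \<in> {0..1}. \<bar>f t\<bar> > \<epsilon>} \<le> r/2"
          using small_norm_small_in_measure[of \<epsilon> "r/2"] \<open>\<epsilon> > 0\<close> by auto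
        have "eventually (\<lambda>n. orlicz_norm M (\<lambda>t. x n t - f t) < e) sequentially"
          by (rule order_tendstoD(2)[OF lim e(1)])
        then obtain N where N: "\<And>n. n \<ge> N \<Longrightarrow> orlicz_norm M (\<lambda>t. x n t - f t) < e"
          by (auto simp: eventually_sequentially)
        show "\<exists>no. \<forall>n\<ge>no. norm (measure \<U> {t \<in> {0..1}. \<bar>x n t - f t\<bar> > \<epsilon>} - 0) < r"
        proof (intro exI allI impI)
          fix n assume "n \<ge> N"
          from e(2)[OF xf N[OF this]] \<open>r > 0\<close>
          show "norm (measure \<U> {t \<in> {0..1}. \<bar>x n t - f t\<bar> > \<epsilon>} - 0) < r" by simp
        qed
      qed
    qed
  next
    fix x f
    assume x: "\<forall>n::nat. x n \<in> ?H" and f: "f \<in> ?H" and lim: "converges_in_measure x f"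
    have xf: "(\<lambda>t. x n t - f t) \<in> ?H" for n using H_diff[of "x n" f] x f by auto
    show "(\<lambda>n. orlicz_norm M (\<lambda>t. x n t - f t)) \<longlonglongrightarrow> 0"
    proof (rule LIMSEQ_I)
      fix r :: real assume "r > 0"
      \<comment> \<open>Blown up by \<open>a\<close>, the differences stay small in measure, so their norms are at most
        \<open>(K + 1) / a < r\<close>.\<close>
      define a where "a = (K + 2) / r"
      have a: "a > 0" using K \<open>r > 0\<close> by (simp add: a_def)
      have "(\<lambda>n. measure \<U> {t \<in> {0..1}. \<bar>x n t - f t\<bar> > \<delta> / (2 * a)}) \<longlonglongrightarrow> 0"
        using lim a \<open>\<delta> > 0\<close> unfolding converges_in_measure_def by simp
      then have "eventually (\<lambda>n. measure \<U> {t \<in> {0..1}. \<bar>x n t - f t\<bar> > \<delta> / (2 * a)} < \<delta>/2) sequentially"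
        by (rule order_tendstoD(2)) (use \<open>\<delta> > 0\<close> in simp)
      then obtain N where N: "\<And>n. n \<ge> N \<Longrightarrow>
          measure \<U> {t \<in> {0..1}. \<bar>x n t - f t\<bar> > \<delta> / (2 * a)} < \<delta>/2"
        by (auto simp: eventually_sequentially)
      show "\<exists>no. \<forall>n\<ge>no. norm (orlicz_norm M (\<lambda>t. x n t - f t) - 0) < r"
      proof (intro exI allI impI)
        fix n assume "n \<ge> N"
        have "{t \<in> {0..1}. \<bar>a * (x n t - f t)\<bar> > \<delta>/2} = {t \<in> {0..1}. \<bar>x n t - f t\<bar> > \<delta> / (2 * a)}"
        proof -
          have "(\<bar>a * y\<bar> > \<delta>/2) = (\<bar>y\<bar> > \<delta> / (2 * a))" for y
            using a by (simp add: abs_mult pos_divide_less_eq mult.commute mult.left_commute)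
          then show ?thesis by simp
        qed
        with N[OF \<open>n \<ge> N\<close>] have "measure \<U> {t \<in> {0..1}. \<bar>a * (x n t - f t)\<bar> > \<delta>/2} \<le> \<delta>/2" by simp
        then have "orlicz_norm M (\<lambda>t. a * (x n t - f t)) \<le> K + 1"
          by (intro keyH H_cmult xf)
        moreover have sp: "(\<lambda>t. x n t - f t) \<in> orlicz_space M" using xf sub by auto
        ultimately have "a * orlicz_norm M (\<lambda>t. x n t - f t) < K + 2"
          using a by (simp add: orlicz_norm_cmult)
        moreover have "K + 2 = a * r" using \<open>r > 0\<close> by (simp add: a_def)
        ultimately have "orlicz_norm M (\<lambda>t. x n t - f t) < r"
          using a by simp
        then show "norm (orlicz_norm M (\<lambda>t. x n t - f t) - 0) < r"
          using orlicz_norm_nonneg[OF sp] by simp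
      qed
    qed
  qed
qed

end

section \<open>Independent variables from the digits of a point\<close>

text \<open>The mean of \<open>1 - cos (\<tau> x)\<close> over \<open>\<tau> \<in> [0,1]\<close>. Unlike \<open>1 - cos x\<close> itself, it is comparable with
  \<open>min 1 (x\<^sup>2)\<close> on the whole line.\<close>

definition integral_one_minus_cos :: "real \<Rightarrow> real" where
  "integral_one_minus_cos x = (if x = 0 then 0 else 1 - sin x / x)"

lemma has_integral_one_minus_cos:
  "((\<lambda>\<tau>. 1 - cos (\<tau> * x)) has_integral integral_one_minus_cos x) {0..1}"
proof (cases "x = 0")
  case False
  have "((\<lambda>\<tau>. 1 - cos (\<tau> * x)) has_integral (1 - sin (1 * x) / x) - (0 - sin (0 * x) / x)) {0..1}"
    using False
    by (intro fundamental_theorem_of_calculus)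
       (auto intro!: derivative_eq_intros simp flip: has_real_derivative_iff_has_vector_derivative)
  with False show ?thesis by (simp add: integral_one_minus_cos_def)
qed (simp add: integral_one_minus_cos_def)

lemma one_minus_cos_le: "1 - cos x \<le> 2 * min 1 (x\<^sup>2)" for x :: real
proof -
  have "1 - cos x = 2 * (sin (x/2))\<^sup>2" using cos_double_sin[of "x/2"] by simp
  also have "(sin (x/2))\<^sup>2 \<le> (x/2)\<^sup>2" using abs_sin_x_le_abs_x[of "x/2"] by (simp only: abs_le_square_iff)
  finally have "1 - cos x \<le> x\<^sup>2 / 2" by (simp add: power_divide)
  with zero_le_power2[of x] have "1 - cos x \<le> 2 * x\<^sup>2" by linarith
  moreover have "1 - cos x \<le> 2" using cos_ge_minus_one[of x] by linarith
  ultimately show ?thesis by (simp add: min_def)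
qed

lemma integral_one_minus_cos_le: "integral_one_minus_cos x \<le> 2 * min 1 (x\<^sup>2)"
proof -
  have "((\<lambda>\<tau>::real. 2 * min 1 (x\<^sup>2)) has_integral 2 * min 1 (x\<^sup>2)) {0..1}"
    using has_integral_const_real[of "2 * min 1 (x\<^sup>2)" 0 1] by simp
  moreover have "1 - cos (\<tau> * x) \<le> 2 * min 1 (x\<^sup>2)" if "\<tau> \<in> {0..1}" for \<tau>
  proof -
    have "\<tau>\<^sup>2 \<le> 1" using that by (simp add: power_le_one)
    then have "(\<tau> * x)\<^sup>2 \<le> x\<^sup>2"
      by (simp add: power_mult_distrib mult_left_le_one_le)
    with one_minus_cos_le[of "\<tau> * x"] show ?thesis by linarith
  qed
  ultimately show ?thesis using has_integral_le[OF has_integral_one_minus_cos[of x]] by simp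
qed

lemma integral_one_minus_cos_ge: "integral_one_minus_cos x \<ge> min 1 (x\<^sup>2) / 9"
proof -
  have *: "integral_one_minus_cos x \<ge> min 1 (x\<^sup>2) / 9" if "x > 0" for x
  proof (cases "x \<ge> 2")
    case True
    have "sin x / x \<le> 1 / 2" using True sin_le_one[of x] by (intro frac_le) auto
    moreover have "integral_one_minus_cos x = 1 - sin x / x"
      using True by (simp add: integral_one_minus_cos_def)
    moreover have "min 1 (x\<^sup>2) \<le> 1" by simp
    ultimately show ?thesis by linarith
  next
    case False
    \<comment> \<open>Taylor: \<open>1 - sin x / x \<ge> x\<^sup>2/6 - x\<^sup>4/120\<close>, and \<open>x\<^sup>2 < 4\<close>.\<close>
    have "\<bar>sin x - (\<Sum>m<5. sin_coeff m * x ^ m)\<bar> \<le> inverse (fact 5) * \<bar>x\<bar> ^ 5"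
      by (rule Maclaurin_sin_bound)
    moreover have "(\<Sum>m<5. sin_coeff m * x ^ m) = x - x^3/6"
      by (simp add: sin_coeff_def lessThan_nat_numeral fact_numeral)
    moreover have "fact 5 = (120::real)" by (simp add: fact_numeral)
    ultimately have "\<bar>sin x - (x - x^3/6)\<bar> \<le> x^5/120" using that by simp
    then have "sin x \<le> x - x^3/6 + x^5/120" by linarith
    then have "sin x / x \<le> (x - x^3/6 + x^5/120) / x" using that by (intro divide_right_mono) auto
    also have "\<dots> = 1 - x\<^sup>2/6 + x\<^sup>2 * x\<^sup>2/120" using that by (simp add: field_simps eval_nat_numeral)
    also have "\<dots> \<le> 1 - x\<^sup>2/6 + x\<^sup>2 * 4/120"
    proof -
      have "x\<^sup>2 \<le> 2\<^sup>2" using that False by (intro power_mono) auto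
      then have "x\<^sup>2 * x\<^sup>2 \<le> x\<^sup>2 * 4" by (intro mult_left_mono) auto
      then show ?thesis by simp
    qed
    finally have "1 - sin x / x \<ge> x\<^sup>2 / 9" using zero_le_power2[of x] by linarith
    then show ?thesis using that by (simp add: integral_one_minus_cos_def min_def)
  qed
  have "integral_one_minus_cos (-x) = integral_one_minus_cos x" by (simp add: integral_one_minus_cos_def)
  with *[of x] *[of "-x"] show ?thesis
    by (cases "x = 0"; cases "x > 0") (auto simp: integral_one_minus_cos_def)
qed

lemma sum_div_mod_product:
  fixes g f :: "nat \<Rightarrow> 'a::comm_semiring_0"
  assumes "k > 0"
  shows "(\<Sum>i<n * k. g (i div k) * f (i mod k)) = (\<Sum>i<n. g i) * (\<Sum>j<k. f j)"
proof -
  have "(\<Sum>i<n * k. g (i div k) * f (i mod k)) =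
      (\<Sum>i<n. \<Sum>j\<in>{i * k..<i * k + k}. g (j div k) * f (j mod k))"
    by (rule sum.nat_group[symmetric])
  also have "\<dots> = (\<Sum>i<n. \<Sum>j<k. g i * f j)"
  proof (rule sum.cong[OF refl])
    fix i
    have "(\<Sum>j\<in>{i * k..<i * k + k}. g (j div k) * f (j mod k)) =
        (\<Sum>j\<in>{0..<k}. g ((j + i * k) div k) * f ((j + i * k) mod k))"
      using sum.shift_bounds_nat_ivl[of "\<lambda>j. g (j div k) * f (j mod k)" 0 "i * k" k]
      by (simp add: add.commute)
    also have "\<dots> = (\<Sum>j<k. g i * f j)"
      using assms by (intro sum.cong) (auto simp: div_mult_self3)
    finally show "(\<Sum>j\<in>{i * k..<i * k + k}. g (j div k) * f (j mod k)) = (\<Sum>j<k. g i * f j)" .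
  qed
  also have "\<dots> = (\<Sum>i<n. g i) * (\<Sum>j<k. f j)" by (simp add: sum_product)
  finally show ?thesis .
qed

text \<open>Mixed radix expansions of the points of \<open>[0,1]\<close>: at level \<open>m\<close> the interval is divided into
  \<open>L 0 * \<dots> * L (m - 1)\<close> cells of equal length, numbered from the left, and the digit of index \<open>m\<close> is the
  position of the cell of level \<open>m + 1\<close> inside the cell of level \<open>m\<close>.\<close>

locale digit_expansion =
  fixes L :: "nat \<Rightarrow> nat"
  assumes L_pos: "L n > 0"
begin

definition cells :: "nat \<Rightarrow> nat" where "cells m = (\<Prod>k<m. L k)"
definition cell :: "nat \<Rightarrow> real \<Rightarrow> nat" where "cell m t = nat \<lfloor>real (cells m) * t\<rfloor>"
definition digit :: "nat \<Rightarrow> real \<Rightarrow> nat" where "digit n t = cell (Suc n) t mod L n"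
definition average :: "nat \<Rightarrow> (nat \<Rightarrow> 'a::real_normed_field) \<Rightarrow> 'a" where
  "average n F = (\<Sum>d<L n. F d) / of_nat (L n)"

lemma cells_pos: "cells m > 0"
  using L_pos by (simp add: cells_def)

lemma cells_Suc: "cells (Suc m) = cells m * L m"
  by (simp add: cells_def)

lemma digit_less: "digit n t < L n"
  using L_pos by (simp add: digit_def)

lemma cell_Suc_div:
  assumes "t \<ge> 0" shows "cell (Suc m) t div L m = cell m t"
proof -
  have "int (cell (Suc m) t div L m) = \<lfloor>real (cells (Suc m)) * t\<rfloor> div int (L m)"
    using assms by (simp add: cell_def zdiv_int)
  also have "\<dots> = \<lfloor>real (cells (Suc m)) * t / real_of_int (int (L m))\<rfloor>"
    by (rule floor_divide_real_eq_div[symmetric]) simp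
  also have "\<dots> = int (cell m t)"
    using assms L_pos[of m] by (simp add: cells_Suc cell_def)
  finally show ?thesis by simp
qed

lemma digit_cell_cong:
  assumes "s \<ge> 0" "t \<ge> 0" "cell m s = cell m t" "n < m"
  shows "digit n s = digit n t"
proof -
  have "cell (m - k) s = cell (m - k) t" for k
  proof (induction k)
    case (Suc k)
    show ?case
    proof (cases "k < m")
      case True
      then have "Suc (m - Suc k) = m - k" by simp
      with Suc show ?thesis
        using cell_Suc_div[OF assms(1), of "m - Suc k"] cell_Suc_div[OF assms(2), of "m - Suc k"] by simp
    qed (use Suc in simp)
  qed (use assms in simp)
  from this[of "m - Suc n"] assms(4) show ?thesis by (simp add: digit_def)
qed

lemma cell_measurable: "cell m \<in> measurable \<U> (count_space UNIV)"
proof -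
  have "(\<lambda>t. \<lfloor>real (cells m) * t\<rfloor>) \<in> measurable \<U> (count_space UNIV)"
    by (rule measurable_compose[OF borel_imp_measurable_U measurable_real_floor]) simp
  then have "(\<lambda>t. nat \<lfloor>real (cells m) * t\<rfloor>) \<in> measurable \<U> (count_space UNIV)"
    by (rule measurable_compose) simp
  then show ?thesis by (simp add: cell_def[abs_def])
qed

lemma AE_U_less_1: "AE t in \<U>. t < 1"
proof (rule AE_I)
  show "{t \<in> space \<U>. \<not> t < 1} \<subseteq> {1}" by auto
  show "emeasure \<U> {1} = 0" by (simp add: emeasure_restrict_space)
  show "{1} \<in> sets \<U>" by (simp add: sets_restrict_space_iff)
qed

text \<open>The number of the cell is uniformly distributed. The point \<open>1\<close>, which lies in none of the
  half-open cells, is negligible.\<close>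

lemma has_integral_cell_function:
  fixes G :: "nat \<Rightarrow> 'a::{banach, second_countable_topology}"
  shows "has_bochner_integral \<U> (\<lambda>t. G (cell m t)) ((\<Sum>i<cells m. G i) /\<^sub>R real (cells m))"
proof -
  let ?N = "cells m"
  let ?I = "\<lambda>i::nat. {real i / ?N ..< (real i + 1) / ?N}"
  have N: "real ?N > 0" using cells_pos[of m] by simp
  have "has_bochner_integral \<U> (\<lambda>t. indicator (?I i) t *\<^sub>R G i) ((1 / ?N) *\<^sub>R G i)" if "i < ?N" for i
  proof -
    have sub: "?I i \<subseteq> {0..1}"
    proof -
      have "real i + 1 \<le> ?N" using that by linarith
      then have "(real i + 1) / ?N \<le> 1" using N by (simp add: field_simps)
      moreover have "0 \<le> real i / ?N" by simp
      ultimately show ?thesis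
        by (metis (no_types, lifting) atLeastLessThan_subseteq_atLeastAtMost_iff)
    qed
    have meas: "measure \<U> (?I i) = 1 / ?N"
      using sub N by (subst measure_restrict_space) (auto simp: field_simps)
    have "?I i \<in> sets \<U>" using sub by (subst sets_restrict_space_iff) auto
    then have "has_bochner_integral \<U> (indicator (?I i)) (measure \<U> (?I i))"
      by (intro has_bochner_integral_real_indicator)
         (auto simp: finite_measure.emeasure_eq_measure[OF finite_measure_U])
    from has_bochner_integral_scaleR_left[OF this] show ?thesis by (simp add: meas)
  qed
  then have *: "has_bochner_integral \<U> (\<lambda>t. \<Sum>i<?N. indicator (?I i) t *\<^sub>R G i) (\<Sum>i<?N. (1 / ?N) *\<^sub>R G i)"
    by (intro has_bochner_integral_sum) auto
  have "AE t in \<U>. (\<Sum>i<?N. indicator (?I i) t *\<^sub>R G i) = G (cell m t)"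
    using AE_U_less_1 AE_space
  proof eventually_elim
    case (elim t)
    then have t: "0 \<le> t" "t < 1" by auto
    have lt: "cell m t < ?N"
    proof -
      have "real ?N * t < real ?N * 1" using t N by (intro mult_strict_left_mono) auto
      then have "\<lfloor>real ?N * t\<rfloor> < int ?N" by (simp add: floor_less_iff)
      with N t show ?thesis by (simp add: cell_def nat_less_iff)
    qed
    have mem: "t \<in> ?I i \<longleftrightarrow> i = cell m t" for i
    proof -
      have "t \<in> ?I i \<longleftrightarrow> real i \<le> real ?N * t \<and> real ?N * t < real i + 1"
        using N by (auto simp: field_simps)
      also have "\<dots> \<longleftrightarrow> \<lfloor>real ?N * t\<rfloor> = int i"
        by (simp add: floor_eq_iff)
      also have "\<dots> \<longleftrightarrow> i = cell m t"
        using t N by (auto simp: cell_def)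
      finally show ?thesis .
    qed
    have "(\<Sum>i<?N. indicator (?I i) t *\<^sub>R G i) = (\<Sum>i<?N. if i = cell m t then G i else 0)"
      by (intro sum.cong refl) (use mem in \<open>auto simp: indicator_def\<close>)
    also have "\<dots> = G (cell m t)" using lt by simp
    finally show ?case .
  qed
  moreover have "(\<lambda>t. G (cell m t)) \<in> borel_measurable \<U>"
    by (rule measurable_compose[OF cell_measurable]) simp
  ultimately have "has_bochner_integral \<U> (\<lambda>t. G (cell m t)) (\<Sum>i<?N. (1 / ?N) *\<^sub>R G i)"
    using has_bochner_integral_cong_AE[THEN iffD1, OF borel_measurable_has_bochner_integral[OF *] _ _ *] by blast
  then show ?thesis by (simp add: scaleR_sum_right divide_inverse)
qed

text \<open>Functions that are constant on the cells of level \<open>m\<close>, in particular all functions of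
  the first \<open>m\<close> digits.\<close>

definition cellwise :: "nat \<Rightarrow> (real \<Rightarrow> 'a) \<Rightarrow> bool" where
  "cellwise m f \<longleftrightarrow> (\<forall>s\<in>{0..1}. \<forall>t\<in>{0..1}. cell m s = cell m t \<longrightarrow> f s = f t)"

lemma cellwise_factor:
  assumes "cellwise m f" obtains g where "\<And>t. t \<in> {0..1} \<Longrightarrow> f t = g (cell m t)"
proof
  fix t :: real assume t: "t \<in> {0..1}"
  let ?s = "SOME s. s \<in> {0..1} \<and> cell m s = cell m t"
  have "?s \<in> {0..1} \<and> cell m ?s = cell m t" by (rule someI[of _ t]) (use t in simp)
  then show "f t = (\<lambda>i. f (SOME s. s \<in> {0..1} \<and> cell m s = i)) (cell m t)"
    using assms t unfolding cellwise_def by metis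
qed

lemma cellwise_digits:
  assumes "\<And>s t. (\<And>n. n < m \<Longrightarrow> digit n s = digit n t) \<Longrightarrow> f s = f t"
  shows "cellwise m f"
  unfolding cellwise_def by (intro ballI impI assms digit_cell_cong) auto

lemma integrable_cellwise:
  fixes f :: "real \<Rightarrow> 'a::{banach, second_countable_topology}"
  assumes "cellwise m f" shows "integrable \<U> f"
proof -
  from cellwise_factor[OF assms] obtain g where g: "\<And>t. t \<in> {0..1} \<Longrightarrow> f t = g (cell m t)" by metis
  have "integrable \<U> (\<lambda>t. g (cell m t))"
    using has_integral_cell_function by (auto simp: has_bochner_integral_iff)
  then show ?thesis by (subst Bochner_Integration.integrable_cong[OF refl g]) auto
qed

text \<open>Independence of the digits in the form of a product formula. A function of the first \<open>m\<close> digits depends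
  only on the cell of level \<open>m\<close>, and the numbers of the cells of level \<open>m + 1\<close> inside cell \<open>i\<close> are those
  with quotient \<open>i\<close> modulo \<open>L m\<close>; so each further digit splits off one factor of the sum over all cells.\<close>

theorem digits_independent:
  fixes F :: "nat \<Rightarrow> nat \<Rightarrow> 'a::{real_normed_field, banach, second_countable_topology}"
  shows "(\<integral>t. (\<Prod>n<m. F n (digit n t)) \<partial>\<U>) = (\<Prod>n<m. average n (F n))"
proof -
  define G where "G = rec_nat (\<lambda>i. 1) (\<lambda>n g i. g (i div L n) * F n (i mod L n))"
  have G: "G 0 i = 1" "G (Suc n) i = G n (i div L n) * F n (i mod L n)" for n i
    by (simp_all add: G_def)
  have fact: "(\<Prod>n<m. F n (digit n t)) = G m (cell m t)" if "t \<in> {0..1}" for t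
    using that by (induction m) (auto simp: G cell_Suc_div digit_def)
  have sum: "(\<Sum>i<cells m. G m i) = (\<Prod>n<m. \<Sum>d<L n. F n d)"
  proof (induction m)
    case (Suc m)
    then show ?case using sum_div_mod_product[OF L_pos[of m], of "G m" "F m" "cells m"]
      by (simp add: cells_Suc G)
  qed (simp add: G cells_def)
  have "(\<integral>t. (\<Prod>n<m. F n (digit n t)) \<partial>\<U>) = (\<integral>t. G m (cell m t) \<partial>\<U>)"
    by (intro Bochner_Integration.integral_cong fact) auto
  also have "\<dots> = (\<Sum>i<cells m. G m i) /\<^sub>R real (cells m)"
    by (rule has_bochner_integral_integral_eq[OF has_integral_cell_function])
  also have "\<dots> = (\<Prod>n<m. \<Sum>d<L n. F n d) / of_nat (cells m)"
    by (simp add: sum scaleR_conv_of_real divide_inverse mult.commute)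
  also have "\<dots> = (\<Prod>n<m. average n (F n))"
    by (simp add: average_def cells_def prod_dividef)
  finally show ?thesis .
qed


definition digit_sum :: "(nat \<Rightarrow> nat \<Rightarrow> real) \<Rightarrow> nat \<Rightarrow> real \<Rightarrow> real" where
  "digit_sum w m t = (\<Sum>n<m. w n (digit n t))"

lemma average_mono:
  fixes F G :: "nat \<Rightarrow> real"
  shows "(\<And>d. d < L n \<Longrightarrow> F d \<le> G d) \<Longrightarrow> average n F \<le> average n G"
  unfolding average_def by (intro divide_right_mono sum_mono) auto

lemma average_const: "average n (\<lambda>d. c) = c"
  using L_pos[of n] by (simp add: average_def)

lemma average_add: "average n (\<lambda>d. F d + G d) = average n F + average n G"
  by (simp add: average_def sum.distrib add_divide_distrib)

lemma average_cmult: "average n (\<lambda>d. c * F d) = c * average n F"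
  by (simp add: average_def sum_distrib_left)

lemma average_diff: "average n (\<lambda>d. F d - G d) = average n F - average n G"
  by (simp add: average_def sum_subtractf diff_divide_distrib)

lemma cellwise_digit_sum: "cellwise m (\<lambda>t. f (digit_sum w m t))"
  by (intro cellwise_digits) (simp add: digit_sum_def)

text \<open>The characteristic functions of the summands are real because the sine averages vanish.\<close>

lemma expectation_cos_digit_sum:
  assumes sin: "\<And>n. n < m \<Longrightarrow> average n (\<lambda>d. sin (\<tau> * w n d)) = 0"
  shows "(\<integral>t. cos (\<tau> * digit_sum w m t) \<partial>\<U>) = (\<Prod>n<m. average n (\<lambda>d. cos (\<tau> * w n d)))"
proof -
  have avg: "average n (\<lambda>d. cis (\<tau> * w n d)) = complex_of_real (average n (\<lambda>d. cos (\<tau> * w n d)))"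
    if "n < m" for n
  proof -
    have "average n (\<lambda>d. cis (\<tau> * w n d)) =
        Complex (average n (\<lambda>d. cos (\<tau> * w n d))) (average n (\<lambda>d. sin (\<tau> * w n d)))"
      using L_pos[of n] by (simp add: complex_eq_iff average_def Re_divide_of_nat Im_divide_of_nat)
    with sin[OF that] show ?thesis by (simp add: complex_eq_iff)
  qed
  have cis: "cis (\<tau> * digit_sum w m t) = (\<Prod>n<m. cis (\<tau> * w n (digit n t)))" for t
    unfolding digit_sum_def by (induction m) (auto simp: distrib_left simp flip: cis_mult)
  have "(\<integral>t. cos (\<tau> * digit_sum w m t) \<partial>\<U>) = (\<integral>t. Re (cis (\<tau> * digit_sum w m t)) \<partial>\<U>)" by simp
  also have "\<dots> = Re (\<integral>t. cis (\<tau> * digit_sum w m t) \<partial>\<U>)"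
    by (intro integral_Re integrable_cellwise[of m] cellwise_digit_sum)
  also have "\<dots> = Re (\<Prod>n<m. average n (\<lambda>d. cis (\<tau> * w n d)))"
    unfolding cis using digits_independent[where F = "\<lambda>n d. cis (\<tau> * w n d)"] by simp
  also have "\<dots> = Re (complex_of_real (\<Prod>n<m. average n (\<lambda>d. cos (\<tau> * w n d))))"
    using avg by (simp add: of_real_prod)
  finally show ?thesis by (simp only: Re_complex_of_real)
qed

text \<open>A cellwise function takes finitely many values, so exchanging the two integrals only exchanges an
  integral with a finite sum.\<close>

lemma has_integral_expectation_one_minus_cos:
  assumes "cellwise m S"
  shows "((\<lambda>\<tau>. \<integral>t. 1 - cos (\<tau> * S t) \<partial>\<U>) has_integral (\<integral>t. integral_one_minus_cos (S t) \<partial>\<U>)) {0..1}"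
proof -
  from cellwise_factor[OF assms] obtain g where g: "\<And>t. t \<in> {0..1} \<Longrightarrow> S t = g (cell m t)" by metis
  have *: "(\<integral>t. f (S t) \<partial>\<U>) = (\<Sum>i<cells m. f (g i)) / cells m" for f :: "real \<Rightarrow> real"
  proof -
    have "(\<integral>t. f (S t) \<partial>\<U>) = (\<integral>t. f (g (cell m t)) \<partial>\<U>)"
      by (intro Bochner_Integration.integral_cong) (auto simp: g)
    then show ?thesis
      using has_bochner_integral_integral_eq[OF has_integral_cell_function[of "\<lambda>i. f (g i)" m]]
      by (simp add: divide_inverse mult.commute)
  qed
  show ?thesis
    unfolding *[of "\<lambda>x. 1 - cos (_ * x)"] *[of integral_one_minus_cos]
    by (intro has_integral_divide has_integral_sum has_integral_one_minus_cos) auto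
qed

text \<open>The characteristic function of a sum of independent symmetric variables detects the size
  of its terms: with \<open>A = \<Sum> E (1 - cos (\<tau> w\<^sub>n))\<close> one has
  \<open>1 - E (cos (\<tau> S)) \<ge> 1 - exp (-A) \<ge> A / (1 + A)\<close>. The nonnegativity of the factors
  is needed to pass to the exponential. Averaging over \<open>\<tau>\<close> prevents the terms
  \<open>1 - cos (\<tau> w\<^sub>n)\<close> from vanishing by periodicity.\<close>

lemma digit_sum_lower_bound:
  assumes sin: "\<And>n \<tau>. n < m \<Longrightarrow> average n (\<lambda>d. sin (\<tau> * w n d)) = 0"
    and cos: "\<And>n \<tau>. n < m \<Longrightarrow> average n (\<lambda>d. cos (\<tau> * w n d)) \<ge> 0"
  defines "B \<equiv> \<Sum>n<m. average n (\<lambda>d. min 1 ((w n d)\<^sup>2))"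
  shows "(\<integral>t. integral_one_minus_cos (digit_sum w m t) \<partial>\<U>) \<ge> (B / 9) / (1 + 2 * B)"
proof -
  define A where "A \<tau> = (\<Sum>n<m. average n (\<lambda>d. 1 - cos (\<tau> * w n d)))" for \<tau>
  have B: "B \<ge> 0" unfolding B_def average_def by (intro sum_nonneg divide_nonneg_nonneg) auto
  have A0: "A \<tau> \<ge> 0" for \<tau>
    unfolding A_def average_def by (intro sum_nonneg divide_nonneg_nonneg) auto
  have A: "A \<tau> \<le> 2 * B" if "\<tau> \<in> {0..1}" for \<tau>
  proof -
    have "1 - cos (\<tau> * x) \<le> 2 * min 1 (x\<^sup>2)" for x :: real
    proof -
      have "\<tau>\<^sup>2 \<le> 1" using that by (simp add: power_le_one)
      then have "(\<tau> * x)\<^sup>2 \<le> x\<^sup>2" by (simp add: power_mult_distrib mult_left_le_one_le)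
      with one_minus_cos_le[of "\<tau> * x"] show ?thesis by linarith
    qed
    then have "A \<tau> \<le> (\<Sum>n<m. average n (\<lambda>d. 2 * min 1 ((w n d)\<^sup>2)))"
      unfolding A_def by (intro sum_mono average_mono)
    then show ?thesis by (simp add: B_def average_cmult sum_distrib_left)
  qed
  have le: "A \<tau> / (1 + 2 * B) \<le> (\<integral>t. 1 - cos (\<tau> * digit_sum w m t) \<partial>\<U>)" if "\<tau> \<in> {0..1}" for \<tau>
  proof -
    have "(\<Prod>n<m. average n (\<lambda>d. cos (\<tau> * w n d))) \<le> (\<Prod>n<m. exp (- average n (\<lambda>d. 1 - cos (\<tau> * w n d))))"
    proof (intro prod_mono conjI cos)
      fix n
      have "average n (\<lambda>d. cos (\<tau> * w n d)) = 1 + (- average n (\<lambda>d. 1 - cos (\<tau> * w n d)))"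
        by (simp add: average_diff average_const)
      then show "average n (\<lambda>d. cos (\<tau> * w n d)) \<le> exp (- average n (\<lambda>d. 1 - cos (\<tau> * w n d)))"
        by (metis exp_ge_add_one_self)
    qed auto
    also have "\<dots> = exp (- A \<tau>)" by (simp add: A_def exp_sum flip: sum_negf)
    also have "\<dots> \<le> 1 / (1 + A \<tau>)"
      using exp_ge_add_one_self[of "A \<tau>"] A0[of \<tau>] by (simp add: exp_minus field_simps)
    finally have "1 - (\<Prod>n<m. average n (\<lambda>d. cos (\<tau> * w n d))) \<ge> 1 - 1 / (1 + A \<tau>)" by simp
    moreover have "1 - 1 / (1 + A \<tau>) = A \<tau> / (1 + A \<tau>)" using A0[of \<tau>] by (simp add: field_simps)
    moreover have "A \<tau> / (1 + A \<tau>) \<ge> A \<tau> / (1 + 2 * B)"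
      using A[OF that] A0[of \<tau>] by (intro divide_left_mono) auto
    moreover have "(\<integral>t. 1 - cos (\<tau> * digit_sum w m t) \<partial>\<U>) =
        1 - (\<Prod>n<m. average n (\<lambda>d. cos (\<tau> * w n d)))"
    proof -
      have "(\<integral>t. 1 - cos (\<tau> * digit_sum w m t) \<partial>\<U>) =
          (\<integral>t. 1 \<partial>\<U>) - (\<integral>t. cos (\<tau> * digit_sum w m t) \<partial>\<U>)"
        by (intro Bochner_Integration.integral_diff integrable_cellwise[of m] cellwise_digit_sum)
      also have "(\<integral>t. 1 \<partial>\<U>) = (1::real)" by (simp add: measure_def emeasure_U_space)
      finally show ?thesis using expectation_cos_digit_sum[of m \<tau> w] sin by simp
    qed
    ultimately show ?thesis by linarith
  qed
  have "((\<lambda>\<tau>. A \<tau>) has_integral (\<Sum>n<m. average n (\<lambda>d. integral_one_minus_cos (w n d)))) {0..1}"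
    unfolding A_def average_def
    by (intro has_integral_divide has_integral_sum has_integral_one_minus_cos) auto
  then have "((\<lambda>\<tau>. A \<tau> / (1 + 2 * B)) has_integral
      (\<Sum>n<m. average n (\<lambda>d. integral_one_minus_cos (w n d))) / (1 + 2 * B)) {0..1}"
    by (rule has_integral_divide)
  from has_integral_le[OF this has_integral_expectation_one_minus_cos[of m "digit_sum w m"]] le
  have "(\<Sum>n<m. average n (\<lambda>d. integral_one_minus_cos (w n d))) / (1 + 2 * B) \<le>
      (\<integral>t. integral_one_minus_cos (digit_sum w m t) \<partial>\<U>)"
    using cellwise_digit_sum[of m "\<lambda>x. x" w] by simp
  moreover have "B / 9 \<le> (\<Sum>n<m. average n (\<lambda>d. integral_one_minus_cos (w n d)))"
  proof -
    have "B / 9 = (\<Sum>n<m. average n (\<lambda>d. (1/9) * min 1 ((w n d)\<^sup>2)))"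
      by (simp only: average_cmult B_def sum_distrib_left[symmetric])
    also have "\<dots> \<le> (\<Sum>n<m. average n (\<lambda>d. integral_one_minus_cos (w n d)))"
      using integral_one_minus_cos_ge by (intro sum_mono average_mono) auto
    finally show ?thesis .
  qed
  then have "(B / 9) / (1 + 2 * B) \<le> (\<Sum>n<m. average n (\<lambda>d. integral_one_minus_cos (w n d))) / (1 + 2 * B)"
    using B by (intro divide_right_mono) auto
  ultimately show ?thesis by linarith
qed

end

section \<open>Modulars of sums of independent variables\<close>

lemma exp_le_quadratic:
  fixes x :: real
  assumes "\<bar>x\<bar> \<le> 1" shows "exp x \<le> 1 + x + x\<^sup>2"
proof (cases "x \<ge> 0")
  case True
  then show ?thesis using exp_bound[of x] assms by simp
next
  case False
  define y where "y = - x"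
  have y: "0 \<le> y" "y \<le> 1" using False assms by (auto simp: y_def)
  have "exp x = 1 / exp y" by (simp add: y_def exp_minus field_simps)
  also have "\<dots> \<le> 1 / (1 + y)" using y exp_ge_add_one_self[of y] by (intro divide_left_mono) auto
  also have "\<dots> \<le> 1 - y + y\<^sup>2"
  proof -
    have "(1 - y + y\<^sup>2) * (1 + y) = 1 + y^3" by (simp add: algebra_simps eval_nat_numeral)
    with y have "1 \<le> (1 - y + y\<^sup>2) * (1 + y)" by simp
    with y show ?thesis by (simp add: divide_le_eq)
  qed
  finally show ?thesis by (simp add: y_def)
qed

context orlicz
begin

text \<open>Doubling gives polynomial growth of \<open>r \<mapsto> M (r b) / M b\<close>, uniformly in \<open>b \<ge> 1\<close>. The exponential
  is a convenient majorant because it turns sums of independent variables into products.\<close>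

lemma exponential_growth:
  assumes doubling: "\<exists>K. \<forall>u\<ge>1. M (2 * u) \<le> K * M u"
  obtains D where "D \<ge> 1" "\<And>r b. \<lbrakk>0 \<le> r; 1 \<le> b\<rbrakk> \<Longrightarrow> M (r * b) \<le> D * exp r * M b"
proof -
  from doubling obtain K0 where K0: "\<And>u. u \<ge> 1 \<Longrightarrow> M (2 * u) \<le> K0 * M u" by auto
  define K where "K = max 1 K0"
  have K: "M (2 * u) \<le> K * M u" if "u \<ge> 1" for u
  proof -
    have "K0 * M u \<le> K * M u" using M_ge_1[OF that] by (intro mult_right_mono) (auto simp: K_def)
    with K0[OF that] show ?thesis by simp
  qed
  have K1: "K \<ge> 1" by (simp add: K_def)
  have pow: "M (2 ^ n * b) \<le> K ^ n * M b" if "b \<ge> 1" for n b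
  proof (induction n)
    case (Suc n)
    have "1 * 1 \<le> 2 ^ n * b" using that by (intro mult_mono) auto
    then have "M (2 * (2 ^ n * b)) \<le> K * M (2 ^ n * b)" by (intro K) simp
    also have "\<dots> \<le> K * (K ^ n * M b)" using Suc K1 by (intro mult_left_mono) auto
    finally show ?case by (simp add: mult.assoc)
  qed simp
  \<comment> \<open>\<open>K ^ (n + 1)\<close> is at most a constant times \<open>exp (2 ^ n)\<close>, since \<open>2 ^ n\<close> grows faster than
    any multiple of \<open>n\<close>.\<close>
  define \<kappa> where "\<kappa> = ln K"
  have \<kappa>: "\<kappa> \<ge> 0" "K = exp \<kappa>" using K1 by (auto simp: \<kappa>_def)
  obtain N :: nat where N: "\<kappa> < 2 ^ N" using real_arch_pow[of 2 \<kappa>] by auto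
  have exponent: "real (Suc n) * \<kappa> \<le> (real N + 1) * \<kappa> + 2 ^ n" for n
  proof (induction n)
    case 0
    have "1 * \<kappa> \<le> (real N + 1) * \<kappa>" using \<kappa> by (intro mult_right_mono) auto
    then show ?case by simp
  next
    case (Suc n)
    show ?case
    proof (cases "Suc n \<le> N")
      case True
      then have "real (Suc (Suc n)) * \<kappa> \<le> (real N + 1) * \<kappa>"
        using \<kappa> by (intro mult_right_mono) auto
      then show ?thesis by (simp add: add_increasing2)
    next
      case False
      then have "(2::real) ^ N \<le> 2 ^ n" by (intro power_increasing) auto
      with N have "\<kappa> \<le> 2 ^ n" by linarith
      with Suc show ?thesis by (simp add: algebra_simps)
    qed
  qed
  define D where "D = exp ((real N + 1) * \<kappa>)"
  have D1: "D \<ge> 1" using \<kappa> by (simp add: D_def)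
  show ?thesis
  proof
    show "D \<ge> 1" by (fact D1)
    fix r b :: real assume r: "0 \<le> r" and b: "1 \<le> b"
    have Mb: "M b \<ge> 1" using b by (rule M_ge_1)
    define n where "n = (LEAST n. r \<le> 2 ^ n)"
    have ex: "\<exists>n. r \<le> 2 ^ n" using real_arch_pow[of 2 r] by (auto intro: less_imp_le)
    have n: "r \<le> 2 ^ n" unfolding n_def by (rule LeastI_ex[OF ex])
    show "M (r * b) \<le> D * exp r * M b"
    proof (cases n)
      case 0
      have "M (r * b) \<le> M (1 * b)" using n 0 r b by (intro M_mono mult_right_mono) auto
      also have "M (1 * b) = 1 * 1 * M b" by simp
      also have "\<dots> \<le> D * exp r * M b"
        using D1 r Mb by (intro mult_right_mono mult_mono) auto
      finally show ?thesis by simp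
    next
      case (Suc k)
      have "\<not> r \<le> 2 ^ k" using not_less_Least[of k "\<lambda>n. r \<le> 2 ^ n"] Suc by (simp add: n_def)
      have "M (r * b) \<le> M (2 ^ n * b)" using n r b by (intro M_mono mult_right_mono) auto
      also have "\<dots> \<le> K ^ n * M b" by (rule pow[OF b])
      also have "K ^ n = exp (real (Suc k) * \<kappa>)" by (simp only: \<kappa>(2) Suc exp_of_nat_mult)
      also have "\<dots> \<le> exp ((real N + 1) * \<kappa> + r)" using exponent[of k] \<open>\<not> r \<le> 2 ^ k\<close> by simp
      also have "\<dots> = D * exp r" by (simp add: D_def exp_add)
      finally show ?thesis using Mb by simp
    qed
  qed
qed

end

locale growth_orlicz = orlicz +
  fixes D :: real
  assumes D_ge_1: "D \<ge> 1"
    and growth: "\<And>r b. \<lbrakk>0 \<le> r; 1 \<le> b\<rbrakk> \<Longrightarrow> M (r * b) \<le> D * exp r * M b"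
begin

text \<open>If \<open>N\<close> of the summands are nonzero, then the sum is at most \<open>N\<close> times the largest one, and growth
  costs the factor \<open>D exp N\<close>. The latter is a product over the summands.\<close>

lemma M_sum_le:
  fixes b :: "nat \<Rightarrow> real"
  assumes b: "\<And>n. n < m \<Longrightarrow> b n = 0 \<or> b n \<ge> 1"
  shows "M (\<Sum>n<m. b n) \<le> D * (\<Sum>n<m. M (b n) * (\<Prod>k<m. if b k = 0 then 1 else exp 1))"
proof (cases "\<forall>n<m. b n = 0")
  case True
  then show ?thesis by simp
next
  case False
  let ?I = "{n. n < m \<and> b n \<noteq> 0}"
  have b0: "b n \<ge> 0" if "n < m" for n using b[OF that] by auto
  have prod: "(\<Prod>k<m. if b k = 0 then 1 else exp 1) = exp (real (card ?I))"
  proof -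
    have "(\<Prod>k<m. if b k = 0 then 1 else exp 1) = (\<Prod>k\<in>?I. exp (1::real))"
      by (rule prod.mono_neutral_cong_right) auto
    then show ?thesis by (simp flip: exp_of_nat_mult)
  qed
  have fin: "finite (b ` ?I)" "b ` ?I \<noteq> {}" using False by auto
  from Max_in[OF fin] obtain k where k: "k \<in> ?I" "Max (b ` ?I) = b k" by auto
  have max: "b n \<le> b k" if "n \<in> ?I" for n using Max_ge[OF fin(1), of "b n"] that k by simp
  have bk: "b k \<ge> 1" using b[of k] k by auto
  have "(\<Sum>n<m. b n) = (\<Sum>n\<in>?I. b n)" by (rule sum.mono_neutral_right) auto
  also have "\<dots> \<le> (\<Sum>n\<in>?I. b k)" by (intro sum_mono max)
  also have "\<dots> = real (card ?I) * b k" by simp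
  finally have "M (\<Sum>n<m. b n) \<le> M (real (card ?I) * b k)"
    using b0 by (intro M_mono sum_nonneg) auto
  also have "\<dots> \<le> D * exp (real (card ?I)) * M (b k)" using bk by (intro growth) auto
  also have "\<dots> \<le> D * exp (real (card ?I)) * (\<Sum>n<m. M (b n))"
    using D_ge_1 k b0 by (intro mult_left_mono member_le_sum M_nonneg) auto
  finally show ?thesis by (simp add: prod mult.assoc mult.commute[of "exp _"] flip: sum_distrib_right)
qed

text \<open>Every term on the right is a product of functions of one summand each, so that
  independence applies to it.\<close>

lemma M_sum_split:
  fixes x :: "nat \<Rightarrow> real"
  shows "M (\<bar>\<Sum>n<m. x n\<bar> / 2) \<le>
    D * ((\<Prod>n<m. exp (if \<bar>x n\<bar> \<le> 1 then x n else 0)) + (\<Prod>n<m. exp (- (if \<bar>x n\<bar> \<le> 1 then x n else 0)))) +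
    D * (\<Sum>n<m. \<Prod>k<m. if \<bar>x k\<bar> \<le> 1 then (if k = n then 0 else 1) else (if k = n then M \<bar>x k\<bar> else 1) * exp 1)"
proof -
  define s where "s n = (if \<bar>x n\<bar> \<le> 1 then x n else 0)" for n
  define b where "b n = (if \<bar>x n\<bar> \<le> 1 then 0 else \<bar>x n\<bar>)" for n
  have b0: "b n \<ge> 0" for n by (simp add: b_def)
  have "\<bar>\<Sum>n<m. x n\<bar> = \<bar>(\<Sum>n<m. s n) + (\<Sum>n<m. x n - s n)\<bar>"
    by (simp add: sum_subtractf)
  also have "\<dots> \<le> \<bar>\<Sum>n<m. s n\<bar> + (\<Sum>n<m. b n)"
  proof -
    have "\<bar>\<Sum>n<m. x n - s n\<bar> \<le> (\<Sum>n<m. \<bar>x n - s n\<bar>)" by (rule sum_abs)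
    also have "\<dots> = (\<Sum>n<m. b n)" by (intro sum.cong) (auto simp: s_def b_def)
    finally show ?thesis by linarith
  qed
  finally have "M (\<bar>\<Sum>n<m. x n\<bar> / 2) \<le> M ((1 - 1/2) * \<bar>\<Sum>n<m. s n\<bar> + 1/2 * (\<Sum>n<m. b n))"
    by (intro M_mono) auto
  also have "\<dots> \<le> (1 - 1/2) * M \<bar>\<Sum>n<m. s n\<bar> + 1/2 * M (\<Sum>n<m. b n)"
    using b0 by (intro M_convexD sum_nonneg) auto
  also have "\<dots> \<le> M \<bar>\<Sum>n<m. s n\<bar> + M (\<Sum>n<m. b n)"
    using M_nonneg[of "\<bar>\<Sum>n<m. s n\<bar>"] M_nonneg[of "\<Sum>n<m. b n"] b0 by (auto simp: sum_nonneg)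
  also have "M \<bar>\<Sum>n<m. s n\<bar> \<le> D * ((\<Prod>n<m. exp (s n)) + (\<Prod>n<m. exp (- s n)))"
  proof -
    have "M \<bar>\<Sum>n<m. s n\<bar> \<le> D * exp \<bar>\<Sum>n<m. s n\<bar>" using growth[of "\<bar>\<Sum>n<m. s n\<bar>" 1] by simp
    also have "exp \<bar>\<Sum>n<m. s n\<bar> \<le> exp (\<Sum>n<m. s n) + exp (- (\<Sum>n<m. s n))"
      by (auto simp: abs_if)
    also have "\<dots> = (\<Prod>n<m. exp (s n)) + (\<Prod>n<m. exp (- s n))"
      by (simp add: exp_sum sum_negf[symmetric] del: sum_negf)
    finally show ?thesis using D_ge_1 by (simp add: mult_left_mono)
  qed
  also have "M (\<Sum>n<m. b n) \<le> D * (\<Sum>n<m. M (b n) * (\<Prod>k<m. if b k = 0 then 1 else exp 1))"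
    by (intro M_sum_le) (auto simp: b_def)
  also have "(\<Sum>n<m. M (b n) * (\<Prod>k<m. if b k = 0 then 1 else exp 1)) =
      (\<Sum>n<m. \<Prod>k<m. if \<bar>x k\<bar> \<le> 1 then (if k = n then 0 else 1) else (if k = n then M \<bar>x k\<bar> else 1) * exp 1)"
  proof (rule sum.cong[OF refl])
    fix n assume n: "n \<in> {..<m}"
    let ?P = "\<Prod>k\<in>{..<m} - {n}. if b k = 0 then 1 else exp (1::real)"
    have "M (b n) * (\<Prod>k<m. if b k = 0 then 1 else exp 1) = M (b n) * (if b n = 0 then 1 else exp 1) * ?P"
      using n by (subst prod.remove[of _ n]) auto
    also have "?P = (\<Prod>k\<in>{..<m} - {n}. if \<bar>x k\<bar> \<le> 1 then (if k = n then 0 else 1)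
        else (if k = n then M \<bar>x k\<bar> else 1) * exp 1)"
      by (intro prod.cong) (auto simp: b_def)
    also have "M (b n) * (if b n = 0 then 1 else exp 1) * \<dots> =
      (\<Prod>k<m. if \<bar>x k\<bar> \<le> 1 then (if k = n then 0 else 1) else (if k = n then M \<bar>x k\<bar> else 1) * exp 1)"
      using n by (subst (2) prod.remove[of _ n]) (auto simp: b_def)
    finally show "M (b n) * (\<Prod>k<m. if b k = 0 then 1 else exp 1) =
      (\<Prod>k<m. if \<bar>x k\<bar> \<le> 1 then (if k = n then 0 else 1) else (if k = n then M \<bar>x k\<bar> else 1) * exp 1)" .
  qed
  finally show ?thesis by (simp add: s_def)
qed

end

locale growth_orlicz_digits = growth_orlicz M D + digit_expansion L
  for M :: "real \<Rightarrow> real" and D :: real and L :: "nat \<Rightarrow> nat"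
begin

lemma average_exp_small_part_le:
  fixes v :: "nat \<Rightarrow> real"
  assumes "average n (\<lambda>d. if \<bar>v d\<bar> \<le> 1 then v d else 0) = 0"
  shows "average n (\<lambda>d. exp (if \<bar>v d\<bar> \<le> 1 then v d else 0)) \<le> exp (average n (\<lambda>d. min 1 ((v d)\<^sup>2)))"
proof -
  have "average n (\<lambda>d. exp (if \<bar>v d\<bar> \<le> 1 then v d else 0)) \<le>
      average n (\<lambda>d. (1 + (if \<bar>v d\<bar> \<le> 1 then v d else 0)) + min 1 ((v d)\<^sup>2))"
  proof (intro average_mono)
    fix d
    have "(v d)\<^sup>2 \<le> 1" if "\<bar>v d\<bar> \<le> 1" using that by (simp add: abs_square_le_1)
    then show "exp (if \<bar>v d\<bar> \<le> 1 then v d else 0) \<le> (1 + (if \<bar>v d\<bar> \<le> 1 then v d else 0)) + min 1 ((v d)\<^sup>2)"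
      using exp_le_quadratic[of "v d"] by (auto simp: min_def)
  qed
  also have "\<dots> = 1 + average n (\<lambda>d. min 1 ((v d)\<^sup>2))"
    by (simp only: average_add average_const assms)
  also have "\<dots> \<le> exp (average n (\<lambda>d. min 1 ((v d)\<^sup>2)))" by (rule exp_ge_add_one_self)
  finally show ?thesis .
qed

text \<open>The moment estimate. Small summands have exponential moments bounded through their
  total variance. Of the large ones only few occur at the same time, so their sum costs no more
  than a constant times the sum of the separate modulars.\<close>

lemma digit_sum_modular_bound:
  assumes mean: "\<And>n. n < m \<Longrightarrow> average n (\<lambda>d. if \<bar>w n d\<bar> \<le> 1 then w n d else 0) = 0"
    and B: "(\<Sum>n<m. average n (\<lambda>d. min 1 ((w n d)\<^sup>2))) \<le> 1"
  shows "(\<integral>t. M (\<bar>digit_sum w m t\<bar> / 2) \<partial>\<U>) \<le>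
    D * (2 * exp 1) + D * (exp 3 * (\<Sum>n<m. average n (\<lambda>d. if \<bar>w n d\<bar> \<le> 1 then 0 else M \<bar>w n d\<bar>)))"
proof -
  define \<phi> where "\<phi> n = average n (\<lambda>d. min 1 ((w n d)\<^sup>2))" for n
  have \<phi>0: "\<phi> n \<ge> 0" for n unfolding \<phi>_def average_def by (intro divide_nonneg_nonneg sum_nonneg) auto
  define F1 F2 where "F1 n d = exp (if \<bar>w n d\<bar> \<le> 1 then w n d else 0)"
    and "F2 n d = exp (- (if \<bar>w n d\<bar> \<le> 1 then w n d else 0))" for n d
  define F where "F n k d = (if \<bar>w k d\<bar> \<le> 1 then (if k = n then 0 else 1)
    else (if k = n then M \<bar>w k d\<bar> else 1) * exp 1)" for n k d
  define P1 P2 where "P1 t = (\<Prod>n<m. F1 n (digit n t))" and "P2 t = (\<Prod>n<m. F2 n (digit n t))" for t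
  define Q where "Q n t = (\<Prod>k<m. F n k (digit k t))" for n t
  have int: "integrable \<U> P1" "integrable \<U> P2" "integrable \<U> (Q n)" for n
    unfolding P1_def P2_def Q_def by (intro integrable_cellwise[of m] cellwise_digits; simp)+
  have "(\<integral>t. M (\<bar>digit_sum w m t\<bar> / 2) \<partial>\<U>) \<le> (\<integral>t. D * (P1 t + P2 t) + D * (\<Sum>n<m. Q n t) \<partial>\<U>)"
  proof (rule integral_mono)
    show "integrable \<U> (\<lambda>t. M (\<bar>digit_sum w m t\<bar> / 2))"
      by (intro integrable_cellwise[of m] cellwise_digit_sum)
    show "integrable \<U> (\<lambda>t. D * (P1 t + P2 t) + D * (\<Sum>n<m. Q n t))" using int by simp
    show "M (\<bar>digit_sum w m t\<bar> / 2) \<le> D * (P1 t + P2 t) + D * (\<Sum>n<m. Q n t)" for t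
      using M_sum_split[where m = m and x = "\<lambda>n. w n (digit n t)"]
      by (simp add: digit_sum_def P1_def P2_def Q_def F1_def F2_def F_def)
  qed
  also have "\<dots> = D * ((\<integral>t. P1 t \<partial>\<U>) + (\<integral>t. P2 t \<partial>\<U>)) + D * (\<Sum>n<m. \<integral>t. Q n t \<partial>\<U>)"
    using int by simp
  also have "\<dots> \<le> D * (exp 1 + exp 1) +
      D * (\<Sum>n<m. exp 3 * average n (\<lambda>d. if \<bar>w n d\<bar> \<le> 1 then 0 else M \<bar>w n d\<bar>))"
  proof (intro add_mono mult_left_mono sum_mono)
    have exp_phi: "(\<Prod>n<m. exp (\<phi> n)) \<le> exp 1" using B by (simp add: \<phi>_def flip: exp_sum)
    have "(\<integral>t. P1 t \<partial>\<U>) = (\<Prod>n<m. average n (F1 n))" unfolding P1_def by (rule digits_independent)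
    also have "\<dots> \<le> (\<Prod>n<m. exp (\<phi> n))"
    proof (intro prod_mono conjI)
      fix n assume "n \<in> {..<m}"
      then show "average n (F1 n) \<le> exp (\<phi> n)"
        unfolding F1_def \<phi>_def by (intro average_exp_small_part_le mean) auto
      show "0 \<le> average n (F1 n)"
        unfolding average_def F1_def by (intro divide_nonneg_nonneg sum_nonneg) auto
    qed
    also note exp_phi
    finally show "(\<integral>t. P1 t \<partial>\<U>) \<le> exp 1" .
    have "(\<integral>t. P2 t \<partial>\<U>) = (\<Prod>n<m. average n (F2 n))" unfolding P2_def by (rule digits_independent)
    also have "\<dots> \<le> (\<Prod>n<m. exp (\<phi> n))"
    proof (intro prod_mono conjI)
      fix n assume n: "n \<in> {..<m}"
      have neg: "- (if \<bar>x\<bar> \<le> 1 then x else 0) = (if \<bar>- x\<bar> \<le> 1 then - x else 0)" for x :: real by simp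
      have "average n (\<lambda>d. if \<bar>- w n d\<bar> \<le> 1 then - w n d else 0) = - average n (\<lambda>d. if \<bar>w n d\<bar> \<le> 1 then w n d else 0)"
        unfolding neg[symmetric] by (simp add: average_def sum_negf)
      then have "average n (\<lambda>d. exp (if \<bar>- w n d\<bar> \<le> 1 then - w n d else 0)) \<le>
          exp (average n (\<lambda>d. min 1 ((- w n d)\<^sup>2)))"
        using mean n by (intro average_exp_small_part_le) auto
      then show "average n (F2 n) \<le> exp (\<phi> n)"
        unfolding F2_def \<phi>_def neg by simp
      show "0 \<le> average n (F2 n)"
        unfolding average_def F2_def by (intro divide_nonneg_nonneg sum_nonneg) auto
    qed
    also note exp_phi
    finally show "(\<integral>t. P2 t \<partial>\<U>) \<le> exp 1" .
    fix n assume n: "n \<in> {..<m}"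
    have F0: "F n k d \<ge> 0" for k d by (simp add: F_def M_nonneg)
    have avg0: "0 \<le> average k (F n k)" for k
      unfolding average_def using F0 by (intro divide_nonneg_nonneg sum_nonneg) auto
    define G where "G = average n (\<lambda>d. if \<bar>w n d\<bar> \<le> 1 then 0 else M \<bar>w n d\<bar>)"
    have G0: "G \<ge> 0"
      unfolding G_def average_def by (intro divide_nonneg_nonneg sum_nonneg) (auto simp: M_nonneg)
    have "(\<integral>t. Q n t \<partial>\<U>) = (\<Prod>k<m. average k (F n k))" unfolding Q_def by (rule digits_independent)
    also have "\<dots> = average n (F n n) * (\<Prod>k\<in>{..<m} - {n}. average k (F n k))"
      using n by (subst prod.remove[of _ n]) auto
    also have "average n (F n n) = exp 1 * G"
    proof -
      have "F n n = (\<lambda>d. exp 1 * (if \<bar>w n d\<bar> \<le> 1 then 0 else M \<bar>w n d\<bar>))" by (auto simp: F_def)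
      then show ?thesis by (simp only: average_cmult G_def)
    qed
    also have "(\<Prod>k\<in>{..<m} - {n}. average k (F n k)) \<le> (\<Prod>k\<in>{..<m} - {n}. exp (2 * \<phi> k))"
    proof (intro prod_mono conjI avg0)
      fix k assume k: "k \<in> {..<m} - {n}"
      have "average k (F n k) \<le> average k (\<lambda>d. 1 + 2 * min 1 ((w k d)\<^sup>2))"
      proof (intro average_mono)
        fix d
        have "exp 1 \<le> (3::real)" by (rule exp_le)
        moreover have "1 \<le> (w k d)\<^sup>2" if "\<bar>w k d\<bar> > 1"
          using that abs_square_less_1[of "w k d"] by linarith
        ultimately show "F n k d \<le> 1 + 2 * min 1 ((w k d)\<^sup>2)"
          using k by (auto simp: F_def min_def)
      qed
      also have "\<dots> = 1 + 2 * \<phi> k" by (simp only: average_add average_const average_cmult \<phi>_def)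
      also have "\<dots> \<le> exp (2 * \<phi> k)" by (rule exp_ge_add_one_self)
      finally show "average k (F n k) \<le> exp (2 * \<phi> k)" .
    qed
    also have "\<dots> = exp (2 * (\<Sum>k\<in>{..<m} - {n}. \<phi> k))" by (simp add: exp_sum sum_distrib_left)
    also have "(\<Sum>k\<in>{..<m} - {n}. \<phi> k) \<le> 1"
      using B \<phi>0 sum_mono2[of "{..<m}" "{..<m} - {n}" \<phi>] by (simp add: \<phi>_def[symmetric])
    finally have "(\<integral>t. Q n t \<partial>\<U>) \<le> exp 1 * G * exp (2 * 1)"
      using G0 by (simp add: mult_left_mono)
    also have "\<dots> = exp 3 * G" by (simp flip: exp_add)
    finally show "(\<integral>t. Q n t \<partial>\<U>) \<le> exp 3 * average n (\<lambda>d. if \<bar>w n d\<bar> \<le> 1 then 0 else M \<bar>w n d\<bar>)"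
      by (simp add: G_def)
  qed (use D_ge_1 in auto)
  finally show ?thesis by (simp add: sum_distrib_left)
qed

end

section \<open>Elements of the convex hull as modulars of bumps\<close>

lemma mspace_C01: "mspace C01 = {f. f \<in> extensional {0..1} \<and> continuous_on {0..1} f}"
  by (subst compactin_mspace_cfunspace) (auto simp: compactin_subtopology)

lemma restrict_in_C01:
  assumes "continuous_on {0..1} f" shows "restrict f {0..1} \<in> mspace C01"
proof -
  have "continuous_on {0..1} (restrict f {0..1})"
    using assms by (rule continuous_on_cong[THEN iffD1, rotated 2]) auto
  then show ?thesis unfolding mspace_C01 by simp
qed

lemma C01_continuous: "f \<in> mspace C01 \<Longrightarrow> continuous_on {0..1} f"
  unfolding mspace_C01 by simp

lemma mdist_C01_le:
  assumes "f \<in> mspace C01" "g \<in> mspace C01" "mdist C01 f g \<le> e" "x \<in> {0..1}"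
  shows "\<bar>f x - g x\<bar> \<le> e"
  using mdist_cfunspace_imp_mdist_le[OF assms(1-3), of x] assms(4) by (simp add: dist_real_def)

lemma M_quotient_in_C01:
  assumes "orlicz_function M" "y > 0"
  shows "restrict (\<lambda>x. M (x * y) / M y) {0..1} \<in> mspace C01"
proof -
  interpret orlicz M by unfold_locales fact
  have "M y > 0" using strict_mono_onD[OF M_strict, of 0 y] assms(2) by simp
  then show ?thesis
    using assms(2)
    by (intro restrict_in_C01 continuous_intros continuous_on_compose2[OF M_continuous]) auto
qed

context growth_orlicz
begin

text \<open>Properties of \<open>x \<mapsto> M (x y) / M y\<close>, for \<open>y > A\<close>, that survive convex combinations. The
  lower bound keeps limits from vanishing near \<open>0\<close>. The last property says that \<open>\<theta> \<phi>\<close> is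
  the modular of the multiples of one function on a short interval. Keeping \<open>\<theta>\<close> and the left end point
  variable makes it stable under convex combinations: the functions for \<open>(1 - p) \<theta>\<close> and \<open>p \<theta>\<close> are
  placed on adjacent intervals.\<close>

definition realizable :: "real \<Rightarrow> (real \<Rightarrow> real) \<Rightarrow> bool" where
  "realizable A \<phi> \<longleftrightarrow> \<phi> 0 = 0 \<and> \<phi> 1 = 1 \<and>
     (\<forall>x y. 0 \<le> x \<and> x \<le> y \<and> y \<le> 1 \<longrightarrow> y * \<phi> x \<le> x * \<phi> y) \<and>
     (\<forall>r. 1 \<le> r \<and> r \<le> A \<longrightarrow> 1 / (D * exp r) \<le> \<phi> (1 / r)) \<and>
     (\<forall>a \<theta>. 0 \<le> \<theta> \<and> \<theta> \<le> 1 \<longrightarrow> (\<exists>g. g \<in> borel_measurable borel \<and> (\<forall>t. 0 \<le> g t) \<and> (\<exists>b. \<forall>t. g t \<le> b) \<and>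
        (\<forall>t. t \<notin> {a..<a + \<theta> / M A} \<longrightarrow> g t = 0) \<and>
        (\<forall>x\<in>{0..1}. has_bochner_integral lborel (\<lambda>t. M (x * g t)) (\<theta> * \<phi> x))))"

lemma realizable_quotient:
  assumes "A \<ge> 1" "y > A" shows "realizable A (\<lambda>x. M (x * y) / M y)"
proof -
  have My: "M y \<ge> 1" "M A \<ge> 1" "M A \<le> M y" using assms M_ge_1 M_mono[of A y] by auto
  show ?thesis
    unfolding realizable_def
  proof (intro conjI allI impI)
    show "M (0 * y) / M y = 0" "M (1 * y) / M y = 1" using My by auto
    show "v * (M (u * y) / M y) \<le> u * (M (v * y) / M y)" if "0 \<le> u \<and> u \<le> v \<and> v \<le> 1" for u v
    proof (cases "v = 0")
      case False
      then have v: "v > 0" using that by simp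
      then have "M ((u / v) * (v * y)) \<le> (u / v) * M (v * y)"
        using that assms by (intro M_scale) auto
      then have "v * M (u * y) \<le> u * M (v * y)" using v by (simp add: field_simps)
      then have "v * M (u * y) / M y \<le> u * M (v * y) / M y"
        using My by (intro divide_right_mono) auto
      then show ?thesis by simp
    qed (use that in simp)
    show "1 / (D * exp r) \<le> M (1 / r * y) / M y" if r: "1 \<le> r \<and> r \<le> A" for r
    proof -
      have "M (r * (y / r)) \<le> D * exp r * M (y / r)"
        using r assms by (intro growth) (auto simp: le_divide_eq)
      then have "M y \<le> D * exp r * M (y / r)" using r by simp
      then show ?thesis using D_ge_1 My by (simp add: field_simps)
    qed
    fix a \<theta> :: real assume \<theta>: "0 \<le> \<theta> \<and> \<theta> \<le> 1"
    define I where "I = {a..<a + \<theta> / M y}"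
    define g where "g t = y * indicator I t" for t :: real
    have I: "I \<in> sets borel" "emeasure lborel I < \<infinity>" "measure lborel I = \<theta> / M y"
      using \<theta> My by (auto simp: I_def)
    have "has_bochner_integral lborel (\<lambda>t. M (x * g t)) (\<theta> * (M (x * y) / M y))" for x
    proof -
      have "has_bochner_integral lborel (\<lambda>t. indicator I t *\<^sub>R M (x * y)) (measure lborel I *\<^sub>R M (x * y))"
        using I by (intro has_bochner_integral_scaleR_left has_bochner_integral_real_indicator) auto
      moreover have "M (x * g t) = indicator I t *\<^sub>R M (x * y)" for t
        by (auto simp: g_def indicator_def)
      ultimately show ?thesis using I by simp
    qed
    moreover have "g t = 0" if "t \<notin> {a..<a + \<theta> / M A}" for t
    proof -
      have "\<theta> / M y \<le> \<theta> / M A" using My \<theta> by (intro divide_left_mono) auto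
      with that show ?thesis by (auto simp: g_def I_def)
    qed
    ultimately show "\<exists>g. g \<in> borel_measurable borel \<and> (\<forall>t. 0 \<le> g t) \<and> (\<exists>b. \<forall>t. g t \<le> b) \<and>
        (\<forall>t. t \<notin> {a..<a + \<theta> / M A} \<longrightarrow> g t = 0) \<and>
        (\<forall>x\<in>{0..1}. has_bochner_integral lborel (\<lambda>t. M (x * g t)) (\<theta> * (M (x * y) / M y)))"
    proof (intro exI[of _ g] conjI)
      show "g \<in> borel_measurable borel" using I unfolding g_def by simp
      show "\<forall>t. 0 \<le> g t" using assms by (simp add: g_def)
      show "\<exists>b. \<forall>t. g t \<le> b" using assms by (intro exI[of _ y]) (simp add: g_def indicator_def)
    qed auto
  qed
qed

lemma realizable_convex:
  assumes "A \<ge> 1" "realizable A \<phi>" "realizable A \<xi>" "0 \<le> p" "p \<le> 1"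
  shows "realizable A (\<lambda>x. (1 - p) * \<phi> x + p * \<xi> x)"
  unfolding realizable_def
proof (intro conjI allI impI)
  show "(1 - p) * \<phi> 0 + p * \<xi> 0 = 0" "(1 - p) * \<phi> 1 + p * \<xi> 1 = 1"
    using assms by (auto simp: realizable_def)
  show "v * ((1 - p) * \<phi> u + p * \<xi> u) \<le> u * ((1 - p) * \<phi> v + p * \<xi> v)"
    if "0 \<le> u \<and> u \<le> v \<and> v \<le> 1" for u v
  proof -
    have "v * \<phi> u \<le> u * \<phi> v" "v * \<xi> u \<le> u * \<xi> v" using assms that by (auto simp: realizable_def)
    then have "(1 - p) * (v * \<phi> u) + p * (v * \<xi> u) \<le> (1 - p) * (u * \<phi> v) + p * (u * \<xi> v)"
      using assms by (intro add_mono mult_left_mono) auto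
    then show ?thesis by (simp add: algebra_simps)
  qed
  show "1 / (D * exp r) \<le> (1 - p) * \<phi> (1 / r) + p * \<xi> (1 / r)" if r: "1 \<le> r \<and> r \<le> A" for r
  proof -
    define q where "q = 1 / (D * exp r)"
    have "q \<le> \<phi> (1 / r)" "q \<le> \<xi> (1 / r)" using assms r by (auto simp: realizable_def q_def)
    then have "(1 - p) * q + p * q \<le> (1 - p) * \<phi> (1 / r) + p * \<xi> (1 / r)"
      using assms by (intro add_mono mult_left_mono) auto
    then show ?thesis by (simp add: left_diff_distrib flip: q_def)
  qed
  fix a \<theta> :: real assume \<theta>: "0 \<le> \<theta> \<and> \<theta> \<le> 1"
  have MA: "M A > 0" using M_ge_1[OF assms(1)] by simp
  define a' where "a' = a + (1 - p) * \<theta> / M A"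
  have a': "a \<le> a'" "a' + p * \<theta> / M A = a + \<theta> / M A" "a' \<le> a + \<theta> / M A"
  proof -
    show "a \<le> a'" using assms \<theta> MA by (simp add: a'_def)
    show eq: "a' + p * \<theta> / M A = a + \<theta> / M A" by (simp add: a'_def field_simps diff_divide_distrib)
    have "p * \<theta> / M A \<ge> 0" using assms \<theta> MA by simp
    with eq show "a' \<le> a + \<theta> / M A" by linarith
  qed
  have p: "0 \<le> (1 - p) * \<theta>" "(1 - p) * \<theta> \<le> 1" "0 \<le> p * \<theta>" "p * \<theta> \<le> 1"
    using \<theta> assms by (auto intro!: mult_le_one)
  from assms(2) p obtain g b where g: "g \<in> borel_measurable borel" "\<And>t. 0 \<le> g t" "\<And>t. g t \<le> b"
    "\<And>t. t \<notin> {a..<a + (1 - p) * \<theta> / M A} \<Longrightarrow> g t = 0"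
    "\<And>x. x \<in> {0..1} \<Longrightarrow> has_bochner_integral lborel (\<lambda>t. M (x * g t)) ((1 - p) * \<theta> * \<phi> x)"
    unfolding realizable_def by meson
  from assms(3) p obtain h c where h: "h \<in> borel_measurable borel" "\<And>t. 0 \<le> h t" "\<And>t. h t \<le> c"
    "\<And>t. t \<notin> {a'..<a' + p * \<theta> / M A} \<Longrightarrow> h t = 0"
    "\<And>x. x \<in> {0..1} \<Longrightarrow> has_bochner_integral lborel (\<lambda>t. M (x * h t)) (p * \<theta> * \<xi> x)"
    unfolding realizable_def by meson
  have disj: "g t = 0 \<or> h t = 0" for t
    using g(4)[of t, folded a'_def] h(4)[of t] by (cases "t < a'") auto
  show "\<exists>g. g \<in> borel_measurable borel \<and> (\<forall>t. 0 \<le> g t) \<and> (\<exists>b. \<forall>t. g t \<le> b) \<and>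
      (\<forall>t. t \<notin> {a..<a + \<theta> / M A} \<longrightarrow> g t = 0) \<and>
      (\<forall>x\<in>{0..1}. has_bochner_integral lborel (\<lambda>t. M (x * g t)) (\<theta> * ((1 - p) * \<phi> x + p * \<xi> x)))"
  proof (intro exI[of _ "\<lambda>t. g t + h t"] conjI allI impI ballI)
    show "(\<lambda>t. g t + h t) \<in> borel_measurable borel" using g h by simp
    show "0 \<le> g t + h t" for t using g(2)[of t] h(2)[of t] by simp
    show "\<exists>b. \<forall>t. g t + h t \<le> b" using g(3) h(3) by (intro exI[of _ "b + c"]) (auto intro: add_mono)
    show "g t + h t = 0" if "t \<notin> {a..<a + \<theta> / M A}" for t
    proof -
      have "t \<notin> {a..<a'}" "t \<notin> {a'..<a + \<theta> / M A}" using that a' by auto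
      then show ?thesis using g(4)[of t, folded a'_def] h(4)[of t] a' by simp
    qed
    fix x :: real assume x: "x \<in> {0..1}"
    have "has_bochner_integral lborel (\<lambda>t. M (x * g t) + M (x * h t)) ((1 - p) * \<theta> * \<phi> x + p * \<theta> * \<xi> x)"
      using x by (intro has_bochner_integral_add g h)
    moreover have "M (x * g t) + M (x * h t) = M (x * (g t + h t))" for t
      using disj[of t] by auto
    ultimately show "has_bochner_integral lborel (\<lambda>t. M (x * (g t + h t))) (\<theta> * ((1 - p) * \<phi> x + p * \<xi> x))"
      by (simp add: algebra_simps)
  qed
qed

definition approximable :: "real \<Rightarrow> (real \<Rightarrow> real) set" where
  "approximable A = {f \<in> mspace C01. \<forall>\<eta>>0. \<exists>\<phi>. realizable A \<phi> \<and> (\<forall>x\<in>{0..1}. \<bar>f x - \<phi> x\<bar> \<le> \<eta>)}"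

lemma closedin_approximable: "closedin (mtopology_of C01) (approximable A)"
proof -
  interpret C: Metric_space "mspace C01" "mdist C01" by (rule Metric_space_mspace_mdist)
  have "closedin C.mtopology (approximable A)"
    unfolding C.closedin_metric
  proof (intro conjI allI impI)
    show "approximable A \<subseteq> mspace C01" by (auto simp: approximable_def)
    fix f assume f: "f \<in> mspace C01 - approximable A"
    then obtain \<eta> where \<eta>: "\<eta> > 0" "\<And>\<phi>. realizable A \<phi> \<Longrightarrow> \<exists>x\<in>{0..1}. \<not> \<bar>f x - \<phi> x\<bar> \<le> \<eta>"
      unfolding approximable_def by auto
    have "disjnt (approximable A) (C.mball f (\<eta>/2))"
      unfolding disjnt_iff
    proof (intro allI notI; elim conjE)
      fix g assume g: "g \<in> approximable A" "g \<in> C.mball f (\<eta>/2)"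
      have "\<eta>/2 > 0" using \<eta> by simp
      with g obtain \<phi> where \<phi>: "realizable A \<phi>" "\<And>x. x \<in> {0..1} \<Longrightarrow> \<bar>g x - \<phi> x\<bar> \<le> \<eta>/2"
        unfolding approximable_def by blast
      have "\<bar>f x - \<phi> x\<bar> \<le> \<eta>" if "x \<in> {0..1}" for x
      proof -
        have "f \<in> mspace C01" "g \<in> mspace C01" "mdist C01 f g \<le> \<eta>/2"
          using g(2) unfolding C.in_mball by auto
        then have "\<bar>f x - g x\<bar> \<le> \<eta>/2" by (rule mdist_C01_le[OF _ _ _ that])
        with \<phi>(2)[OF that] show ?thesis by linarith
      qed
      with \<eta>(2)[OF \<phi>(1)] show False by blast
    qed
    with \<eta> show "\<exists>r>0. disjnt (approximable A) (C.mball f r)" by (intro exI[of _ "\<eta>/2"]) auto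
  qed
  then show ?thesis by (simp add: mtopology_of_def)
qed

lemma convex_approximable: "A \<ge> 1 \<Longrightarrow> convex_in_C01 (approximable A)"
  unfolding convex_in_C01_def
proof (intro ballI)
  fix f g p assume A: "A \<ge> 1" and f: "f \<in> approximable A" and g: "g \<in> approximable A" and p: "p \<in> {0..1::real}"
  let ?h = "restrict (\<lambda>x. (1 - p) * f x + p * g x) {0..1}"
  have "continuous_on {0..1} (\<lambda>x. (1 - p) * f x + p * g x)"
    using f g by (intro continuous_intros C01_continuous) (auto simp: approximable_def)
  then have "?h \<in> mspace C01" by (rule restrict_in_C01)
  moreover have "\<exists>\<phi>. realizable A \<phi> \<and> (\<forall>x\<in>{0..1}. \<bar>?h x - \<phi> x\<bar> \<le> \<eta>)" if \<eta>: "\<eta> > 0" for \<eta>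
  proof -
    obtain \<phi> where \<phi>: "realizable A \<phi>" "\<And>x. x \<in> {0..1} \<Longrightarrow> \<bar>f x - \<phi> x\<bar> \<le> \<eta>"
      using f \<eta> unfolding approximable_def by blast
    obtain \<xi> where \<xi>: "realizable A \<xi>" "\<And>x. x \<in> {0..1} \<Longrightarrow> \<bar>g x - \<xi> x\<bar> \<le> \<eta>"
      using g \<eta> unfolding approximable_def by blast
    have "\<bar>?h x - ((1 - p) * \<phi> x + p * \<xi> x)\<bar> \<le> \<eta>" if "x \<in> {0..1}" for x
    proof -
      have "?h x - ((1 - p) * \<phi> x + p * \<xi> x) = (1 - p) * (f x - \<phi> x) + p * (g x - \<xi> x)"
        using that by (simp add: algebra_simps)
      also have "\<bar>\<dots>\<bar> \<le> (1 - p) * \<bar>f x - \<phi> x\<bar> + p * \<bar>g x - \<xi> x\<bar>"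
        using p abs_triangle_ineq[of "(1 - p) * (f x - \<phi> x)" "p * (g x - \<xi> x)"] by (simp add: abs_mult)
      also have "\<dots> \<le> (1 - p) * \<eta> + p * \<eta>"
        using p \<phi>(2)[OF that] \<xi>(2)[OF that] by (intro add_mono mult_left_mono) auto
      finally show ?thesis by (simp add: algebra_simps)
    qed
    with realizable_convex[OF A \<phi>(1) \<xi>(1), of p] p show ?thesis by auto
  qed
  ultimately show "?h \<in> approximable A" by (simp add: approximable_def)
qed

text \<open>Uniform limits of realizable functions form a closed convex set that contains the generators
  of \<open>E_infinity M\<close>, hence the hull.\<close>

lemma C_infinity_subset_approximable:
  assumes "A \<ge> 1" shows "C_infinity M \<subseteq> approximable A"
  unfolding C_infinity_def
proof (rule hull_minimal)
  have "{restrict (\<lambda>x. M (x * y) / M y) {0..1} | y. y > A} \<subseteq> approximable A"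
  proof clarify
    fix y assume y: "y > A"
    have "restrict (\<lambda>x. M (x * y) / M y) {0..1} \<in> mspace C01"
      using y assms by (intro M_quotient_in_C01 orlicz) auto
    then show "restrict (\<lambda>x. M (x * y) / M y) {0..1} \<in> approximable A"
      unfolding approximable_def using realizable_quotient[OF assms y]
      by (intro CollectI conjI allI impI exI[of _ "\<lambda>x. M (x * y) / M y"]) auto
  qed
  then have "E_infinity_from M A \<subseteq> approximable A"
    unfolding E_infinity_from_def by (rule closure_of_minimal[OF _ closedin_approximable])
  then show "E_infinity M \<subseteq> approximable A"
    using assms unfolding E_infinity_def by auto
  show "closedin (mtopology_of C01) (approximable A) \<and> convex_in_C01 (approximable A)"
    using closedin_approximable convex_approximable[OF assms] by simp
qed

lemma C_infinity_realize:
  assumes "\<psi> \<in> C_infinity M" "A \<ge> 1" "\<eta> > 0"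
  obtains g b where "g \<in> borel_measurable borel" "\<And>t. 0 \<le> g t" "\<And>t. g t \<le> b"
    "\<And>t. t \<notin> {a..<a + 1 / M A} \<Longrightarrow> g t = 0"
    "\<And>x. x \<in> {0..1} \<Longrightarrow> integrable lborel (\<lambda>t. M (x * g t)) \<and> \<bar>(\<integral>t. M (x * g t) \<partial>lborel) - \<psi> x\<bar> \<le> \<eta>"
proof -
  from C_infinity_subset_approximable[OF assms(2)] assms(1,3) obtain \<phi> where
    \<phi>: "realizable A \<phi>" "\<And>x. x \<in> {0..1} \<Longrightarrow> \<bar>\<psi> x - \<phi> x\<bar> \<le> \<eta>"
    unfolding approximable_def by blast
  from \<phi>(1) obtain g b where g: "g \<in> borel_measurable borel" "\<And>t. 0 \<le> g t" "\<And>t. g t \<le> b"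
    "\<And>t. t \<notin> {a..<a + 1 / M A} \<Longrightarrow> g t = 0"
    "\<And>x. x \<in> {0..1} \<Longrightarrow> has_bochner_integral lborel (\<lambda>t. M (x * g t)) (1 * \<phi> x)"
    unfolding realizable_def by (meson order_refl zero_le_one)
  show ?thesis
  proof (rule that[OF g(1-4)])
    fix x :: real assume "x \<in> {0..1}"
    from g(5)[OF this] \<phi>(2)[OF this]
    show "integrable lborel (\<lambda>t. M (x * g t)) \<and> \<bar>(\<integral>t. M (x * g t) \<partial>lborel) - \<psi> x\<bar> \<le> \<eta>"
      by (simp add: has_bochner_integral_iff abs_minus_commute)
  qed auto
qed


lemma C_infinity_approximate:
  assumes "\<psi> \<in> C_infinity M" "A \<ge> 1" "\<eta> > 0"
  obtains \<phi> where "realizable A \<phi>" "\<And>x. x \<in> {0..1} \<Longrightarrow> \<bar>\<psi> x - \<phi> x\<bar> \<le> \<eta>"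
  using C_infinity_subset_approximable[OF assms(2)] assms(1,3) unfolding approximable_def by blast

text \<open>Strict monotonicity does not survive uniform limits. It is recovered from two closed
  conditions, \<open>y \<psi> x \<le> x \<psi> y\<close> for \<open>x \<le> y\<close> and positivity on \<open>(0,1]\<close>; the latter comes from the growth
  condition on \<open>M\<close>.\<close>

lemma C_infinity_shape:
  assumes \<psi>: "\<psi> \<in> C_infinity M"
  shows "continuous_on {0..1} \<psi>" "\<psi> 0 = 0" "\<psi> 1 = 1" "strict_mono_on {0..1} \<psi>"
proof -
  show "continuous_on {0..1} \<psi>"
    using C_infinity_subset_approximable[of 1] \<psi> by (intro C01_continuous) (auto simp: approximable_def)
  have "\<bar>\<psi> 0 - 0\<bar> \<le> 0 + e" "\<bar>\<psi> 1 - 1\<bar> \<le> 0 + e" if e: "e > 0" for e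
  proof -
    obtain \<phi> where \<phi>: "realizable 1 \<phi>" "\<And>x. x \<in> {0..1} \<Longrightarrow> \<bar>\<psi> x - \<phi> x\<bar> \<le> e"
      using C_infinity_approximate[OF \<psi> order_refl e] by blast
    from \<phi>(2)[of 0] \<phi>(2)[of 1] \<phi>(1) show "\<bar>\<psi> 0 - 0\<bar> \<le> 0 + e" "\<bar>\<psi> 1 - 1\<bar> \<le> 0 + e"
      by (auto simp: realizable_def)
  qed
  then have "\<bar>\<psi> 0 - 0\<bar> \<le> 0" "\<bar>\<psi> 1 - 1\<bar> \<le> 0" by (blast intro: field_le_epsilon)+
  then show "\<psi> 0 = 0" "\<psi> 1 = 1" by auto
  have pos: "\<psi> x > 0" if x: "0 < x" "x \<le> 1" for x
  proof -
    have r: "1 / x \<ge> 1" using x by simp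
    have "1 / (D * exp (1 / x)) \<le> \<psi> x + e" if e: "e > 0" for e
    proof -
      obtain \<phi> where \<phi>: "realizable (1 / x) \<phi>" "\<And>x. x \<in> {0..1} \<Longrightarrow> \<bar>\<psi> x - \<phi> x\<bar> \<le> e"
        using C_infinity_approximate[OF \<psi> r e] by blast
      have "1 / (D * exp (1 / x)) \<le> \<phi> (1 / (1 / x))"
        using \<phi>(1) r unfolding realizable_def by blast
      with \<phi>(2)[of x] x show ?thesis by simp
    qed
    then have "1 / (D * exp (1 / x)) \<le> \<psi> x" by (rule field_le_epsilon)
    moreover have "1 / (D * exp (1 / x)) > 0" using D_ge_1 by simp
    ultimately show ?thesis by linarith
  qed
  have star: "y * \<psi> x \<le> x * \<psi> y" if xy: "0 \<le> x" "x \<le> y" "y \<le> 1" for x y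
  proof (rule field_le_epsilon)
    fix e :: real assume "e > 0"
    then have e2: "e/2 > 0" by simp
    obtain \<phi> where \<phi>: "realizable 1 \<phi>" "\<And>x. x \<in> {0..1} \<Longrightarrow> \<bar>\<psi> x - \<phi> x\<bar> \<le> e/2"
      using C_infinity_approximate[OF \<psi> order_refl e2] by blast
    have "\<bar>\<psi> x - \<phi> x\<bar> \<le> e/2" by (rule \<phi>(2)) (use xy in auto)
    moreover have "\<bar>\<psi> y - \<phi> y\<bar> \<le> e/2" by (rule \<phi>(2)) (use xy in auto)
    ultimately have near: "\<psi> x \<le> \<phi> x + e/2" "\<phi> y \<le> \<psi> y + e/2" by linarith+
    have "y * \<psi> x \<le> y * (\<phi> x + e/2)" using near xy by (intro mult_left_mono) auto
    also have "\<dots> \<le> x * \<phi> y + y * (e/2)" using \<phi>(1) xy by (auto simp: realizable_def distrib_left)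
    also have "x * \<phi> y \<le> x * (\<psi> y + e/2)" using near xy by (intro mult_left_mono) auto
    also have "x * (\<psi> y + e/2) + y * (e/2) \<le> x * \<psi> y + 1 * (e/2) + 1 * (e/2)"
      using xy \<open>e > 0\<close> unfolding distrib_left by (intro add_mono mult_right_mono order_refl) auto
    finally show "y * \<psi> x \<le> x * \<psi> y + e" by simp
  qed
  show "strict_mono_on {0..1} \<psi>"
  proof (rule strict_mono_onI)
    fix x y :: real assume xy: "x \<in> {0..1}" "y \<in> {0..1}" "x < y"
    have "y * \<psi> x \<le> x * \<psi> y" using xy by (intro star) auto
    also have "\<dots> < y * \<psi> y" using xy pos[of y] by (intro mult_strict_right_mono) auto
    finally show "\<psi> x < \<psi> y" using xy by simp
  qed
qed

end

section \<open>The reciprocal inverse and its tails\<close>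

lemma nn_integral_U:
  assumes "f \<in> borel_measurable borel"
  shows "(\<integral>\<^sup>+ t. f t \<partial>\<U>) = (\<integral>\<^sup>+ t. f t * indicator {0..1} t \<partial>lborel)"
  using assms by (subst nn_integral_restrict_space) (auto simp: nn_integral_completion)

lemma right_riemann_sum_le_nn_integral:
  fixes G :: "real \<Rightarrow> real"
  assumes G: "G \<in> borel_measurable borel" "\<And>u. 0 \<le> G u"
    and anti: "\<And>u v. \<lbrakk>0 < u; u \<le> v; v \<le> 1\<rbrakk> \<Longrightarrow> G v \<le> G u" and "K > 0"
  shows "ennreal ((\<Sum>j<K. G ((real j + 1) / real K)) / real K) \<le> (\<integral>\<^sup>+ u. ennreal (G u) \<partial>\<U>)"
proof -
  define A where "A j = {real j / K<..(real j + 1) / K}" for j :: nat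
  have K: "real K > 0" using \<open>K > 0\<close> by simp
  have A_meas: "emeasure lborel (A j) = ennreal (1 / K)" for j
  proof -
    have "real j / K \<le> (real j + 1) / K" using K by (simp add: divide_right_mono)
    then show ?thesis unfolding A_def by (simp add: diff_divide_distrib[symmetric])
  qed
  have A_sub: "A j \<subseteq> {0<..1}" if "j < K" for j
  proof -
    have "real j + 1 \<le> K" using that by linarith
    then have "(real j + 1) / K \<le> 1" using K by simp
    moreover have "0 \<le> real j / K" by simp
    ultimately have "0 < u \<and> u \<le> 1" if "real j / K < u" "u \<le> (real j + 1) / K" for u
      using that by linarith
    then show ?thesis by (auto simp: A_def)
  qed
  have disj: "disjoint_family_on A {..<K}"
  proof -
    have "A i \<inter> A j = {}" if "i < j" for i j
    proof -
      have "real i + 1 \<le> real j" using that by linarith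
      then have "(real i + 1) / K \<le> real j / K" using K by (intro divide_right_mono) auto
      then show ?thesis by (auto simp: A_def)
    qed
    then show ?thesis unfolding disjoint_family_on_def by (metis Int_commute linorder_neqE_nat)
  qed
  have "ennreal ((\<Sum>j<K. G ((real j + 1) / K)) / K) = (\<Sum>j<K. ennreal (G ((real j + 1) / K)) * emeasure lborel (A j))"
    using G(2) K by (simp add: A_meas sum_divide_distrib flip: sum_ennreal ennreal_mult)
  also have "\<dots> = (\<Sum>j<K. \<integral>\<^sup>+ u. ennreal (G ((real j + 1) / K)) * indicator (A j) u \<partial>lborel)"
    by (intro sum.cong refl nn_integral_cmult_indicator[symmetric]) (simp add: A_def)
  also have "\<dots> \<le> (\<Sum>j<K. \<integral>\<^sup>+ u. ennreal (G u) * indicator (A j) u \<partial>lborel)"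
  proof (intro sum_mono nn_integral_mono)
    fix j u assume j: "j \<in> {..<K}"
    show "ennreal (G ((real j + 1) / K)) * indicator (A j) u \<le> ennreal (G u) * indicator (A j) u"
    proof (cases "u \<in> A j")
      case True
      with j have "u \<in> {0<..1}" using A_sub by blast
      moreover have "real j + 1 \<le> K" using j by simp
      ultimately have "G ((real j + 1) / K) \<le> G u"
        using True K by (intro anti) (auto simp: A_def)
      then show ?thesis using True by (simp add: ennreal_leI)
    qed simp
  qed
  also have "\<dots> = (\<integral>\<^sup>+ u. (\<Sum>j<K. ennreal (G u) * indicator (A j) u) \<partial>lborel)"
    using G(1) by (intro nn_integral_sum[symmetric]) (auto simp: A_def)
  also have "\<dots> \<le> (\<integral>\<^sup>+ u. ennreal (G u) * indicator {0..1} u \<partial>lborel)"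
  proof (intro nn_integral_mono)
    fix u
    have "(\<Sum>j<K. ennreal (G u) * indicator (A j) u) = ennreal (G u) * indicator (\<Union>j<K. A j) u"
      using disj by (simp add: indicator_UN_disjoint sum_distrib_left)
    also have "\<dots> \<le> ennreal (G u) * indicator {0..1} u"
    proof -
      have "(\<Union>j<K. A j) \<subseteq> {0..1}" using A_sub by fastforce
      then show ?thesis by (auto simp: indicator_def)
    qed
    finally show "(\<Sum>j<K. ennreal (G u) * indicator (A j) u) \<le> ennreal (G u) * indicator {0..1} u" .
  qed
  also have "\<dots> = (\<integral>\<^sup>+ u. ennreal (G u) \<partial>\<U>)"
    using G(1) by (intro nn_integral_U[symmetric]) simp
  finally show ?thesis .
qed

lemma sum_lessThan_add: "(\<Sum>d<a + b. f d) = (\<Sum>d<a. f d) + (\<Sum>d<b. f (a + d))"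
  for f :: "nat \<Rightarrow> 'a::comm_monoid_add"
  by (induction b) (auto simp: add.assoc)

locale submultiplicative_limit = growth_orlicz +
  fixes \<psi> :: "real \<Rightarrow> real" and C :: real
  assumes \<psi>: "\<psi> \<in> C_infinity M"
    and reciprocal_inverse: "(\<lambda>t. 1 / inv_into {0..1} \<psi> t) \<in> orlicz_space M"
    and C_pos: "C > 0"
    and submult: "\<And>u v. \<lbrakk>u \<in> {0..1}; v \<in> {0..1}\<rbrakk> \<Longrightarrow> \<psi> (u * v) \<le> C * \<psi> u * \<psi> v"
begin

lemmas \<psi>_continuous = C_infinity_shape(1)[OF \<psi>]
  and \<psi>_0 [simp] = C_infinity_shape(2)[OF \<psi>]
  and \<psi>_1 [simp] = C_infinity_shape(3)[OF \<psi>]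
  and \<psi>_strict = C_infinity_shape(4)[OF \<psi>]

abbreviation \<psi>inv :: "real \<Rightarrow> real" where "\<psi>inv \<equiv> inv_into {0..1} \<psi>"

lemma \<psi>_less_iff: "\<lbrakk>x \<in> {0..1}; y \<in> {0..1}\<rbrakk> \<Longrightarrow> \<psi> x < \<psi> y \<longleftrightarrow> x < y"
  using \<psi>_strict by (simp add: strict_mono_on_less)

lemma \<psi>_le_iff: "\<lbrakk>x \<in> {0..1}; y \<in> {0..1}\<rbrakk> \<Longrightarrow> \<psi> x \<le> \<psi> y \<longleftrightarrow> x \<le> y"
  using \<psi>_less_iff[of y x] by (simp add: not_less[symmetric])

lemma \<psi>_range: "x \<in> {0..1} \<Longrightarrow> \<psi> x \<in> {0..1}"
  using \<psi>_le_iff[of 0 x] \<psi>_le_iff[of x 1] by auto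

lemma \<psi>_surj: "u \<in> {0..1} \<Longrightarrow> u \<in> \<psi> ` {0..1}"
  using IVT'[of \<psi> 0 u 1] \<psi>_continuous by force

lemma \<psi>_\<psi>inv: "u \<in> {0..1} \<Longrightarrow> \<psi> (\<psi>inv u) = u"
  using \<psi>_surj by (simp add: f_inv_into_f)

lemma \<psi>inv_range: "u \<in> {0..1} \<Longrightarrow> \<psi>inv u \<in> {0..1}"
  using \<psi>_surj by (intro inv_into_into) auto

lemma \<psi>inv_mono: "\<lbrakk>u \<in> {0..1}; v \<in> {0..1}; u \<le> v\<rbrakk> \<Longrightarrow> \<psi>inv u \<le> \<psi>inv v"
  using \<psi>_le_iff[OF \<psi>inv_range \<psi>inv_range, of u v] by (simp add: \<psi>_\<psi>inv)

lemma \<psi>inv_pos: "\<lbrakk>0 < u; u \<le> 1\<rbrakk> \<Longrightarrow> 0 < \<psi>inv u"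
  using \<psi>_less_iff[OF _ \<psi>inv_range, of 0 u] by (simp add: \<psi>_\<psi>inv)

text \<open>On \<open>(0,1]\<close> this is the nonincreasing function that exceeds \<open>s \<ge> 1\<close> on a set of measure \<open>\<psi> (1/s)\<close>.
  Clamping the argument to \<open>[0,1]\<close> makes the inverse monotone on the whole line, hence Borel.\<close>

definition h :: "real \<Rightarrow> real" where "h u = 1 / \<psi>inv (max 0 (min 1 u))"

lemma h_eq: "u \<in> {0..1} \<Longrightarrow> h u = 1 / \<psi>inv u"
  by (simp add: h_def)

lemma h_measurable [measurable]: "h \<in> borel_measurable borel"
proof -
  have "mono (\<lambda>u. \<psi>inv (max 0 (min 1 u)))"
    by (intro monoI \<psi>inv_mono) auto
  from borel_measurable_mono[OF this] show ?thesis unfolding h_def[abs_def] by simp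
qed

lemma h_nonneg: "0 \<le> h u"
  unfolding h_def using \<psi>inv_range[of "max 0 (min 1 u)"] by simp

lemma h_ge_1: "\<lbrakk>0 < u; u \<le> 1\<rbrakk> \<Longrightarrow> 1 \<le> h u"
  using \<psi>inv_pos[of u] \<psi>inv_range[of u] by (simp add: h_eq le_divide_eq)

lemma h_antimono: "\<lbrakk>0 < u; u \<le> v; v \<le> 1\<rbrakk> \<Longrightarrow> h v \<le> h u"
  using \<psi>inv_pos[of u] \<psi>inv_mono[of u v] by (simp add: h_eq frac_le)

lemma h_gt_iff:
  assumes "0 < c" "c \<le> 1" "0 < u" "u \<le> 1" shows "1 < c * h u \<longleftrightarrow> u < \<psi> c"
proof -
  have "1 < c * h u \<longleftrightarrow> \<psi>inv u < c" using assms \<psi>inv_pos[of u] by (simp add: h_eq less_divide_eq)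
  also have "\<dots> \<longleftrightarrow> u < \<psi> c" using assms \<psi>_less_iff[OF \<psi>inv_range, of u c] by (simp add: \<psi>_\<psi>inv)
  finally show ?thesis .
qed

lemma h_ge_iff:
  assumes "0 < c" "c \<le> 1" "0 < u" "u \<le> 1" shows "1 \<le> c * h u \<longleftrightarrow> u \<le> \<psi> c"
proof -
  have "1 \<le> c * h u \<longleftrightarrow> \<psi>inv u \<le> c" using assms \<psi>inv_pos[of u] by (simp add: h_eq le_divide_eq)
  also have "\<dots> \<longleftrightarrow> u \<le> \<psi> c" using assms \<psi>_le_iff[OF \<psi>inv_range, of u c] by (simp add: \<psi>_\<psi>inv)
  finally show ?thesis .
qed

lemma M_h_measurable: "(\<lambda>u. M (c * h u)) \<in> borel_measurable borel" if "c \<ge> 0"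
proof -
  have "(\<lambda>u. M \<bar>c * h u\<bar>) \<in> borel_measurable borel"
    by (rule measurable_compose[OF _ M_abs_measurable]) simp
  then show ?thesis using that h_nonneg by (simp add: abs_mult)
qed

text \<open>Membership of \<open>h\<close> in the Orlicz space is a statement about \<open>h / c\<close> for some \<open>c\<close>; growth
  removes the \<open>c\<close>.\<close>

lemma M_h_integral_finite:
  obtains I where "I \<ge> 0" "(\<integral>\<^sup>+ t. ennreal (M (h t)) \<partial>\<U>) \<le> ennreal I"
proof -
  obtain c where c: "c > 0" "modular M (\<lambda>t. 1 / \<psi>inv t) c \<le> 1"
    using reciprocal_inverse by (auto simp: orlicz_space_iff)
  have bound: "M (h t) \<le> D * exp c * M (h t / c) + M c" for t
  proof (cases "h t / c \<ge> 1")
    case True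
    have "M (c * (h t / c)) \<le> D * exp c * M (h t / c)" using c True by (intro growth) auto
    moreover have "M c \<ge> 0" using c by (intro M_nonneg) auto
    ultimately show ?thesis using c by simp
  next
    case False
    then have "M (h t) \<le> M c" using c h_nonneg by (intro M_mono) auto
    moreover have "D * exp c * M (h t / c) \<ge> 0"
      using D_ge_1 c h_nonneg by (intro mult_nonneg_nonneg M_nonneg) auto
    ultimately show ?thesis by simp
  qed
  have meas: "(\<lambda>t. ennreal (M (h t / c))) \<in> borel_measurable \<U>"
    using M_h_measurable[of "1 / c"] c by (intro measurable_compose[OF _ measurable_ennreal] borel_imp_measurable_U) auto
  have Mc: "M c \<ge> 0" using c by (intro M_nonneg) auto
  have "(\<integral>\<^sup>+ t. ennreal (M (h t)) \<partial>\<U>) \<le>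
      (\<integral>\<^sup>+ t. ennreal (D * exp c) * ennreal (M (h t / c)) + ennreal (M c) \<partial>\<U>)"
  proof (intro nn_integral_mono)
    fix t
    have "0 \<le> M (h t / c)" using c h_nonneg by (intro M_nonneg) auto
    then show "ennreal (M (h t)) \<le> ennreal (D * exp c) * ennreal (M (h t / c)) + ennreal (M c)"
      using bound[of t] D_ge_1 Mc by (simp flip: ennreal_mult ennreal_plus add: ennreal_leI)
  qed
  also have "\<dots> = ennreal (D * exp c) * (\<integral>\<^sup>+ t. ennreal (M (h t / c)) \<partial>\<U>) + ennreal (M c)"
    using meas by (simp add: nn_integral_add nn_integral_cmult emeasure_U_space)
  also have "(\<integral>\<^sup>+ t. ennreal (M (h t / c)) \<partial>\<U>) = modular M (\<lambda>t. 1 / \<psi>inv t) c"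
    unfolding modular_def
  proof (rule nn_integral_cong)
    fix t assume "t \<in> space \<U>"
    then have t: "t \<in> {0..1}" by simp
    have "\<bar>1 / \<psi>inv t\<bar> = h t" using h_nonneg[of t] by (simp add: h_eq[OF t, symmetric])
    then show "ennreal (M (h t / c)) = ennreal (M (\<bar>1 / \<psi>inv t\<bar> / c))" by simp
  qed
  also have "ennreal (D * exp c) * \<dots> + ennreal (M c) \<le> ennreal (D * exp c) * 1 + ennreal (M c)"
    using c by (intro add_right_mono mult_left_mono) auto
  also have "\<dots> = ennreal (D * exp c + M c)" using D_ge_1 Mc by simp
  finally show ?thesis using D_ge_1 Mc by (intro that[of "D * exp c + M c"]) auto
qed

text \<open>Submultiplicativity, read for the inverse function: on the set where it exceeds \<open>1\<close>, which is
  \<open>(0, \<psi> c)\<close>, the function \<open>c h\<close> is dominated by \<open>h\<close> dilated by the factor \<open>C \<psi> c\<close>.\<close>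

lemma tail_dilation:
  assumes c: "0 < c" "c \<le> 1" and w: "0 < w" "C * \<psi> c * w < \<psi> c"
  shows "w \<le> 1" "c * h (C * \<psi> c * w) \<le> h w"
proof -
  have pc: "0 < \<psi> c" "\<psi> c \<le> 1" using \<psi>_less_iff[of 0 c] \<psi>_range[of c] c by auto
  have C1: "1 \<le> C" using submult[of 1 1] by simp
  have "C * w < 1" using w pc by (simp add: mult.commute mult.left_commute)
  then have "1 * w < 1" using C1 w mult_right_mono[of 1 C w] by linarith
  then show w1: "w \<le> 1" by simp
  let ?z = "\<psi>inv w" and ?u = "C * \<psi> c * w"
  have "?u \<le> 1" using w(2) pc by linarith
  moreover have "0 < ?u" using w pc C_pos by simp
  ultimately have u: "0 < ?u" "?u \<le> 1" by auto
  have z: "0 < ?z" "?z \<le> 1" "\<psi> ?z = w" using \<psi>inv_pos[of w] \<psi>inv_range[of w] \<psi>_\<psi>inv[of w] w w1 by auto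
  have cz: "c * ?z \<in> {0..1}" using c z by (auto intro: mult_le_one)
  have "\<psi> (c * ?z) \<le> ?u" using submult[of c ?z] c z by simp
  then have "\<psi> (c * ?z) \<le> \<psi> (\<psi>inv ?u)" using u by (simp add: \<psi>_\<psi>inv)
  then have "c * ?z \<le> \<psi>inv ?u" using \<psi>_le_iff[OF cz \<psi>inv_range] u by simp
  then show "c * h ?u \<le> h w"
    using z u w w1 \<psi>inv_pos[OF u] by (simp add: h_eq field_simps)
qed

lemma tail_modular_le:
  assumes I: "(\<integral>\<^sup>+ t. ennreal (M (h t)) \<partial>\<U>) \<le> ennreal I" "I \<ge> 0" and c: "0 < c" "c \<le> 1"
  shows "(\<integral>\<^sup>+ u. ennreal (if c * h u \<le> 1 then 0 else M (c * h u)) \<partial>\<U>) \<le> ennreal (C * \<psi> c * I)"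
proof -
  let ?k = "C * \<psi> c"
  let ?T = "\<lambda>u. ennreal (if c * h u \<le> 1 then 0 else M (c * h u)) * indicator {0<..1} u"
  have pc: "0 < \<psi> c" "\<psi> c \<le> 1" using \<psi>_less_iff[of 0 c] \<psi>_range[of c] c by auto
  have k: "?k > 0" using pc C_pos by simp
  have meas: "(\<lambda>u. if c * h u \<le> 1 then 0 else M (c * h u)) \<in> borel_measurable borel"
    using M_h_measurable[of c] c by simp
  have "(\<integral>\<^sup>+ u. ennreal (if c * h u \<le> 1 then 0 else M (c * h u)) \<partial>\<U>) =
      (\<integral>\<^sup>+ u. ennreal (if c * h u \<le> 1 then 0 else M (c * h u)) * indicator {0..1} u \<partial>lborel)"
    using meas by (intro nn_integral_U) simp
  also have "\<dots> = (\<integral>\<^sup>+ u. ?T u \<partial>lborel)"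
  proof (rule nn_integral_cong_AE)
    have "AE u in lborel. u \<noteq> (0::real)" by (rule AE_lborel_singleton)
    then show "AE u in lborel. ennreal (if c * h u \<le> 1 then 0 else M (c * h u)) * indicator {0..1} u = ?T u"
      by eventually_elim (auto simp: indicator_def)
  qed
  also have "\<dots> = ennreal \<bar>?k\<bar> * (\<integral>\<^sup>+ w. ?T (0 + ?k * w) \<partial>lborel)"
    using meas k by (intro nn_integral_real_affine) auto
  also have "\<dots> \<le> ennreal \<bar>?k\<bar> * (\<integral>\<^sup>+ w. ennreal (M (h w)) * indicator {0..1} w \<partial>lborel)"
  proof (intro mult_left_mono nn_integral_mono)
    fix w
    show "?T (0 + ?k * w) \<le> ennreal (M (h w)) * indicator {0..1} w"
    proof (cases "0 < ?k * w \<and> ?k * w \<le> 1 \<and> 1 < c * h (?k * w)")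
      case True
      then have "?k * w < \<psi> c" using h_gt_iff[OF c] by blast
      moreover have w0: "0 < w" using True k by (simp add: zero_less_mult_iff)
      ultimately have "w \<le> 1" "c * h (?k * w) \<le> h w" using tail_dilation[OF c w0] by auto
      then show ?thesis using True w0 c h_nonneg by (auto intro!: ennreal_leI M_mono)
    next
      case False
      then show ?thesis by (auto simp: indicator_def not_less)
    qed
  qed auto
  also have "(\<integral>\<^sup>+ w. ennreal (M (h w)) * indicator {0..1} w \<partial>lborel) = (\<integral>\<^sup>+ w. ennreal (M (h w)) \<partial>\<U>)"
    using M_h_measurable[of 1] by (intro nn_integral_U[symmetric]) auto
  also have "ennreal \<bar>?k\<bar> * \<dots> \<le> ennreal \<bar>?k\<bar> * ennreal I"
    using I by (intro mult_left_mono) auto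
  also have "\<dots> = ennreal (C * \<psi> c * I)" using k I by (simp flip: ennreal_mult)
  finally show ?thesis .
qed

end

section \<open>Random sums with the reciprocal inverse as profile\<close>

sublocale submultiplicative_limit \<subseteq> growth_orlicz_digits M D "\<lambda>n. 4 * 2 ^ n"
  by unfold_locales simp

context submultiplicative_limit
begin

text \<open>The value carried by digit \<open>d\<close> of index \<open>n\<close>. The first quarter of the digits samples \<open>h\<close> at the right
  end points of \<open>2 ^ n\<close> intervals, so that averages of monotone functions of the samples stay below
  the corresponding integrals. The second quarter makes the distribution symmetric. The value \<open>0\<close> on the remaining
  half makes the characteristic function nonnegative.\<close>

definition val :: "nat \<Rightarrow> nat \<Rightarrow> real" where
  "val n d = (if d < 2 ^ n then h ((real d + 1) / real (2 ^ n))
     else if d < 2 * 2 ^ n then - h ((real (d - 2 ^ n) + 1) / real (2 ^ n)) else 0)"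

definition profile_mean :: "nat \<Rightarrow> (real \<Rightarrow> real) \<Rightarrow> real" where
  "profile_mean n F = (\<Sum>j<2 ^ n. F (h ((real j + 1) / real (2 ^ n)))) / real (2 ^ n)"

lemma average_val:
  fixes F :: "real \<Rightarrow> real"
  shows "average n (\<lambda>d. F (val n d)) = (profile_mean n F + profile_mean n (\<lambda>x. F (- x))) / 4 + F 0 / 2"
proof -
  let ?K = "2 ^ n :: nat"
  have "(\<Sum>d<4 * ?K. F (val n d)) = (\<Sum>d<?K + (?K + 2 * ?K). F (val n d))" by (simp add: algebra_simps)
  also have "\<dots> = (\<Sum>d<?K. F (val n d)) + ((\<Sum>d<?K. F (val n (?K + d))) + (\<Sum>d<2 * ?K. F (val n (?K + (?K + d)))))"
    by (simp only: sum_lessThan_add)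
  also have "(\<Sum>d<?K. F (val n d)) = real ?K * profile_mean n F"
    by (simp add: val_def profile_mean_def)
  also have "(\<Sum>d<?K. F (val n (?K + d))) = real ?K * profile_mean n (\<lambda>x. F (- x))"
    by (simp add: val_def profile_mean_def)
  also have "(\<Sum>d<2 * ?K. F (val n (?K + (?K + d)))) = 2 * real ?K * F 0"
    by (simp add: val_def)
  finally show ?thesis by (simp add: average_def field_simps)
qed

lemma h_profile_ge_1: "j < 2 ^ n \<Longrightarrow> h ((real j + 1) / real (2 ^ n)) \<ge> 1"
proof (rule h_ge_1)
  assume "j < 2 ^ n"
  then have "real (j + 1) \<le> real (2 ^ n)" by (simp only: of_nat_le_iff)
  then show "(real j + 1) / real (2 ^ n) \<le> 1" by (simp add: divide_le_eq)
qed simp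

lemma profile_mean_mono:
  assumes "\<And>x. x \<ge> 1 \<Longrightarrow> F x \<le> G x" shows "profile_mean n F \<le> profile_mean n G"
  unfolding profile_mean_def
  by (intro divide_right_mono sum_mono assms h_profile_ge_1) auto

lemma profile_mean_const: "profile_mean n (\<lambda>x. c) = c"
  by (simp add: profile_mean_def)

lemma average_val_odd:
  assumes "\<And>x. F (- x) = - F x" shows "average n (\<lambda>d. F (val n d)) = (0::real)"
proof -
  have "F 0 = 0" using assms[of 0] by simp
  then show ?thesis unfolding average_val by (simp add: assms profile_mean_def sum_negf)
qed

lemma average_val_even:
  assumes "\<And>x. F (- x) = F x" "F 0 = (0::real)"
  shows "average n (\<lambda>d. F (val n d)) = profile_mean n F / 2"
  unfolding average_val using assms by simp

lemma average_cos_val_nonneg: "average n (\<lambda>d. cos (\<tau> * val n d)) \<ge> 0"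
proof -
  have "profile_mean n (\<lambda>x. cos (\<tau> * x)) \<ge> profile_mean n (\<lambda>x. -1)"
    "profile_mean n (\<lambda>x. cos (\<tau> * (- x))) \<ge> profile_mean n (\<lambda>x. -1)"
    by (intro profile_mean_mono; simp)+
  then show ?thesis unfolding average_val[of n "\<lambda>x. cos (\<tau> * x)"] by (simp add: profile_mean_const)
qed

lemma average_min_val: "average n (\<lambda>d. min 1 ((c * val n d)\<^sup>2)) = profile_mean n (\<lambda>x. min 1 ((c * x)\<^sup>2)) / 2"
  by (rule average_val_even) auto

lemma average_min_val_ge_1:
  assumes "\<bar>c\<bar> \<ge> 1" shows "average n (\<lambda>d. min 1 ((c * val n d)\<^sup>2)) = 1/2"
proof -
  have "min 1 ((c * x)\<^sup>2) = 1" if "x \<ge> 1" for x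
  proof -
    have "1 * 1 \<le> \<bar>c\<bar> * \<bar>x\<bar>" using assms that by (intro mult_mono) auto
    then have "1 \<le> (c * x)\<^sup>2" using abs_le_square_iff[of 1 "c * x"] by (simp add: abs_mult)
    then show ?thesis by simp
  qed
  then have "profile_mean n (\<lambda>x. min 1 ((c * x)\<^sup>2)) = profile_mean n (\<lambda>x. 1)"
    by (intro antisym profile_mean_mono) auto
  then show ?thesis by (simp add: average_min_val profile_mean_const)
qed

text \<open>A sample point \<open>u\<close> with \<open>\<bar>c\<bar> h u \<ge> 1\<close>, that is \<open>u \<le> \<psi> \<bar>c\<bar>\<close>, contributes \<open>1\<close> to the truncated second
  moment. There are at least \<open>2 ^ n * \<psi> \<bar>c\<bar> - 1\<close> of them, which makes the error summable in \<open>n\<close>.\<close>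

lemma \<psi>_le_average_min_val:
  assumes "\<bar>c\<bar> \<le> 1"
  shows "\<psi> \<bar>c\<bar> \<le> 2 * average n (\<lambda>d. min 1 ((c * val n d)\<^sup>2)) + 1 / 2 ^ n"
proof (cases "c = 0")
  case False
  then have c: "0 < \<bar>c\<bar>" "\<bar>c\<bar> \<le> 1" using assms by auto
  let ?K = "2 ^ n :: nat"
  have K: "real ?K > 0" by simp
  have p: "0 \<le> \<psi> \<bar>c\<bar>" "\<psi> \<bar>c\<bar> \<le> 1" using \<psi>_range[of "\<bar>c\<bar>"] c by auto
  define N where "N = nat \<lfloor>real ?K * \<psi> \<bar>c\<bar>\<rfloor>"
  have N: "real N \<le> real ?K * \<psi> \<bar>c\<bar>" "real N \<ge> real ?K * \<psi> \<bar>c\<bar> - 1"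
    using p K unfolding N_def by (auto simp: of_nat_nat intro: of_int_floor_le)
  have "real ?K * \<psi> \<bar>c\<bar> \<le> real ?K * 1" using p by (intro mult_left_mono) auto
  with N have "real N \<le> real ?K" by linarith
  then have NK: "N \<le> ?K" by (simp only: of_nat_le_iff)
  have "real N = (\<Sum>j<N. 1)" by simp
  also have "\<dots> \<le> (\<Sum>j<N. min 1 ((c * h ((real j + 1) / ?K))\<^sup>2))"
  proof (rule sum_mono)
    fix j assume "j \<in> {..<N}"
    then have "real j + 1 \<le> real N" by simp
    with N have le: "real j + 1 \<le> real ?K * \<psi> \<bar>c\<bar>" by linarith
    then have "(real j + 1) / ?K \<le> \<psi> \<bar>c\<bar>" using K by (simp add: divide_le_eq mult.commute)
    moreover from this have "(real j + 1) / ?K \<le> 1" using p(2) by linarith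
    moreover have "0 < (real j + 1) / ?K" by simp
    ultimately have "1 \<le> \<bar>c\<bar> * h ((real j + 1) / ?K)" using h_ge_iff[OF c] by blast
    then have "1 \<le> (c * h ((real j + 1) / ?K))\<^sup>2"
      using abs_le_square_iff[of 1 "c * h ((real j + 1) / ?K)"] h_nonneg by (simp add: abs_mult)
    then show "1 \<le> min 1 ((c * h ((real j + 1) / ?K))\<^sup>2)" by simp
  qed
  also have "\<dots> \<le> (\<Sum>j<?K. min 1 ((c * h ((real j + 1) / ?K))\<^sup>2))"
    using NK by (intro sum_mono2) auto
  finally have "real N / ?K \<le> profile_mean n (\<lambda>x. min 1 ((c * x)\<^sup>2))"
    unfolding profile_mean_def by (rule divide_right_mono) simp
  moreover have "\<psi> \<bar>c\<bar> - 1 / ?K \<le> real N / ?K"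
    using divide_right_mono[OF N(2), of ?K] by (simp add: diff_divide_distrib)
  ultimately show ?thesis by (simp add: average_min_val)
qed (simp add: average_def sum_nonneg)

lemma profile_mean_le_integral:
  assumes "\<And>u v. \<lbrakk>0 < u; u \<le> v; v \<le> 1\<rbrakk> \<Longrightarrow> F (h v) \<le> F (h u)" "(\<lambda>u. F (h u)) \<in> borel_measurable borel"
    "\<And>u. 0 \<le> F (h u)" "(\<integral>\<^sup>+ u. ennreal (F (h u)) \<partial>\<U>) \<le> ennreal B" "B \<ge> 0"
  shows "profile_mean n F \<le> B"
proof -
  have "ennreal (profile_mean n F) \<le> (\<integral>\<^sup>+ u. ennreal (F (h u)) \<partial>\<U>)"
    unfolding profile_mean_def
    by (rule right_riemann_sum_le_nn_integral[of "\<lambda>u. F (h u)"]) (use assms in auto)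
  also note assms(4)
  finally show ?thesis using assms(5) by simp
qed

lemma average_tail_le:
  assumes I: "(\<integral>\<^sup>+ t. ennreal (M (h t)) \<partial>\<U>) \<le> ennreal I" "I \<ge> 0" and c: "\<bar>c\<bar> \<le> 1"
  shows "average n (\<lambda>d. if \<bar>c * val n d\<bar> \<le> 1 then 0 else M \<bar>c * val n d\<bar>) \<le> C * \<psi> \<bar>c\<bar> * I"
proof (cases "c = 0")
  case True
  then show ?thesis by (simp add: average_const)
next
  case False
  then have c: "0 < \<bar>c\<bar>" "\<bar>c\<bar> \<le> 1" using assms by auto
  let ?F = "\<lambda>x. if \<bar>c * x\<bar> \<le> 1 then 0 else M \<bar>c * x\<bar>"
  have F_h: "?F (h u) = (if \<bar>c\<bar> * h u \<le> 1 then 0 else M (\<bar>c\<bar> * h u))" for u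
    using h_nonneg[of u] by (simp add: abs_mult)
  have p: "0 \<le> \<psi> \<bar>c\<bar>" using \<psi>_range[of "\<bar>c\<bar>"] c by auto
  have F0: "0 \<le> ?F x" for x by (simp add: M_nonneg)
  have B: "C * \<psi> \<bar>c\<bar> * I \<ge> 0" using p C_pos I by simp
  have "profile_mean n ?F \<le> C * \<psi> \<bar>c\<bar> * I"
  proof (rule profile_mean_le_integral[OF _ _ F0 _ B])
    fix u v :: real assume uv: "0 < u" "u \<le> v" "v \<le> 1"
    have le: "\<bar>c\<bar> * h v \<le> \<bar>c\<bar> * h u" using h_antimono[OF uv] by (intro mult_left_mono) auto
    then have "M (\<bar>c\<bar> * h v) \<le> M (\<bar>c\<bar> * h u)" using h_nonneg by (intro M_mono) auto
    with le show "?F (h v) \<le> ?F (h u)" using F0[of "h u"] unfolding F_h by auto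
  next
    show "(\<lambda>u. ?F (h u)) \<in> borel_measurable borel"
      unfolding F_h using M_h_measurable[of "\<bar>c\<bar>"] by simp
    show "(\<integral>\<^sup>+ u. ennreal (?F (h u)) \<partial>\<U>) \<le> ennreal (C * \<psi> \<bar>c\<bar> * I)"
      unfolding F_h by (rule tail_modular_le[OF I c])
  qed
  moreover have "average n (\<lambda>d. ?F (val n d)) = profile_mean n ?F / 2"
    by (rule average_val_even) auto
  ultimately show ?thesis using B by simp
qed

lemma average_M_val_le:
  assumes "(\<integral>\<^sup>+ t. ennreal (M (h t)) \<partial>\<U>) \<le> ennreal I" "I \<ge> 0"
  shows "average n (\<lambda>d. M \<bar>val n d\<bar>) \<le> I"
proof -
  have "profile_mean n (\<lambda>x. M \<bar>x\<bar>) \<le> I"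
  proof (rule profile_mean_le_integral)
    show "M \<bar>h v\<bar> \<le> M \<bar>h u\<bar>" if "0 < u" "u \<le> v" "v \<le> 1" for u v
      using h_antimono[OF that] h_nonneg by (intro M_mono) auto
    show "(\<lambda>u. M \<bar>h u\<bar>) \<in> borel_measurable borel"
      by (rule measurable_compose[OF h_measurable M_abs_measurable])
    show "(\<integral>\<^sup>+ u. ennreal (M \<bar>h u\<bar>) \<partial>\<U>) \<le> ennreal I" using assms(1) h_nonneg by simp
  qed (use assms in \<open>auto intro: M_nonneg\<close>)
  moreover have "average n (\<lambda>d. M \<bar>val n d\<bar>) = profile_mean n (\<lambda>x. M \<bar>x\<bar>) / 2"
    by (rule average_val_even) auto
  ultimately show ?thesis using assms(2) by simp
qed

definition weight :: "(nat \<Rightarrow> real) \<Rightarrow> nat \<Rightarrow> real" where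
  "weight c m = (\<Sum>n<m. average n (\<lambda>d. min 1 ((c n * val n d)\<^sup>2)))"

text \<open>A coefficient of absolute value at least \<open>1\<close> alone contributes \<open>1/2\<close> to the weight, the probability
  of a nonzero digit value. The number \<open>5/2\<close> is \<open>2 * (1/4) + \<Sum> 1 / 2 ^ n\<close>.\<close>

lemma weight_le_quarter:
  assumes "weight c m \<le> 1/4"
  shows "\<And>n. n < m \<Longrightarrow> \<bar>c n\<bar> \<le> 1" "(\<Sum>n<m. \<psi> \<bar>c n\<bar>) \<le> 5/2"
proof -
  have nonneg: "0 \<le> average n (\<lambda>d. min 1 ((c n * val n d)\<^sup>2))" for n
    unfolding average_def by (intro divide_nonneg_nonneg sum_nonneg) auto
  show c: "\<bar>c n\<bar> \<le> 1" if "n < m" for n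
  proof (rule ccontr)
    assume "\<not> \<bar>c n\<bar> \<le> 1"
    then have "average n (\<lambda>d. min 1 ((c n * val n d)\<^sup>2)) = 1/2" by (intro average_min_val_ge_1) auto
    moreover have "average n (\<lambda>d. min 1 ((c n * val n d)\<^sup>2)) \<le> weight c m"
      unfolding weight_def using that nonneg
      by (intro member_le_sum[of n "{..<m}" "\<lambda>n. average n (\<lambda>d. min 1 ((c n * val n d)\<^sup>2))"]) auto
    ultimately show False using assms by simp
  qed
  have "(\<Sum>n<m. \<psi> \<bar>c n\<bar>) \<le> (\<Sum>n<m. 2 * average n (\<lambda>d. min 1 ((c n * val n d)\<^sup>2)) + 1 / 2 ^ n)"
    by (intro sum_mono \<psi>_le_average_min_val c) simp
  also have "\<dots> = 2 * weight c m + (\<Sum>n<m. (1/2) ^ n)"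
    by (simp add: weight_def sum.distrib sum_distrib_left power_one_over)
  also have "(\<Sum>n<m. (1/2::real) ^ n) \<le> 2" by (simp add: sum_gp_strict)
  finally show "(\<Sum>n<m. \<psi> \<bar>c n\<bar>) \<le> 5/2" using assms by simp
qed

lemma random_sum_modular_bound:
  shows "\<exists>K\<ge>0. \<forall>m c. weight c m \<le> 1/4 \<longrightarrow>
    (\<integral>t. M (\<bar>digit_sum (\<lambda>n d. c n * val n d) m t\<bar> / 2) \<partial>\<U>) \<le> K"
proof -
  obtain I where I: "I \<ge> 0" "(\<integral>\<^sup>+ t. ennreal (M (h t)) \<partial>\<U>) \<le> ennreal I" by (rule M_h_integral_finite)
  define K where "K = D * (2 * exp 1) + D * (exp 3 * (C * I * (5/2)))"
  show ?thesis
  proof (intro exI[of _ K] conjI allI impI)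
    show "K \<ge> 0" using D_ge_1 C_pos I by (simp add: K_def)
    fix m :: nat and c :: "nat \<Rightarrow> real" assume w: "weight c m \<le> 1/4"
    have mean: "average n (\<lambda>d. if \<bar>c n * val n d\<bar> \<le> 1 then c n * val n d else 0) = 0" for n
      by (rule average_val_odd[of "\<lambda>x. if \<bar>c n * x\<bar> \<le> 1 then c n * x else 0"]) simp
    have "(\<integral>t. M (\<bar>digit_sum (\<lambda>n d. c n * val n d) m t\<bar> / 2) \<partial>\<U>) \<le>
      D * (2 * exp 1) + D * (exp 3 * (\<Sum>n<m. average n (\<lambda>d. if \<bar>c n * val n d\<bar> \<le> 1 then 0 else M \<bar>c n * val n d\<bar>)))"
      using w by (intro digit_sum_modular_bound mean) (simp add: weight_def)
    also have "(\<Sum>n<m. average n (\<lambda>d. if \<bar>c n * val n d\<bar> \<le> 1 then 0 else M \<bar>c n * val n d\<bar>)) \<le>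
        (\<Sum>n<m. C * \<psi> \<bar>c n\<bar> * I)"
      using weight_le_quarter(1)[OF w] I by (intro sum_mono average_tail_le) auto
    also have "\<dots> = C * I * (\<Sum>n<m. \<psi> \<bar>c n\<bar>)" by (simp add: sum_distrib_left mult_ac)
    also have "\<dots> \<le> C * I * (5/2)"
      using weight_le_quarter(2)[OF w] C_pos I by (intro mult_left_mono) auto
    finally show "(\<integral>t. M (\<bar>digit_sum (\<lambda>n d. c n * val n d) m t\<bar> / 2) \<partial>\<U>) \<le> K"
      using D_ge_1 by (simp add: K_def)
  qed
qed

lemma random_sum_lower_bound:
  assumes "weight c m > 1/4"
  shows "(\<integral>t. integral_one_minus_cos (digit_sum (\<lambda>n d. c n * val n d) m t) \<partial>\<U>) \<ge> 1/54"
proof -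
  let ?B = "weight c m"
  have "(\<integral>t. integral_one_minus_cos (digit_sum (\<lambda>n d. c n * val n d) m t) \<partial>\<U>) \<ge> (?B / 9) / (1 + 2 * ?B)"
    unfolding weight_def
  proof (rule digit_sum_lower_bound)
    fix n and \<tau> :: real
    show "average n (\<lambda>d. sin (\<tau> * (c n * val n d))) = 0"
      by (rule average_val_odd[of "\<lambda>x. sin (\<tau> * (c n * x))"]) simp
    show "0 \<le> average n (\<lambda>d. cos (\<tau> * (c n * val n d)))"
      using average_cos_val_nonneg[of n "\<tau> * c n"] by (simp add: mult.assoc)
  qed
  moreover have "(?B / 9) / (1 + 2 * ?B) \<ge> 1/54" using assms by (simp add: field_simps)
  ultimately show ?thesis by linarith
qed

end

section \<open>The subspace\<close>

lemma (in orlicz) bounded_in_orlicz_space: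
  assumes "f \<in> borel_measurable \<U>" "\<And>t. t \<in> {0..1} \<Longrightarrow> \<bar>f t\<bar> \<le> b"
  shows "f \<in> orlicz_space M"
proof -
  have "modular M f (max b 1) \<le> (\<integral>\<^sup>+ t. ennreal (M 1) \<partial>\<U>)"
    unfolding modular_def
  proof (intro nn_integral_mono ennreal_leI M_mono)
    fix t assume "t \<in> space \<U>"
    then have "\<bar>f t\<bar> \<le> max b 1" using assms(2)[of t] by simp
    then show "\<bar>f t\<bar> / max b 1 \<le> 1" by (simp add: divide_le_eq)
  qed auto
  also have "\<dots> = 1" by (simp add: emeasure_U_space)
  finally show ?thesis using assms(1) unfolding orlicz_space_iff by (intro conjI exI[of _ "max b 1"]) auto
qed

lemma (in orlicz) Delta2_infinity_imp_doubling:
  assumes "Delta2_infinity (\<lambda>u. ereal (M u))" shows "\<exists>K. \<forall>u\<ge>1. M (2 * u) \<le> K * M u"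
proof -
  from assms obtain K u0 where K: "K > 0" "u0 > 0" "\<And>u. u \<ge> u0 \<Longrightarrow> M (2 * u) \<le> K * M u"
    unfolding Delta2_infinity_def by auto
  have "M (2 * u) \<le> max K (M (2 * u0)) * M u" if u: "u \<ge> 1" for u
  proof (cases "u \<ge> u0")
    case True
    have "K * M u \<le> max K (M (2 * u0)) * M u" using M_ge_1[OF u] by (intro mult_right_mono) auto
    with K(3)[OF True] show ?thesis by simp
  next
    case False
    then have "M (2 * u) \<le> M (2 * u0) * 1" using u by (simp add: M_mono)
    also have "\<dots> \<le> max K (M (2 * u0)) * M u"
      using M_ge_1[OF u] K by (intro mult_mono) auto
    finally show ?thesis .
  qed
  then show ?thesis by blast
qed

context submultiplicative_limit
begin

text \<open>The supports lie in disjoint dyadic intervals inside \<open>[0, 1/256)\<close>, and the deviations of the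
  modulars from \<open>\<psi>\<close> are summable.\<close>

definition bumps :: "(nat \<Rightarrow> real \<Rightarrow> real) \<Rightarrow> bool" where
  "bumps g \<longleftrightarrow> (\<forall>n. g n \<in> borel_measurable borel \<and> (\<forall>t. 0 \<le> g n t) \<and> (\<exists>b. \<forall>t. g n t \<le> b) \<and>
     (\<forall>t. t \<notin> {1 / 2 ^ (n + 9)..<1 / 2 ^ (n + 8)} \<longrightarrow> g n t = 0) \<and>
     (\<forall>x\<in>{0..1}. integrable lborel (\<lambda>t. M (x * g n t)) \<and>
        \<bar>(\<integral>t. M (x * g n t) \<partial>lborel) - \<psi> x\<bar> \<le> 1 / 2 ^ (n + 1)))"

lemma bumps_exist: obtains g where "bumps g"
proof -
  have "\<exists>g :: real \<Rightarrow> real. g \<in> borel_measurable borel \<and> (\<forall>t. 0 \<le> g t) \<and> (\<exists>b. \<forall>t. g t \<le> b) \<and>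
     (\<forall>t. t \<notin> {1 / 2 ^ (n + 9)..<1 / 2 ^ (n + 8)} \<longrightarrow> g t = 0) \<and>
     (\<forall>x\<in>{0..1}. integrable lborel (\<lambda>t. M (x * g t)) \<and>
        \<bar>(\<integral>t. M (x * g t) \<partial>lborel) - \<psi> x\<bar> \<le> 1 / 2 ^ (n + 1))" for n :: nat
  proof -
    from M_at_top have "eventually (\<lambda>x. M x \<ge> 2 ^ (n + 9)) at_top" by (simp add: filterlim_at_top)
    then obtain R where R: "\<And>x. x \<ge> R \<Longrightarrow> M x \<ge> 2 ^ (n + 9)" by (auto simp: eventually_at_top_linorder)
    define A where "A = max R 1"
    have A: "A \<ge> 1" "M A \<ge> 2 ^ (n + 9)" using R[of A] by (auto simp: A_def)
    have len: "1 / 2 ^ (n + 9) + 1 / M A \<le> 1 / 2 ^ (n + 8)"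
    proof -
      have "1 / M A \<le> 1 / 2 ^ (n + 9)" using A by (intro frac_le) auto
      moreover have "(1::real) / 2 ^ (n + 8) = 1 / 2 ^ (n + 9) + 1 / 2 ^ (n + 9)"
        by (simp add: power_add)
      ultimately show ?thesis by linarith
    qed
    have \<eta>: "1 / 2 ^ (n + 1) > (0::real)" by simp
    obtain g b where g: "g \<in> borel_measurable borel" "\<And>t. 0 \<le> g t" "\<And>t. g t \<le> b"
      "\<And>t. t \<notin> {1 / 2 ^ (n + 9)..<1 / 2 ^ (n + 9) + 1 / M A} \<Longrightarrow> g t = 0"
      "\<And>x. x \<in> {0..1} \<Longrightarrow> integrable lborel (\<lambda>t. M (x * g t)) \<and>
         \<bar>(\<integral>t. M (x * g t) \<partial>lborel) - \<psi> x\<bar> \<le> 1 / 2 ^ (n + 1)"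
      using C_infinity_realize[OF \<psi> A(1) \<eta>, of "1 / 2 ^ (n + 9)"] by blast
    have "g t = 0" if "t \<notin> {1 / 2 ^ (n + 9)..<1 / 2 ^ (n + 8)}" for t
    proof (rule g(4))
      show "t \<notin> {1 / 2 ^ (n + 9)..<1 / 2 ^ (n + 9) + 1 / M A}"
        using that len unfolding atLeastLessThan_iff by linarith
    qed
    with g show ?thesis by (intro exI[of _ g]) auto
  qed
  then have "\<exists>g. bumps g" unfolding bumps_def by (rule choice[OF allI])
  with that show ?thesis by blast
qed

lemma bumpsD:
  assumes "bumps g"
  shows "g n \<in> borel_measurable borel" "0 \<le> g n t" "\<exists>b. \<forall>t. g n t \<le> b"
    "t \<notin> {1 / 2 ^ (n + 9)..<1 / 2 ^ (n + 8)} \<Longrightarrow> g n t = 0"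
    "x \<in> {0..1} \<Longrightarrow> integrable lborel (\<lambda>t. M (x * g n t))"
    "x \<in> {0..1} \<Longrightarrow> \<bar>(\<integral>t. M (x * g n t) \<partial>lborel) - \<psi> x\<bar> \<le> 1 / 2 ^ (n + 1)"
  using assms unfolding bumps_def by blast+

lemma bump_support_subset: "{1 / 2 ^ (n + 9)..<1 / 2 ^ (n + 8)} \<subseteq> {0..<1 / 256::real}"
proof -
  have "(1::real) / 2 ^ (n + 8) \<le> 1 / 2 ^ 8" by (intro divide_left_mono power_increasing) auto
  also have "\<dots> = 1/256" by simp
  finally have le: "(1::real) / 2 ^ (n + 8) \<le> 1/256" .
  have ge: "0 \<le> (1::real) / 2 ^ (n + 9)" by simp
  show ?thesis
  proof
    fix t :: real assume "t \<in> {1 / 2 ^ (n + 9)..<1 / 2 ^ (n + 8)}"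
    then show "t \<in> {0..<1 / 256}" using le ge unfolding atLeastLessThan_iff by linarith
  qed
qed

lemma bumps_zero:
  assumes "bumps g" "t \<ge> 1/256" shows "g n t = 0"
proof (rule bumpsD(4)[OF assms(1)])
  have "t \<notin> {0..<1/256}" using assms(2) by auto
  then show "t \<notin> {1 / 2 ^ (n + 9)..<1 / 2 ^ (n + 8)}" using bump_support_subset[of n] by blast
qed

lemma bumps_disjoint:
  assumes "bumps g" "g n t \<noteq> 0" "k \<noteq> n" shows "g k t = 0"
proof -
  have "g k t = 0 \<or> g n t = 0" if "k < n" for k n
  proof -
    have "(1::real) / 2 ^ (n + 8) \<le> 1 / 2 ^ (k + 9)" using that by (intro divide_left_mono power_increasing) auto
    then have "t \<notin> {1 / 2 ^ (n + 9)..<1 / 2 ^ (n + 8)} \<or> t \<notin> {1 / 2 ^ (k + 9)..<1 / 2 ^ (k + 8)}" by auto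
    then show ?thesis using bumpsD(4)[OF assms(1)] by blast
  qed
  with assms show ?thesis by (metis linorder_neqE_nat)
qed

lemma bump_modular_measurable:
  assumes "bumps g" "x \<ge> 0" shows "(\<lambda>t. M (x * g n t)) \<in> borel_measurable borel"
proof -
  have "(\<lambda>t. M \<bar>x * g n t\<bar>) \<in> borel_measurable borel"
    by (rule measurable_compose[OF _ M_abs_measurable]) (use bumpsD(1)[OF assms(1)] in simp)
  then show ?thesis using assms bumpsD(2)[OF assms(1)] by (simp add: abs_mult)
qed

lemma bump_modular:
  assumes "bumps g" "x \<in> {0..1}"
  shows "(\<integral>\<^sup>+ t. ennreal (M (x * g n t)) \<partial>\<U>) = ennreal (\<integral>t. M (x * g n t) \<partial>lborel)"
proof -
  have "(\<integral>\<^sup>+ t. ennreal (M (x * g n t)) \<partial>\<U>) = (\<integral>\<^sup>+ t. ennreal (M (x * g n t)) * indicator {0..1} t \<partial>lborel)"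
    using bump_modular_measurable[OF assms(1)] assms(2) by (intro nn_integral_U) auto
  also have "\<dots> = (\<integral>\<^sup>+ t. ennreal (M (x * g n t)) \<partial>lborel)"
  proof (rule nn_integral_cong)
    fix t
    have "g n t = 0" if "t \<notin> {0..1}"
    proof (rule bumpsD(4)[OF assms(1)])
      have "t \<notin> {0..<1/256}" using that by auto
      then show "t \<notin> {1 / 2 ^ (n + 9)..<1 / 2 ^ (n + 8)}" using bump_support_subset[of n] by blast
    qed
    then show "ennreal (M (x * g n t)) * indicator {0..1} t = ennreal (M (x * g n t))"
      by (auto simp: indicator_def)
  qed
  also have "\<dots> = ennreal (\<integral>t. M (x * g n t) \<partial>lborel)"
    using bumpsD(2,5)[OF assms(1)] assms(2) by (intro nn_integral_eq_integral) (auto intro!: M_nonneg)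
  finally show ?thesis .
qed

lemma bump_modular_le:
  assumes "bumps g" "x \<in> {0..1}"
  shows "(\<integral>\<^sup>+ t. ennreal (M (x * g n t)) \<partial>\<U>) \<le> ennreal (\<psi> x + 1 / 2 ^ (n + 1))"
  unfolding bump_modular[OF assms] using bumpsD(6)[OF assms, of n] by (intro ennreal_leI) linarith

lemma bump_norm_ge:
  assumes g: "bumps g" and space: "g n \<in> orlicz_space M"
  shows "orlicz_norm M (g n) \<ge> 1/2"
proof (rule ccontr)
  assume "\<not> orlicz_norm M (g n) \<ge> 1/2"
  then obtain d where d: "0 < d" "d < 1/2" "modular M (g n) d \<le> 1"
    using orlicz_norm_lessE[OF space, of "1/2"] by auto
  have "ennreal (1/2) \<le> ennreal (\<integral>t. M (1 * g n t) \<partial>lborel)"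
  proof (rule ennreal_leI)
    have "(1::real) / 2 ^ (n + 1) \<le> 1 / 2 ^ 1" by (intro divide_left_mono power_increasing) auto
    moreover have "\<bar>(\<integral>t. M (1 * g n t) \<partial>lborel) - 1\<bar> \<le> 1 / 2 ^ (n + 1)"
      using bumpsD(6)[OF g, of 1 n] unfolding \<psi>_1 by simp
    ultimately show "1/2 \<le> (\<integral>t. M (1 * g n t) \<partial>lborel)" unfolding power_one_right by linarith
  qed
  also have "\<dots> = (\<integral>\<^sup>+ t. ennreal (M (1 * g n t)) \<partial>\<U>)"
    using g by (intro bump_modular[symmetric]) auto
  also have "\<dots> \<le> (\<integral>\<^sup>+ t. ennreal d * ennreal (M (\<bar>g n t\<bar> / d)) \<partial>\<U>)"
  proof (intro nn_integral_mono)
    fix t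
    have "M (d * (\<bar>g n t\<bar> / d)) \<le> d * M (\<bar>g n t\<bar> / d)" using d by (intro M_scale) auto
    then have "M (1 * g n t) \<le> d * M (\<bar>g n t\<bar> / d)" using d bumpsD(2)[OF g, of n t] by simp
    then show "ennreal (M (1 * g n t)) \<le> ennreal d * ennreal (M (\<bar>g n t\<bar> / d))"
      using d by (simp add: M_nonneg ennreal_leI flip: ennreal_mult)
  qed
  also have "\<dots> = ennreal d * modular M (g n) d"
    unfolding modular_def using space d
    by (intro nn_integral_cmult modular_measurable orlicz_space_measurable) auto
  also have "\<dots> \<le> ennreal d * 1" using d by (intro mult_left_mono) auto
  finally have "ennreal (1/2) \<le> ennreal d" by (simp only: mult_1_right)
  then have "1/2 \<le> d" using d by (simp only: ennreal_le_iff less_imp_le)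
  with d show False by simp
qed

text \<open>The random part is cut off on \<open>[0, 1/256)\<close>, so that the restriction of an element of the system to
  the interval carrying its bump is the bump itself.\<close>

definition system :: "(nat \<Rightarrow> real \<Rightarrow> real) \<Rightarrow> nat \<Rightarrow> real \<Rightarrow> real" where
  "system g n t = val n (digit n t) * indicator {1/256..} t + g n t"

definition combination :: "(nat \<Rightarrow> real \<Rightarrow> real) \<Rightarrow> (nat \<Rightarrow> real) \<Rightarrow> nat \<Rightarrow> real \<Rightarrow> real" where
  "combination g c m t = (\<Sum>n<m. c n * system g n t)"

lemma val_digit_measurable: "(\<lambda>t. val n (digit n t)) \<in> borel_measurable \<U>"
  by (intro borel_measurable_integrable integrable_cellwise[of "Suc n"] cellwise_digits) simp

lemma system_measurable: "bumps g \<Longrightarrow> system g n \<in> borel_measurable \<U>"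
  unfolding system_def[abs_def]
  by (intro borel_measurable_add borel_measurable_times val_digit_measurable borel_imp_measurable_U
      borel_measurable_indicator bumpsD(1)) auto

lemma combination_measurable: "bumps g \<Longrightarrow> combination g c m \<in> borel_measurable \<U>"
  unfolding combination_def[abs_def] using system_measurable by simp

lemma system_in_orlicz_space:
  assumes "bumps g" shows "system g n \<in> orlicz_space M"
proof -
  obtain b where b: "\<And>t. g n t \<le> b" using bumpsD(3)[OF assms] by blast
  define B where "B = Max ((\<lambda>d. \<bar>val n d\<bar>) ` {..<4 * 2 ^ n}) + b"
  show ?thesis
  proof (rule bounded_in_orlicz_space[OF system_measurable[OF assms]])
    fix t :: real
    have "\<bar>val n (digit n t)\<bar> \<le> Max ((\<lambda>d. \<bar>val n d\<bar>) ` {..<4 * 2 ^ n})"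
      using digit_less[of n t] by (intro Max_ge) auto
    then show "\<bar>system g n t\<bar> \<le> B"
      using b[of t] bumpsD(2)[OF assms, of n t]
      by (auto simp: system_def B_def indicator_def intro: order_trans)
  qed
qed

lemma combination_outside: "\<lbrakk>bumps g; t \<ge> 1/256\<rbrakk> \<Longrightarrow> combination g c m t = digit_sum (\<lambda>n d. c n * val n d) m t"
  by (simp add: combination_def system_def digit_sum_def bumps_zero)

lemma M_combination_le:
  assumes "bumps g"
  shows "M (\<bar>combination g c m t\<bar> / 2) \<le>
    M (\<bar>digit_sum (\<lambda>n d. c n * val n d) m t\<bar> / 2) + (\<Sum>n<m. M (\<bar>c n\<bar> * g n t))"
proof (cases "t \<ge> 1/256")
  case True
  then show ?thesis using assms bumpsD(2)[OF assms]
    by (simp add: combination_outside sum_nonneg M_nonneg)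
next
  case False
  then have y: "combination g c m t = (\<Sum>n<m. c n * g n t)" by (simp add: combination_def system_def)
  have nonneg: "0 \<le> M (\<bar>c n\<bar> * g n t)" for n using bumpsD(2)[OF assms] by (intro M_nonneg) simp
  have "M (\<bar>combination g c m t\<bar> / 2) \<le> (\<Sum>n<m. M (\<bar>c n\<bar> * g n t))"
  proof (cases "\<exists>k<m. g k t \<noteq> 0")
    case True
    then obtain k where k: "k < m" "g k t \<noteq> 0" by blast
    have "(\<Sum>n<m. c n * g n t) = (\<Sum>n<m. if n = k then c k * g k t else 0)"
      using bumps_disjoint[OF assms k(2)] by (intro sum.cong) auto
    then have "combination g c m t = c k * g k t" using k y by simp
    then have "M (\<bar>combination g c m t\<bar> / 2) \<le> M (\<bar>c k\<bar> * g k t)"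
      using bumpsD(2)[OF assms, of k t] by (intro M_mono) (auto simp: abs_mult)
    also have "\<dots> \<le> (\<Sum>n<m. M (\<bar>c n\<bar> * g n t))"
      using k nonneg by (intro member_le_sum[of k "{..<m}" "\<lambda>n. M (\<bar>c n\<bar> * g n t)"]) auto
    finally show ?thesis .
  next
    case False
    then have "combination g c m t = 0" using y by simp
    then show ?thesis using nonneg by (simp add: sum_nonneg)
  qed
  moreover have "0 \<le> M (\<bar>digit_sum (\<lambda>n d. c n * val n d) m t\<bar> / 2)" by (intro M_nonneg) simp
  ultimately show ?thesis by linarith
qed

text \<open>A small weight bounds both the modular of the random part and, through \<open>\<Sum> \<psi> \<bar>c\<^sub>n\<bar>\<close>, that of the
  bumps.\<close>

lemma combination_norm_bound:
  "\<exists>K. \<forall>g c m. bumps g \<longrightarrow> weight c m \<le> 1/4 \<longrightarrow> orlicz_norm M (combination g c m) \<le> K"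
proof -
  obtain K1 where K1: "K1 \<ge> 0" "\<And>m c. weight c m \<le> 1/4 \<Longrightarrow>
    (\<integral>t. M (\<bar>digit_sum (\<lambda>n d. c n * val n d) m t\<bar> / 2) \<partial>\<U>) \<le> K1"
    using random_sum_modular_bound by blast
  define B where "B = K1 + 7/2"
  show ?thesis
  proof (intro exI[of _ "B * 2"] allI impI)
    fix g and c :: "nat \<Rightarrow> real" and m :: nat assume g: "bumps g" and w: "weight c m \<le> 1/4"
    let ?S = "digit_sum (\<lambda>n d. c n * val n d) m"
    have int: "integrable \<U> (\<lambda>t. M (\<bar>?S t\<bar> / 2))"
      by (intro integrable_cellwise[of m] cellwise_digit_sum)
    have "modular M (combination g c m) 2 \<le>
        (\<integral>\<^sup>+ t. ennreal (M (\<bar>?S t\<bar> / 2)) + (\<Sum>n<m. ennreal (M (\<bar>c n\<bar> * g n t))) \<partial>\<U>)"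
      unfolding modular_def
    proof (intro nn_integral_mono)
      fix t
      have nonneg: "0 \<le> M (\<bar>c n\<bar> * g n t)" for n using bumpsD(2)[OF g] by (intro M_nonneg) simp
      have "0 \<le> M (\<bar>?S t\<bar> / 2)" by (intro M_nonneg) simp
      then show "ennreal (M (\<bar>combination g c m t\<bar> / 2)) \<le>
          ennreal (M (\<bar>?S t\<bar> / 2)) + (\<Sum>n<m. ennreal (M (\<bar>c n\<bar> * g n t)))"
        using M_combination_le[OF g, of c m t] nonneg
        by (simp add: sum_ennreal sum_nonneg ennreal_leI flip: ennreal_plus)
    qed
    also have "\<dots> = (\<integral>\<^sup>+ t. ennreal (M (\<bar>?S t\<bar> / 2)) \<partial>\<U>) + (\<Sum>n<m. \<integral>\<^sup>+ t. ennreal (M (\<bar>c n\<bar> * g n t)) \<partial>\<U>)"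
    proof -
      have "(\<lambda>t. ennreal (M (\<bar>c n\<bar> * g n t))) \<in> borel_measurable \<U>" for n
        using borel_imp_measurable_U[OF bump_modular_measurable[OF g, of "\<bar>c n\<bar>" n]] by simp
      moreover have "(\<lambda>t. ennreal (M (\<bar>?S t\<bar> / 2))) \<in> borel_measurable \<U>"
        using borel_measurable_integrable[OF int] by simp
      ultimately show ?thesis by (simp add: nn_integral_add nn_integral_sum)
    qed
    also have "(\<integral>\<^sup>+ t. ennreal (M (\<bar>?S t\<bar> / 2)) \<partial>\<U>) = ennreal (\<integral>t. M (\<bar>?S t\<bar> / 2) \<partial>\<U>)"
      by (intro nn_integral_eq_integral int) (simp add: M_nonneg)
    also have "\<dots> \<le> ennreal K1" by (intro ennreal_leI K1 w)
    also have "(\<Sum>n<m. \<integral>\<^sup>+ t. ennreal (M (\<bar>c n\<bar> * g n t)) \<partial>\<U>) \<le> (\<Sum>n<m. ennreal (\<psi> \<bar>c n\<bar> + 1 / 2 ^ (n + 1)))"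
      using weight_le_quarter(1)[OF w] by (intro sum_mono bump_modular_le g) auto
    also have "\<dots> = ennreal (\<Sum>n<m. \<psi> \<bar>c n\<bar> + 1 / 2 ^ (n + 1))"
      using weight_le_quarter(1)[OF w] \<psi>_range[of "\<bar>c _\<bar>"] by (intro sum_ennreal) auto
    also have "(\<Sum>n<m. \<psi> \<bar>c n\<bar> + 1 / 2 ^ (n + 1)) \<le> 7/2"
    proof -
      have "(\<Sum>n<m. \<psi> \<bar>c n\<bar> + 1 / 2 ^ (n + 1)) = (\<Sum>n<m. \<psi> \<bar>c n\<bar>) + (\<Sum>n<m. (1/2) ^ n) / 2"
        by (simp add: sum.distrib sum_divide_distrib power_one_over mult.commute)
      also have "(\<Sum>n<m. (1/2::real) ^ n) \<le> 2" by (simp add: sum_gp_strict)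
      finally show ?thesis using weight_le_quarter(2)[OF w] by simp
    qed
    also have "ennreal K1 + ennreal (7/2) = ennreal B" using K1 by (simp add: B_def flip: ennreal_plus)
    finally have mod: "modular M (combination g c m) 2 \<le> ennreal B"
      by (simp add: ennreal_leI add_mono)
    show "orlicz_norm M (combination g c m) \<le> B * 2"
      by (rule orlicz_norm_le_modular(2)[OF combination_measurable[OF g] _ _ mod]) (use K1 in \<open>auto simp: B_def\<close>)
  qed
qed

text \<open>Outside \<open>[0, 1/256)\<close> the combination is the sum of independent variables. If the combination is small
  in measure, then the sum is small except on a set of measure at most \<open>2/256\<close>, which leaves less than
  the \<open>1/54\<close> that a weight above \<open>1/4\<close> would force.\<close>

lemma small_in_measure_imp_weight_le:
  assumes g: "bumps g" and small: "measure \<U> {t \<in> {0..1}. \<bar>combination g c m t\<bar> > 1/256} \<le> 1/256"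
  shows "weight c m \<le> 1/4"
proof (rule ccontr)
  assume "\<not> weight c m \<le> 1/4"
  let ?S = "digit_sum (\<lambda>n d. c n * val n d) m"
  let ?A = "{t \<in> {0..1}. \<bar>combination g c m t\<bar> > 1/256}" and ?J = "{0..<1/256} :: real set"
  have A: "?A \<in> sets \<U>"
    using measurable_sets[OF combination_measurable[OF g], of "{x. \<bar>x\<bar> > 1/256}"]
    by (simp add: vimage_def Int_def conj_commute)
  have J: "?J \<in> sets \<U>" by (subst sets_restrict_space_iff) auto
  have mJ: "measure \<U> ?J = 1/256" by (subst measure_restrict_space) auto
  have m1: "measure \<U> {0..1} = 1" using emeasure_U_space by (simp add: measure_def)
  have int_ind: "integrable \<U> (indicator B :: real \<Rightarrow> real)" if "B \<in> sets \<U>" for B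
    using that by (intro integrable_real_indicator)
      (auto simp: finite_measure.emeasure_eq_measure[OF finite_measure_U])
  have integral_eq: "(\<integral>t. 2 * indicator A t + 2 * indicator B t + k \<partial>\<U>) = 2 * measure \<U> A + 2 * measure \<U> B + k"
    if "A \<in> sets \<U>" "B \<in> sets \<U>" for A B and k :: real
  proof -
    have "A \<inter> {0..1} = A" "B \<inter> {0..1} = B"
      using sets.sets_into_space[OF that(1)] sets.sets_into_space[OF that(2)] by auto
    then show ?thesis
      using int_ind[OF that(1)] int_ind[OF that(2)] m1 finite_measure.integrable_const[OF finite_measure_U] by simp
  qed
  have "1/54 \<le> (\<integral>t. integral_one_minus_cos (?S t) \<partial>\<U>)"
    using random_sum_lower_bound \<open>\<not> weight c m \<le> 1/4\<close> by simp
  also have "\<dots> \<le> (\<integral>t. 2 * indicator ?A t + 2 * indicator ?J t + 2 * (1/256)\<^sup>2 \<partial>\<U>)"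
  proof (rule integral_mono)
    show "integrable \<U> (\<lambda>t. integral_one_minus_cos (?S t))"
      by (intro integrable_cellwise[of m] cellwise_digit_sum)
    show "integrable \<U> (\<lambda>t. 2 * indicator ?A t + 2 * indicator ?J t + 2 * (1/256)\<^sup>2 :: real)"
      using int_ind[OF A] int_ind[OF J] finite_measure.integrable_const[OF finite_measure_U] by simp
    fix t assume "t \<in> space \<U>"
    then have t: "t \<in> {0..1}" by simp
    have le: "integral_one_minus_cos (?S t) \<le> 2 * min 1 ((?S t)\<^sup>2)" by (rule integral_one_minus_cos_le)
    show "integral_one_minus_cos (?S t) \<le> 2 * indicator ?A t + 2 * indicator ?J t + 2 * (1/256)\<^sup>2"
    proof (cases "t \<in> ?A \<or> t \<in> ?J")
      case True
      have "integral_one_minus_cos (?S t) \<le> 2" using le by linarith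
      with True show ?thesis by (auto simp: indicator_def power2_eq_square)
    next
      case False
      then have "?S t = combination g c m t" using t combination_outside[OF g, of t c m] by auto
      then have "\<bar>?S t\<bar> \<le> \<bar>1/256\<bar>" using False t by auto
      then have "(?S t)\<^sup>2 \<le> (1/256)\<^sup>2" by (simp only: abs_le_square_iff)
      with le show ?thesis using False by simp
    qed
  qed
  also have "\<dots> = 2 * measure \<U> ?A + 2 * measure \<U> ?J + 2 * (1/256)\<^sup>2"
    using A J by (rule integral_eq)
  also have "\<dots> \<le> 4/256 + 2 * (1/256)\<^sup>2" using small mJ by simp
  also have "\<dots> < 1/54" by (simp add: power2_eq_square)
  finally show False by simp
qed

lemma system_norm_bound:
  "\<exists>K>0. \<forall>g n. bumps g \<longrightarrow> orlicz_norm M (system g n) \<le> K"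
proof -
  obtain I where I: "I \<ge> 0" "(\<integral>\<^sup>+ t. ennreal (M (h t)) \<partial>\<U>) \<le> ennreal I" by (rule M_h_integral_finite)
  show ?thesis
  proof (intro exI[of _ "I + 2"] conjI allI impI)
    show "I + 2 > 0" using I by simp
    fix g n assume g: "bumps g"
    have mean: "(\<integral>t. M \<bar>val n (digit n t)\<bar> \<partial>\<U>) = average n (\<lambda>d. M \<bar>val n d\<bar>)"
    proof -
      let ?F = "\<lambda>k d. if k = n then M \<bar>val n d\<bar> else 1"
      have "(\<integral>t. (\<Prod>k<Suc n. ?F k (digit k t)) \<partial>\<U>) = (\<Prod>k<Suc n. average k (?F k))"
        by (rule digits_independent)
      then show ?thesis by (simp add: average_const)
    qed
    have int: "integrable \<U> (\<lambda>t. M \<bar>val n (digit n t)\<bar>)"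
      by (intro integrable_cellwise[of "Suc n"] cellwise_digits) simp
    have "modular M (system g n) 1 \<le> (\<integral>\<^sup>+ t. ennreal (M \<bar>val n (digit n t)\<bar>) + ennreal (M (1 * g n t)) \<partial>\<U>)"
      unfolding modular_def
    proof (intro nn_integral_mono)
      fix t
      have "M \<bar>system g n t\<bar> \<le> M \<bar>val n (digit n t)\<bar> + M (1 * g n t)"
        using bumps_zero[OF g, of t n] bumpsD(2)[OF g, of n t]
        by (cases "t \<ge> 1/256") (auto simp: system_def M_nonneg)
      then show "ennreal (M (\<bar>system g n t\<bar> / 1)) \<le> ennreal (M \<bar>val n (digit n t)\<bar>) + ennreal (M (1 * g n t))"
        using bumpsD(2)[OF g, of n t] by (simp add: M_nonneg ennreal_leI flip: ennreal_plus)
    qed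
    also have "\<dots> = (\<integral>\<^sup>+ t. ennreal (M \<bar>val n (digit n t)\<bar>) \<partial>\<U>) + (\<integral>\<^sup>+ t. ennreal (M (1 * g n t)) \<partial>\<U>)"
      using borel_imp_measurable_U[OF bump_modular_measurable[OF g, of 1 n]] borel_measurable_integrable[OF int]
      by (intro nn_integral_add) auto
    also have "(\<integral>\<^sup>+ t. ennreal (M \<bar>val n (digit n t)\<bar>) \<partial>\<U>) = ennreal (average n (\<lambda>d. M \<bar>val n d\<bar>))"
      unfolding mean[symmetric] by (intro nn_integral_eq_integral int) (simp add: M_nonneg)
    also have "\<dots> \<le> ennreal I" using average_M_val_le[OF I(2,1)] by (rule ennreal_leI)
    also have "(\<integral>\<^sup>+ t. ennreal (M (1 * g n t)) \<partial>\<U>) \<le> ennreal (\<psi> 1 + 1 / 2 ^ (n + 1))"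
      by (rule bump_modular_le[OF g]) simp
    also have "\<dots> \<le> ennreal 2"
    proof (rule ennreal_leI)
      have "(1::real) / 2 ^ (n + 1) \<le> 1" using one_le_power[of "2::real" "n + 1"] by (simp add: divide_le_eq)
      then show "\<psi> 1 + 1 / 2 ^ (n + 1) \<le> 2" by simp
    qed
    also have "ennreal I + ennreal 2 = ennreal (I + 2)" using I by (intro ennreal_plus[symmetric]) auto
    finally have mod: "modular M (system g n) 1 \<le> ennreal (I + 2)" by (simp add: add_mono)
    have "orlicz_norm M (system g n) \<le> (I + 2) * 1"
      by (rule orlicz_norm_le_modular(2)[OF system_measurable[OF g] _ _ mod]) (use I in auto)
    then show "orlicz_norm M (system g n) \<le> I + 2" by simp
  qed
qed

definition combinations :: "(nat \<Rightarrow> real \<Rightarrow> real) \<Rightarrow> (real \<Rightarrow> real) set" where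
  "combinations g = {combination g c m | c m. True}"

lemma combination_extend:
  assumes "m \<le> k" shows "combination g c m = combination g (\<lambda>n. if n < m then c n else 0) k"
proof
  fix t
  have "combination g (\<lambda>n. if n < m then c n else 0) k t = (\<Sum>n\<in>{..<m}. c n * system g n t)"
    unfolding combination_def using assms by (intro sum.mono_neutral_cong_right) auto
  then show "combination g c m t = combination g (\<lambda>n. if n < m then c n else 0) k t"
    by (simp add: combination_def)
qed

lemma linear_family_combinations: "linear_family (combinations g)"
  unfolding linear_family_def
proof (intro conjI ballI allI)
  have "(\<lambda>t. 0) = combination g (\<lambda>n. 0) 0" by (simp add: combination_def[abs_def])
  then show "(\<lambda>t. 0) \<in> combinations g" by (auto simp: combinations_def)
  fix f assume "f \<in> combinations g"
  then obtain c m where f: "f = combination g c m" by (auto simp: combinations_def)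
  show "(\<lambda>t. a * f t) \<in> combinations g" for a
  proof -
    have "(\<lambda>t. a * f t) = combination g (\<lambda>n. a * c n) m"
      by (simp add: f combination_def[abs_def] sum_distrib_left mult.assoc)
    then show ?thesis by (auto simp: combinations_def)
  qed
  fix f' assume "f' \<in> combinations g"
  then obtain c' m' where f': "f' = combination g c' m'" by (auto simp: combinations_def)
  let ?k = "max m m'"
  have e1: "f = combination g (\<lambda>n. if n < m then c n else 0) ?k"
    unfolding f by (rule combination_extend) simp
  have e2: "f' = combination g (\<lambda>n. if n < m' then c' n else 0) ?k"
    unfolding f' by (rule combination_extend) simp
  have "(\<lambda>t. f t + f' t) = combination g (\<lambda>n. (if n < m then c n else 0) + (if n < m' then c' n else 0)) ?k"
    unfolding e1 e2
    by (simp only: combination_def[abs_def] distrib_right sum.distrib)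
  then show "(\<lambda>t. f t + f' t) \<in> combinations g" by (auto simp: combinations_def)
qed

lemma system_in_combinations: "system g n \<in> combinations g"
proof -
  have "system g n = combination g (\<lambda>k. if k = n then 1 else 0) (Suc n)"
    by (simp add: combination_def[abs_def])
  then show ?thesis unfolding combinations_def by blast
qed

lemma combinations_subset:
  assumes "bumps g" shows "combinations g \<subseteq> orlicz_space M"
proof -
  have "combination g c m \<in> orlicz_space M" for c m
  proof (induction m)
    case 0
    then show ?case by (simp add: combination_def[abs_def] zero_in_orlicz_space)
  next
    case (Suc m)
    have "(\<lambda>t. combination g c m t + c m * system g m t) \<in> orlicz_space M"
      by (intro orlicz_space_add orlicz_space_cmult Suc system_in_orlicz_space assms)
    then show ?case by (simp add: combination_def[abs_def])
  qed
  then show ?thesis by (auto simp: combinations_def)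
qed

text \<open>Restricted to intervals of vanishing length, the normalized elements of the system keep a norm
  bounded below by that of their bumps.\<close>

lemma not_equi_absolutely_continuous:
  assumes g: "bumps g" and H: "combinations g \<subseteq> H"
  shows "\<not> equi_absolutely_continuous_norms M {x \<in> H. orlicz_norm M x \<le> 1}"
proof
  assume eac: "equi_absolutely_continuous_norms M {x \<in> H. orlicz_norm M x \<le> 1}"
  obtain K where K: "K > 0" "\<And>n. orlicz_norm M (system g n) \<le> K"
    using system_norm_bound g by blast
  define r where "r = 1 / (2 * K)"
  have r: "ennreal r > 0" using K by (simp add: r_def)
  let ?sup = "\<lambda>\<delta>. SUP E\<in>{E \<in> sets \<U>. measure \<U> E < \<delta>}.
    SUP x\<in>{x \<in> H. orlicz_norm M x \<le> 1}. ennreal (orlicz_norm M (\<lambda>t. x t * indicator E t))"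
  have "eventually (\<lambda>\<delta>. ?sup \<delta> < ennreal r) (at_right 0)"
    using eac r unfolding equi_absolutely_continuous_norms_def by (rule order_tendstoD(2))
  moreover have "eventually (\<lambda>\<delta>::real. \<delta> > 0) (at_right 0)" by (rule eventually_at_right_less)
  ultimately have "eventually (\<lambda>\<delta>. ?sup \<delta> < ennreal r \<and> \<delta> > 0) (at_right 0)" by (rule eventually_conj)
  then obtain \<delta> where \<delta>: "?sup \<delta> < ennreal r" "\<delta> > 0"
    using eventually_happens'[OF trivial_limit_at_right_real] by blast
  obtain n :: nat where n: "(1/2) ^ n < \<delta>" using real_arch_pow_inv[of \<delta> "1/2"] \<delta> by auto
  define E where "E = {1 / 2 ^ (n + 9)..<1 / 2 ^ (n + 8) :: real}"
  have E_sub: "E \<subseteq> {0..<1/256}" unfolding E_def by (rule bump_support_subset)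
  have "E \<in> sets borel" by (simp add: E_def)
  moreover have E_01: "E \<subseteq> {0..1}" using E_sub by fastforce
  ultimately have E: "E \<in> sets \<U>" by (subst sets_restrict_space_iff) auto
  have "measure \<U> E = measure lborel E"
    by (subst measure_restrict_space) (use E_01 \<open>E \<in> sets borel\<close> in auto)
  also have "\<dots> \<le> 1 / 2 ^ (n + 8)"
  proof -
    have "(1::real) / 2 ^ (n + 9) \<le> 1 / 2 ^ (n + 8)" by (intro divide_left_mono power_increasing) auto
    from measure_lborel_Ico[OF this] show ?thesis by (simp add: E_def)
  qed
  also have "\<dots> \<le> (1/2) ^ n" by (simp add: power_add power_one_over field_simps)
  finally have mE: "measure \<U> E < \<delta>" using n by simp
  define x where "x t = (1/K) * system g n t" for t
  have xH: "x \<in> H"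
    using H system_in_combinations linear_family_combinations unfolding x_def[abs_def] linear_family_def by blast
  have "orlicz_norm M x = \<bar>1/K\<bar> * orlicz_norm M (system g n)"
    unfolding x_def[abs_def] by (rule orlicz_norm_cmult[OF system_in_orlicz_space[OF g]])
  then have x1: "orlicz_norm M x \<le> 1" using K(1) K(2)[of n] by (simp add: divide_le_eq)
  have restr: "(\<lambda>t. x t * indicator E t) = (\<lambda>t. (1/K) * g n t)"
  proof
    fix t
    show "x t * indicator E t = (1/K) * g n t"
    proof (cases "t \<in> E")
      case True
      with E_sub have "t < 1/256" by auto
      with True show ?thesis by (simp add: x_def system_def)
    next
      case False
      then have "g n t = 0" using bumpsD(4)[OF g] by (simp add: E_def)
      with False show ?thesis by simp
    qed
  qed
  have g_space: "g n \<in> orlicz_space M"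
  proof -
    obtain b where "\<And>t. g n t \<le> b" using bumpsD(3)[OF g] by blast
    then show ?thesis
      using bumpsD(2)[OF g] by (intro bounded_in_orlicz_space[of _ b] borel_imp_measurable_U bumpsD(1) g) auto
  qed
  have "r \<le> (1/K) * orlicz_norm M (g n)"
    using bump_norm_ge[OF g g_space] K by (simp add: r_def field_simps)
  also have "\<dots> = orlicz_norm M (\<lambda>t. x t * indicator E t)"
    unfolding restr using orlicz_norm_cmult[OF g_space, of "1/K"] K by simp
  finally have "ennreal r \<le> ennreal (orlicz_norm M (\<lambda>t. x t * indicator E t))" by (rule ennreal_leI)
  also have "\<dots> \<le> (SUP x\<in>{x \<in> H. orlicz_norm M x \<le> 1}. ennreal (orlicz_norm M (\<lambda>t. x t * indicator E t)))"
    using xH x1 by (intro SUP_upper) simp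
  also have "\<dots> \<le> ?sup \<delta>"
    using E mE by (intro SUP_upper[of E]) simp
  finally show False using \<delta>(1) by simp
qed

lemma strongly_embedded_not_equi_absolutely_continuous:
  "\<exists>H. closed_subspace M H \<and> strongly_embedded M H \<and>
     \<not> equi_absolutely_continuous_norms M {x \<in> H. orlicz_norm M x \<le> 1}"
proof -
  obtain g where g: "bumps g" by (rule bumps_exist)
  obtain K where K: "\<And>c m. weight c m \<le> 1/4 \<Longrightarrow> orlicz_norm M (combination g c m) \<le> K"
    using combination_norm_bound g by blast
  let ?S = "combinations g"
  have S: "?S \<subseteq> orlicz_space M" "linear_family ?S"
    using combinations_subset[OF g] linear_family_combinations by auto
  have "strongly_embedded M (orlicz_closure M ?S)"
  proof (rule strongly_embedded_closure[OF S, of "1/256" K])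
    fix s assume s: "s \<in> ?S" "measure \<U> {t \<in> {0..1}. \<bar>s t\<bar> > 1/256} \<le> 1/256"
    then obtain c m where "s = combination g c m" by (auto simp: combinations_def)
    with s show "orlicz_norm M s \<le> K" using small_in_measure_imp_weight_le[OF g] K by blast
  qed simp
  then show ?thesis
    using closed_subspace_closure[OF S] not_equi_absolutely_continuous[OF g orlicz_closure_subset[OF S(1)]] by blast
qed

end

theorem theorem2:
  fixes M :: "real \<Rightarrow> real"
  assumes "orlicz_function M"
    and "Delta2_infinity (\<lambda>u. ereal (M u))"
    and "Delta2_infinity (young_conjugate M)"
    and "\<exists>\<psi>\<in>C_infinity M.
           (\<lambda>t. 1 / inv_into {0..1} \<psi> t) \<in> orlicz_space M \<and>
           (\<exists>C>0. \<forall>u\<in>{0..1}. \<forall>v\<in>{0..1}. \<psi> (u * v) \<le> C * \<psi> u * \<psi> v)"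
  shows "\<exists>H. closed_subspace M H \<and> strongly_embedded M H \<and>
           \<not> equi_absolutely_continuous_norms M {x \<in> H. orlicz_norm M x \<le> 1}"
proof -
  interpret orlicz M by unfold_locales (fact assms(1))
  obtain D where D: "D \<ge> 1" "\<And>r b. \<lbrakk>0 \<le> r; 1 \<le> b\<rbrakk> \<Longrightarrow> M (r * b) \<le> D * exp r * M b"
    using exponential_growth[OF Delta2_infinity_imp_doubling[OF assms(2)]] by blast
  from assms(4) obtain \<psi> C where \<psi>: "\<psi> \<in> C_infinity M"
    "(\<lambda>t. 1 / inv_into {0..1} \<psi> t) \<in> orlicz_space M" "C > 0"
    "\<And>u v. \<lbrakk>u \<in> {0..1}; v \<in> {0..1}\<rbrakk> \<Longrightarrow> \<psi> (u * v) \<le> C * \<psi> u * \<psi> v"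
    by blast
  interpret submultiplicative_limit M D \<psi> C
    by unfold_locales (use D \<psi> in auto)
  show ?thesis by (rule strongly_embedded_not_equi_absolutely_continuous)
qed

end
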